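(* Let $d\ge 1$, let $\Omega\subseteq\mathbb{R}^d$ be a domain, let $\nu>0$, let $f\in C^1(\Omega\times[0,\infty))$, let $h_0>0$ and $r'>1$, let $r=\frac{r'}{r'-1}$ be the conjugate exponent, and let $H(p)=\frac{h_0}{r'}|p|^{r'}$ for $p\in\mathbb{R}^d$ (so $DH(p)=h_0|p|^{r'-2}p$). Set $\mu=\nu\left(\frac{\nu r}{h_0}\right)^{r-1}$. (a) Let $(u,m,\lambda)$ be a solution of the MFG system (in the sense defined in the context). If $$\nu Dm + h_0\, m\, |Du|^{r'-2}Du = 0 \quad\text{a.e. in }\Omega,$$ then, with $\varphi:=m^{1/r}$ in $\Omega$, the pair $(\varphi,\lambda)$ is a solution of the $r$-Laplace problem (in the sense defined in the context). (b) Let $(\varphi,\lambda)$ be a solution of the $r$-Laplace problem, and suppose there exists $u\in C^1(\Omega)$ such that $$h_0\,\varphi\,|Du|^{r'-2}Du + \nu r\, D\varphi = 0 \quad\text{in }\Omega.$$ Then $(u,m,\lambda)$, with $m:=\varphi^r$ in $\Omega$, is a solution of the MFG system.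
   Context: The MFG system is $$-\nu\Delta u + H(Du) + \lambda = f(x,m(x))\ \text{in }\Omega,\qquad -\nu\Delta m - \operatorname{div}(DH(Du)\,m)=0\ \text{in }\Omega,\qquad \int_\Omega m\,dx=1,\ m\ge 0.$$ A triple $(u,m,\lambda)\in C^2(\Omega)\times W^{1,2}_{\mathrm{loc}}(\Omega)\times\mathbb{R}$ is a (local) solution of the MFG system if $\int_\Omega m=1$, $m\ge0$, $u,\lambda$ satisfy the first equation pointwise in $\Omega$, and $m$ satisfies the second equation weakly: $\nu\int_\Omega Dm\cdot D\xi+\int_\Omega m\,DH(Du)\cdot D\xi=0$ for all $\xi\in C_0^\infty(\Omega)$. The $r$-Laplace problem is $$-\mu\Delta_r\varphi + (f(x,\varphi^r)-\lambda)\varphi^{r-1}=0\ \text{in }\Omega,\qquad \int_\Omega\varphi^r\,dx=1,\ \varphi>0,$$ where $\Delta_r\varphi=\operatorname{div}(|D\varphi|^{r-2}D\varphi)$. A pair $(\varphi,\lambda)\in (W^{1,r}_{\mathrm{loc}}(\Omega)\cap L^\infty_{\mathrm{loc}}(\Omega))\times\mathbb{R}$ is a solution if $\int_\Omega\varphi^r=1$, $\varphi>0$, and $\mu\int_\Omega|D\varphi|^{r-2}D\varphi\cdot D\xi+\int_\Omega(f(x,\varphi^r)-\lambda)\varphi^{r-1}\xi=0$ for all $\xi\in C_0^\infty(\Omega)$. *)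

theory Defs
  imports "HOL-Analysis.Analysis"
begin

definition partial :: "'n::finite \<Rightarrow> (real^'n \<Rightarrow> real) \<Rightarrow> real^'n \<Rightarrow> real" where
  "partial i f x = frechet_derivative f (at x) (axis i 1)"

definition grad :: "(real^'n::finite \<Rightarrow> real) \<Rightarrow> real^'n \<Rightarrow> real^'n" where
  "grad f x = (\<chi> i. partial i f x)"

definition laplacian :: "(real^'n::finite \<Rightarrow> real) \<Rightarrow> real^'n \<Rightarrow> real" where
  "laplacian f x = (\<Sum>i\<in>UNIV. partial i (partial i f) x)"

fun ipartial :: "'n::finite list \<Rightarrow> (real^'n \<Rightarrow> real) \<Rightarrow> real^'n \<Rightarrow> real" where
  "ipartial [] f = f"
| "ipartial (i # is) f = partial i (ipartial is f)"

definition C1_on :: "(real^'n::finite) set \<Rightarrow> (real^'n \<Rightarrow> real) \<Rightarrow> bool" where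
  "C1_on U f \<longleftrightarrow> (\<forall>x\<in>U. f differentiable (at x)) \<and> (\<forall>i. continuous_on U (partial i f))"

definition C2_on :: "(real^'n::finite) set \<Rightarrow> (real^'n \<Rightarrow> real) \<Rightarrow> bool" where
  "C2_on U f \<longleftrightarrow> C1_on U f \<and> (\<forall>i. C1_on U (partial i f))"

definition smooth_fun_on :: "(real^'n::finite) set \<Rightarrow> (real^'n \<Rightarrow> real) \<Rightarrow> bool" where
  "smooth_fun_on U f \<longleftrightarrow>
     (\<forall>is. (\<forall>x\<in>U. ipartial is f differentiable (at x)) \<and> continuous_on U (ipartial is f))"

definition test_fun :: "(real^'n::finite) set \<Rightarrow> (real^'n \<Rightarrow> real) \<Rightarrow> bool" where
  "test_fun \<Omega> \<xi> \<longleftrightarrow> smooth_fun_on UNIV \<xi> \<and> compact (closure {x. \<xi> x \<noteq> 0})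
     \<and> closure {x. \<xi> x \<noteq> 0} \<subseteq> \<Omega>"

definition C1_halfline :: "(real^'n::finite) set \<Rightarrow> (real^'n \<Rightarrow> real \<Rightarrow> real) \<Rightarrow> bool" where
  "C1_halfline \<Omega> f \<longleftrightarrow> (\<exists>(fx :: (real^'n) \<times> real \<Rightarrow> real^'n) (ft :: (real^'n) \<times> real \<Rightarrow> real).
      continuous_on (\<Omega> \<times> {0..}) fx \<and> continuous_on (\<Omega> \<times> {0..}) ft \<and>
      (\<forall>z\<in>\<Omega> \<times> {0..}. ((\<lambda>(x, t). f x t) has_derivative (\<lambda>(h, s). fx z \<bullet> h + ft z * s))
                          (at z within \<Omega> \<times> {0..})))"

definition Lp_loc :: "(real^'n::finite) set \<Rightarrow> real \<Rightarrow> (real^'n \<Rightarrow> real) \<Rightarrow> bool" where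
  "Lp_loc \<Omega> p v \<longleftrightarrow> set_borel_measurable lborel \<Omega> v \<and>
     (\<forall>K. compact K \<and> K \<subseteq> \<Omega> \<longrightarrow> set_integrable lborel K (\<lambda>x. \<bar>v x\<bar> powr p))"

definition Linf_loc :: "(real^'n::finite) set \<Rightarrow> (real^'n \<Rightarrow> real) \<Rightarrow> bool" where
  "Linf_loc \<Omega> v \<longleftrightarrow> set_borel_measurable lborel \<Omega> v \<and>
     (\<forall>K. compact K \<and> K \<subseteq> \<Omega> \<longrightarrow> (\<exists>C. AE x in lborel. x \<in> K \<longrightarrow> \<bar>v x\<bar> \<le> C))"

definition weak_grad :: "(real^'n::finite) set \<Rightarrow> (real^'n \<Rightarrow> real) \<Rightarrow> (real^'n \<Rightarrow> real^'n) \<Rightarrow> bool" where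
  "weak_grad \<Omega> v g \<longleftrightarrow> Lp_loc \<Omega> 1 v \<and> (\<forall>i. Lp_loc \<Omega> 1 (\<lambda>x. g x $ i)) \<and>
     (\<forall>\<xi>. test_fun \<Omega> \<xi> \<longrightarrow> (\<forall>i.
        (LINT x:\<Omega>|lborel. v x * partial i \<xi> x) = - (LINT x:\<Omega>|lborel. g x $ i * \<xi> x)))"

definition W1p_grad :: "(real^'n::finite) set \<Rightarrow> real \<Rightarrow> (real^'n \<Rightarrow> real) \<Rightarrow> (real^'n \<Rightarrow> real^'n) \<Rightarrow> bool" where
  "W1p_grad \<Omega> p v g \<longleftrightarrow> weak_grad \<Omega> v g \<and> Lp_loc \<Omega> p v \<and> Lp_loc \<Omega> p (\<lambda>x. norm (g x))"

definition mfg_solution ::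
  "(real^'n::finite) set \<Rightarrow> real \<Rightarrow> (real^'n \<Rightarrow> real) \<Rightarrow> (real^'n \<Rightarrow> real^'n)
   \<Rightarrow> (real^'n \<Rightarrow> real \<Rightarrow> real) \<Rightarrow> (real^'n \<Rightarrow> real) \<Rightarrow> (real^'n \<Rightarrow> real) \<Rightarrow> real \<Rightarrow> bool" where
  "mfg_solution \<Omega> \<nu> H DH f u m lam \<longleftrightarrow>
     C2_on \<Omega> u \<and>
     (LINT x:\<Omega>|lborel. m x) = 1 \<and> (\<forall>x\<in>\<Omega>. m x \<ge> 0) \<and>
     (\<forall>x\<in>\<Omega>. - \<nu> * laplacian u x + H (grad u x) + lam = f x (m x)) \<and>
     (\<exists>g. W1p_grad \<Omega> 2 m g \<and>
        (\<forall>\<xi>. test_fun \<Omega> \<xi> \<longrightarrow>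
           \<nu> * (LINT x:\<Omega>|lborel. g x \<bullet> grad \<xi> x)
           + (LINT x:\<Omega>|lborel. m x * (DH (grad u x) \<bullet> grad \<xi> x)) = 0))"

definition rlap_solution ::
  "(real^'n::finite) set \<Rightarrow> real \<Rightarrow> real \<Rightarrow> (real^'n \<Rightarrow> real \<Rightarrow> real)
   \<Rightarrow> (real^'n \<Rightarrow> real) \<Rightarrow> real \<Rightarrow> bool" where
  "rlap_solution \<Omega> \<mu> r f \<phi> lam \<longleftrightarrow>
     Linf_loc \<Omega> \<phi> \<and>
     (LINT x:\<Omega>|lborel. \<phi> x powr r) = 1 \<and> (AE x in lborel. x \<in> \<Omega> \<longrightarrow> \<phi> x > 0) \<and>
     (\<exists>g. W1p_grad \<Omega> r \<phi> g \<and>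
        (\<forall>\<xi>. test_fun \<Omega> \<xi> \<longrightarrow>
           \<mu> * (LINT x:\<Omega>|lborel. norm (g x) powr (r - 2) * (g x \<bullet> grad \<xi> x))
           + (LINT x:\<Omega>|lborel. (f x (\<phi> x powr r) - lam) * \<phi> x powr (r - 1) * \<xi> x) = 0))"

end

theory Submission
  imports Defs
begin

text \<open>
  Writing $c = h_0/(\nu r)$, the pointwise relation says $D\varphi = -c\,\varphi\,|Du|^{r'-2}Du$, so that
  $|D\varphi|^{r-2}D\varphi = -c^{r-1}\varphi^{r-1}Du$ and $\mu c^{r-1} = \nu$: the $r$-Laplace equation becomes
  $\nu\,\mathrm{div}(\varphi^{r-1}Du) + (f-\lambda)\varphi^{r-1} = 0$, and dividing by $\varphi^{r-1}$ gives the
  Hamilton-Jacobi equation. Two regularity facts make this rigorous.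

  First, a nonnegative weak solution of $Dm = -m\,b$ with $b$ continuous has a $C^1$ representative that is
  either positive or zero. Second, in the converse direction $u$ is only $C^1$ with $\nu\Delta u = H(Du)+\lambda-f$
  weakly, and one needs $u\in C^2$.

  Both follow by mollifying with $\rho_t$ and differentiating in the scale $t$. The mollifier is chosen so that
  $\partial_t\rho_t = t\,\Delta\kappa_t$ with $D\kappa_t(z) = -(z/t^2)\rho_t(z)$, $\kappa_t$ compactly supported.
  Hence $\partial_t(\rho_t * m) = O(\rho_t * m)$ in the first problem, and
  $\partial_t(\rho_t * \partial_j u) = t\,\partial_j\kappa_t * \Delta u$ in the second; the latter gives
  $Du\in C^{1/2}$, hence $\Delta u \in C^{1/2}$, hence uniform convergence of $D^2(\rho_t * u)$ as $t\to 0$.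
\<close>

text \<open>The obstacle is that the data are known only almost everywhere, whereas the conclusions
  are pointwise. Positivity of m is not given in (a), and in (b) the relation only expresses Du as a
  continuous function of D\<phi>/\<phi>, which says nothing about second derivatives of u.

  The scale identity comes from dilation invariance: the derivative in t of t^(-n) \<rho>(z/t) is
  -div(z \<rho>_t)/t, so a \<kappa>_t with D\<kappa>_t = -(z/t^2) \<rho>_t turns it into t
  \<Delta>\<kappa>_t. The Gaussian has the same property but no compact support. Building \<rho>
  from the derivative of exp(-1/s) at s = 1 - |z|^2/t^2 keeps both kernels compactly supported, so
  local weak equations may be tested with them.

  Dividing by \<phi>^(r-1) means testing with \<phi>^(1-r) \<xi>, which is only C^1; weak divergence
  equations are therefore extended to such test functions.

  The exponent 1/2 is a convenience: bounded \<Delta>u gives the rate 1/t for the scale derivative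
  of D^2(\<rho>_t * u), hence only a logarithmic bound, which is weakened to t^(-1/2).\<close>

section \<open>Partial derivatives and gradients read off from Frechet derivatives\<close>

lemma partial_eqI: "(f has_derivative f') (at x) \<Longrightarrow> partial i f x = f' (axis i 1)"
  unfolding partial_def by (metis frechet_derivative_at)

lemma partial_eqI_grad: "(f has_derivative (\<lambda>h. v \<bullet> h)) (at x) \<Longrightarrow> partial i f x = v $ i"
  by (drule partial_eqI) (simp add: inner_axis)

lemma has_derivative_grad:
  fixes f :: "real^'n::finite \<Rightarrow> real"
  assumes "f differentiable (at x)"
  shows "(f has_derivative (\<lambda>h. grad f x \<bullet> h)) (at x)"
proof -
  obtain f' where f': "(f has_derivative f') (at x)" using assms differentiable_def by blast
  interpret bounded_linear f' using f' by (rule has_derivative_bounded_linear)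
  have "f' h = grad f x \<bullet> h" for h
  proof -
    have "f' h = f' (\<Sum>i\<in>UNIV. (h $ i) *\<^sub>R axis i 1)"
      by (metis basis_expansion scalar_mult_eq_scaleR)
    also have "\<dots> = (\<Sum>i\<in>UNIV. h $ i * f' (axis i 1))"
      by (simp add: sum scale)
    also have "\<dots> = grad f x \<bullet> h"
      unfolding inner_vec_def grad_def by (simp add: partial_eqI[OF f'] mult.commute)
    finally show ?thesis .
  qed
  then show ?thesis using f' by (metis (no_types, lifting) ext)
qed

lemma grad_nth [simp]: "grad f x $ i = partial i f x"
  by (simp add: grad_def)

lemma grad_eqI: "(f has_derivative (\<lambda>h. v \<bullet> h)) (at x) \<Longrightarrow> grad f x = v"
  by (simp add: vec_eq_iff partial_eqI_grad)

text \<open>\<open>frechet_derivative\<close> is a choice operator, so the proof shows that both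
  functions admit the same derivatives at \<open>x\<close>; this also covers points where neither is
  differentiable.\<close>

lemma partial_cong_open:
  assumes "open U" "x \<in> U" "\<And>y. y \<in> U \<Longrightarrow> f y = g y"
  shows "partial i f x = partial i g x"
proof -
  have "(f has_derivative D) (at x) \<longleftrightarrow> (g has_derivative D) (at x)" for D
    using assms by (metis has_derivative_transform_within_open)
  then show ?thesis unfolding partial_def frechet_derivative_def by simp
qed

subsection \<open>Flat functions\<close>

definition flat :: "nat \<Rightarrow> real \<Rightarrow> real" where
  "flat k s = (if s > 0 then exp (- 1 / s) / s ^ k else 0)"

lemma flat_tendsto_0: "(flat k \<longlongrightarrow> 0) (at_right 0)"
proof -
  have "((\<lambda>y::real. y ^ k / exp y) \<longlongrightarrow> 0) at_top"
    by (rule tendsto_power_div_exp_0)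
  then have "((\<lambda>s::real. inverse s ^ k / exp (inverse s)) \<longlongrightarrow> 0) (at_right 0)"
    by (rule filterlim_compose[OF _ filterlim_inverse_at_top_right])
  moreover have "\<forall>\<^sub>F s in at_right 0. inverse s ^ k / exp (inverse s) = flat k s"
    unfolding eventually_at_filter
    by (rule always_eventually) (simp add: flat_def exp_minus divide_inverse power_inverse mult.commute)
  ultimately show ?thesis by (rule Lim_transform_eventually)
qed

text \<open>For s > 0 this is d/ds (exp(-1/s) s^(-k)) = exp(-1/s) (s^(-k-2) - k s^(-k-1)). At 0 the
  right difference quotient is \<open>flat (k+1)\<close>, which tends to 0, and the left one
  vanishes.\<close>

lemma flat_has_derivative:
  "(flat k has_real_derivative (flat (Suc (Suc k)) s - k * flat (Suc k) s)) (at s)"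
proof (cases s "0::real" rule: linorder_cases)
  case less
  have "((\<lambda>_. 0) has_real_derivative 0) (at s)" by simp
  then have "(flat k has_real_derivative 0) (at s)"
    by (rule has_field_derivative_transform_within_open[where S = "{..<0}"])
       (use less in \<open>auto simp: flat_def\<close>)
  then show ?thesis using less by (simp add: flat_def)
next
  case greater
  \<comment> \<open>For \<open>k = 0\<close> the truncated exponent \<open>k - 1\<close> is harmless
    because its factor \<open>k\<close> is zero.\<close>
  have "((\<lambda>s. exp (- 1 / s) / s ^ k) has_real_derivative 
      (exp (- 1 / s) * (1 / s\<^sup>2) * s ^ k - exp (- 1 / s) * (k * s ^ (k - 1))) / (s ^ k * s ^ k)) (at s)"
    using greater by (auto intro!: derivative_eq_intros) (cases k; simp add: power2_eq_square)
  also have "(exp (- 1 / s) * (1 / s\<^sup>2) * s ^ k - exp (- 1 / s) * (k * s ^ (k - 1))) / (s ^ k * s ^ k)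
     = flat (Suc (Suc k)) s - k * flat (Suc k) s"
  proof (cases k)
    case 0
    then show ?thesis using greater by (simp add: flat_def power2_eq_square)
  next
    case (Suc j)
    have "(e * (1 / s\<^sup>2) * s ^ k - e * (k * s ^ j)) / (s ^ k * s ^ k)
        = e / s ^ Suc (Suc k) - k * (e / s ^ Suc k)" for e :: real
    proof -
      have "(e * (1 / s\<^sup>2) * s ^ k) / (s ^ k * s ^ k) = e / s ^ Suc (Suc k)"
        using greater by (simp add: power2_eq_square field_simps)
      moreover have "(e * (k * s ^ j)) / (s ^ k * s ^ k) = k * (e / s ^ Suc k)"
        using greater Suc by (simp add: field_simps)
      ultimately show ?thesis by (simp only: diff_divide_distrib)
    qed
    then show ?thesis using greater Suc by (simp add: flat_def del: power_Suc of_nat_Suc)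
  qed
  finally show ?thesis
    by (rule has_field_derivative_transform_within_open[where S = "{0<..}"])
       (use greater in \<open>auto simp: flat_def\<close>)
next
  case equal
  have "((\<lambda>y. (flat k y - flat k 0) / (y - 0)) \<longlongrightarrow> 0) (at 0)"
  proof (subst filterlim_at_split, intro conjI)
    have "\<forall>\<^sub>F y in at_left 0. 0 = (flat k y - flat k 0) / (y - 0)"
      by (auto simp: flat_def eventually_at_filter)
    then show "((\<lambda>y. (flat k y - flat k 0) / (y - 0)) \<longlongrightarrow> 0) (at_left 0)"
      by (rule Lim_transform_eventually[OF tendsto_const])
    have "\<forall>\<^sub>F y in at_right 0. flat (k+1) y = (flat k y - flat k 0) / (y - 0)"
      by (auto simp: flat_def eventually_at_filter)
    then show "((\<lambda>y. (flat k y - flat k 0) / (y - 0)) \<longlongrightarrow> 0) (at_right 0)"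
      by (rule Lim_transform_eventually[OF flat_tendsto_0])
  qed
  then have "(flat k has_real_derivative 0) (at 0)"
    by (simp add: has_field_derivative_iff)
  then show ?thesis using equal by (simp add: flat_def)
qed

text \<open>The $k$-th derivative of $s\mapsto e^{-1/s}$, extended by $0$ to $s\le 0$.\<close>

definition eflat :: "nat \<Rightarrow> real \<Rightarrow> real" where
  "eflat k = (deriv ^^ k) (flat 0)"

text \<open>One differentiation raises the index of \<open>flat\<close> by at most two, whence the
  range up to \<open>2*k\<close>.\<close>

lemma eflat_decomp: "\<exists>c. eflat k = (\<lambda>s. \<Sum>j\<le>2*k. c j * flat j s)"
proof (induction k)
  case 0
  show ?case by (rule exI[of _ "\<lambda>_. 1"]) (simp add: eflat_def fun_eq_iff)
next
  case (Suc k)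
  then obtain c where c: "eflat k = (\<lambda>s. \<Sum>j\<le>2*k. c j * flat j s)" by blast
  \<comment> \<open>This encodes the recurrence d_i = c_(i-2) - (i-1) c_(i-1), with coefficients out
    of range read as 0; the sum over \<open>j\<close> avoids truncated subtraction for small
    \<open>i\<close>.\<close>
  define d where "d i = (\<Sum>j\<le>2*k. c j * (of_bool (i = j + 2) - real j * of_bool (i = j + 1)))" for i
  have "deriv (eflat k) s = (\<Sum>i\<le>2*Suc k. d i * flat i s)" for s
  proof -
    have "(eflat k has_real_derivative (\<Sum>j\<le>2*k. c j * (flat (Suc (Suc j)) s - j * flat (Suc j) s))) (at s)"
      unfolding c by (auto intro!: DERIV_sum DERIV_cmult flat_has_derivative)
    then have "deriv (eflat k) s = (\<Sum>j\<le>2*k. c j * (flat (Suc (Suc j)) s - j * flat (Suc j) s))"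
      by (rule DERIV_imp_deriv)
    also have "\<dots> = (\<Sum>j\<le>2*k. \<Sum>i\<le>2*Suc k. c j * (of_bool (i = j + 2) - real j * of_bool (i = j + 1)) * flat i s)"
    proof (rule sum.cong)
      fix j assume "j \<in> {..2*k}"
      define A where "A = {..2 * Suc k}"
      have fin: "finite A" and mem: "Suc (Suc j) \<in> A" "Suc j \<in> A"
        using \<open>j \<in> {..2*k}\<close> by (auto simp: A_def)
      have "(\<Sum>i\<in>A. c j * (of_bool (i = j + 2) - real j * of_bool (i = j + 1)) * flat i s)
         = c j * ((\<Sum>i\<in>A. (if i = Suc (Suc j) then flat i s else 0)) - j * (\<Sum>i\<in>A. (if i = Suc j then flat i s else 0)))"
        unfolding sum_distrib_left sum_subtractf[symmetric]
        by (rule sum.cong) (auto simp: algebra_simps)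
      also have "\<dots> = c j * (flat (Suc (Suc j)) s - j * flat (Suc j) s)"
        using fin mem by (simp add: sum.delta)
      finally show "c j * (flat (Suc (Suc j)) s - j * flat (Suc j) s)
        = (\<Sum>i\<le>2*Suc k. c j * (of_bool (i = j + 2) - real j * of_bool (i = j + 1)) * flat i s)" by (simp only: A_def)
    qed simp
    also have "\<dots> = (\<Sum>i\<le>2*Suc k. d i * flat i s)"
      by (subst sum.swap) (simp add: d_def sum_distrib_right)
    finally show ?thesis .
  qed
  then show ?case by (intro exI[of _ d]) (simp add: eflat_def fun_eq_iff)
qed

text \<open>The finite expansion in \<open>flat\<close> supplies differentiability, so that the
  iterated \<open>deriv\<close> in the definition is a genuine derivative at every order.\<close>

lemma eflat_has_derivative: "(eflat k has_real_derivative eflat (Suc k) s) (at s)"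
proof -
  obtain c where c: "eflat k = (\<lambda>s. \<Sum>j\<le>2*k. c j * flat j s)" using eflat_decomp by blast
  have "(eflat k has_real_derivative (\<Sum>j\<le>2*k. c j * (flat (Suc (Suc j)) s - j * flat (Suc j) s))) (at s)"
    unfolding c by (auto intro!: DERIV_sum DERIV_cmult flat_has_derivative)
  then have "(eflat k has_real_derivative deriv (eflat k) s) (at s)"
    by (metis DERIV_imp_deriv)
  then show ?thesis by (simp add: eflat_def)
qed

lemma eflat_nonpos: "s \<le> 0 \<Longrightarrow> eflat k s = 0"
  using eflat_decomp[of k] by (auto simp: flat_def)

lemma eflat_0: "eflat 0 s = (if s > 0 then exp (- 1 / s) else 0)"
  by (simp add: eflat_def flat_def)

lemma eflat_1: "eflat (Suc 0) s = (if s > 0 then exp (- 1 / s) / s^2 else 0)"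
proof -
  have "eflat (Suc 0) s = flat (Suc (Suc 0)) s"
    using DERIV_imp_deriv[OF flat_has_derivative[of 0 s]] by (simp add: eflat_def)
  then show ?thesis by (simp add: flat_def power2_eq_square)
qed

lemma continuous_on_eflat [continuous_intros]:
  "continuous_on A f \<Longrightarrow> continuous_on A (\<lambda>x. eflat k (f x))"
proof -
  have "continuous_on UNIV (eflat k)"
    by (meson DERIV_continuous_on eflat_has_derivative has_field_derivative_at_within)
  then show "continuous_on A f \<Longrightarrow> continuous_on A (\<lambda>x. eflat k (f x))"
    by (metis continuous_on_compose2 subset_UNIV)
qed

lemma eflat_measurable [measurable]: "eflat k \<in> borel_measurable borel"
  by (rule borel_measurable_continuous_onI, rule continuous_on_eflat, rule continuous_on_id)

text \<open>Arguments up to 1 suffice: the kernels evaluate \<open>eflat\<close> only at 1 -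
  |z|^2/t^2.\<close>

lemma eflat_bounded: "\<exists>C\<ge>0. \<forall>s\<le>1. \<bar>eflat k s\<bar> \<le> C"
proof -
  have "compact (eflat k ` {0..1})"
    by (intro compact_continuous_image continuous_on_eflat continuous_on_id) auto
  then obtain C where C: "\<And>y. y \<in> eflat k ` {0..1} \<Longrightarrow> \<bar>y\<bar> \<le> C"
    by (meson bounded_real compact_imp_bounded)
  have "C \<ge> 0" using C[of "eflat k 0"] by auto
  moreover have "\<bar>eflat k s\<bar> \<le> C" if "s \<le> 1" for s
    using C[of "eflat k s"] that \<open>C \<ge> 0\<close> eflat_nonpos[of s k] by (cases "s \<le> 0") auto
  ultimately show ?thesis by blast
qed

subsection \<open>A class of smooth functions closed under partial derivatives\<close>

text \<open>All test functions constructed below, box bumps and mollification kernels alike, are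
  polynomials in coordinates combined with \<open>eflat\<close>. For this class smoothness of every
  order, and later the symmetry of second derivatives, reduces to a structural induction.\<close>

inductive smooth_elem :: "(real^'n::finite \<Rightarrow> real) \<Rightarrow> bool" where
  smooth_elem_const: "smooth_elem (\<lambda>_. c)"
| smooth_elem_coord: "smooth_elem (\<lambda>x. x $ i)"
| smooth_elem_add: "smooth_elem f \<Longrightarrow> smooth_elem g \<Longrightarrow> smooth_elem (\<lambda>x. f x + g x)"
| smooth_elem_mult: "smooth_elem f \<Longrightarrow> smooth_elem g \<Longrightarrow> smooth_elem (\<lambda>x. f x * g x)"
| smooth_elem_eflat: "smooth_elem f \<Longrightarrow> smooth_elem (\<lambda>x. eflat k (f x))"

lemma smooth_elem_diff: "smooth_elem f \<Longrightarrow> smooth_elem g \<Longrightarrow> smooth_elem (\<lambda>x. f x - g x)"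
  using smooth_elem_add[OF _ smooth_elem_mult[OF smooth_elem_const[of "-1"]], of f g] by simp

lemma smooth_elem_minus: "smooth_elem f \<Longrightarrow> smooth_elem (\<lambda>x. - f x)"
  using smooth_elem_mult[OF smooth_elem_const[of "-1"], of f] by simp

lemma smooth_elem_divide_const: "smooth_elem f \<Longrightarrow> smooth_elem (\<lambda>x. f x / c)"
  using smooth_elem_mult[OF _ smooth_elem_const[of "1/c"], of f] by simp

lemma smooth_elem_power: "smooth_elem f \<Longrightarrow> smooth_elem (\<lambda>x. f x ^ k)"
  by (induction k) (auto intro: smooth_elem.intros)

lemma smooth_elem_sum: "(\<And>i. i \<in> A \<Longrightarrow> smooth_elem (f i)) \<Longrightarrow> smooth_elem (\<lambda>x. \<Sum>i\<in>A. f i x)"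
  by (induction A rule: infinite_finite_induct) (auto intro: smooth_elem.intros)

lemma smooth_elem_prod: "(\<And>i. i \<in> A \<Longrightarrow> smooth_elem (f i)) \<Longrightarrow> smooth_elem (\<lambda>x. \<Prod>i\<in>A. f i x)"
  by (induction A rule: infinite_finite_induct) (auto intro: smooth_elem.intros)

lemmas smooth_elem_intros = smooth_elem.intros smooth_elem_diff smooth_elem_minus smooth_elem_divide_const smooth_elem_power smooth_elem_sum smooth_elem_prod

lemma smooth_elem_has_derivative:
  fixes f :: "real^'n::finite \<Rightarrow> real"
  assumes "smooth_elem f"
  shows "\<exists>g. (\<forall>x. (f has_derivative (\<lambda>h. g x \<bullet> h)) (at x)) \<and> (\<forall>i. smooth_elem (\<lambda>x. g x $ i))"
  using assms
proof induction
  case (smooth_elem_const c)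
  show ?case by (rule exI[of _ "\<lambda>_. 0"]) (auto intro: smooth_elem_intros)
next
  case (smooth_elem_coord i)
  show ?case
    by (rule exI[of _ "\<lambda>_. axis i 1"])
       (auto intro: smooth_elem_intros simp: inner_axis' bounded_linear_vec_nth intro!: bounded_linear_imp_has_derivative)
next
  case (smooth_elem_add f1 f2)
  then obtain g1 g2 where g: "\<forall>x. (f1 has_derivative (\<lambda>h. g1 x \<bullet> h)) (at x)" "\<forall>i. smooth_elem (\<lambda>x. g1 x $ i)"
    "\<forall>x. (f2 has_derivative (\<lambda>h. g2 x \<bullet> h)) (at x)" "\<forall>i. smooth_elem (\<lambda>x. g2 x $ i)" by blast
  show ?case
    by (rule exI[of _ "\<lambda>x. g1 x + g2 x"])
       (use g in \<open>auto intro!: smooth_elem_intros has_derivative_add simp: inner_add_left\<close>)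
next
  case (smooth_elem_mult f1 f2)
  then obtain g1 g2 where g: "\<forall>x. (f1 has_derivative (\<lambda>h. g1 x \<bullet> h)) (at x)" "\<forall>i. smooth_elem (\<lambda>x. g1 x $ i)"
    "\<forall>x. (f2 has_derivative (\<lambda>h. g2 x \<bullet> h)) (at x)" "\<forall>i. smooth_elem (\<lambda>x. g2 x $ i)" by blast
  have "((\<lambda>x. f1 x * f2 x) has_derivative (\<lambda>h. (f1 x *\<^sub>R g2 x + f2 x *\<^sub>R g1 x) \<bullet> h)) (at x)" for x
    by (rule has_derivative_eq_rhs, rule has_derivative_mult, use g in blast, use g in blast)
       (simp add: inner_add_left fun_eq_iff)
  then show ?case
    by (intro exI[of _ "\<lambda>x. f1 x *\<^sub>R g2 x + f2 x *\<^sub>R g1 x"])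
       (use g smooth_elem_mult in \<open>auto intro!: smooth_elem_intros\<close>)
next
  case (smooth_elem_eflat f1 k)
  then obtain g1 where g: "\<forall>x. (f1 has_derivative (\<lambda>h. g1 x \<bullet> h)) (at x)" "\<forall>i. smooth_elem (\<lambda>x. g1 x $ i)"
    by blast
  have "((\<lambda>x. eflat k (f1 x)) has_derivative (\<lambda>h. (eflat (Suc k) (f1 x) *\<^sub>R g1 x) \<bullet> h)) (at x)" for x
  proof -
    have "(eflat k has_derivative (*) (eflat (Suc k) (f1 x))) (at (f1 x))"
      using eflat_has_derivative has_field_derivative_def by blast
    from has_derivative_compose[OF g(1)[rule_format, of x] this] show ?thesis
      by simp
  qed
  then show ?case
    by (intro exI[of _ "\<lambda>x. eflat (Suc k) (f1 x) *\<^sub>R g1 x"])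
       (use g smooth_elem_eflat in \<open>auto intro!: smooth_elem_intros\<close>)
qed

lemma smooth_elem_differentiable: "smooth_elem f \<Longrightarrow> f differentiable (at x)"
  using smooth_elem_has_derivative differentiable_def by blast

lemma smooth_elem_partial:
  assumes "smooth_elem f" shows "smooth_elem (partial i f)"
proof -
  obtain g where g: "\<forall>x. (f has_derivative (\<lambda>h. g x \<bullet> h)) (at x)" "\<forall>i. smooth_elem (\<lambda>x. g x $ i)"
    using smooth_elem_has_derivative[OF assms] by blast
  then have "partial i f = (\<lambda>x. g x $ i)" by (auto simp: partial_eqI_grad)
  with g show ?thesis by simp
qed

lemma smooth_elem_continuous_on: "smooth_elem f \<Longrightarrow> continuous_on A f"
  by (meson continuous_at_imp_continuous_on differentiable_imp_continuous_within smooth_elem_differentiable)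

lemma smooth_elem_ipartial: "smooth_elem f \<Longrightarrow> smooth_elem (ipartial is f)"
  by (induction "is") (auto intro: smooth_elem_partial)

lemma smooth_elem_smooth: "smooth_elem f \<Longrightarrow> smooth_fun_on U f"
  unfolding smooth_fun_on_def by (auto intro: smooth_elem_continuous_on smooth_elem_differentiable smooth_elem_ipartial)

lemma smooth_elem_test_fun:
  assumes "smooth_elem f" "compact K" "K \<subseteq> \<Omega>" "\<And>x. x \<notin> K \<Longrightarrow> f x = 0"
  shows "test_fun \<Omega> f"
proof -
  have "closure {x. f x \<noteq> 0} \<subseteq> K"
    by (rule closure_minimal) (use assms in \<open>auto simp: compact_imp_closed\<close>)
  moreover from this have "compact (closure {x. f x \<noteq> 0})"
    using assms(2) by (metis closed_closure compact_Int_closed inf.absorb_iff2)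
  ultimately show ?thesis
    unfolding test_fun_def using assms by (auto intro: smooth_elem_smooth)
qed

subsection \<open>Integration tools\<close>

text \<open>The exceptional null sets are indexed by uncountably many points; Lindelof's theorem
  selects countably many of the balls, whose null sets may be united.\<close>

lemma AE_local:
  fixes \<Omega> :: "'a::euclidean_space set"
  assumes "\<And>x. x \<in> \<Omega> \<Longrightarrow> \<exists>r>0. AE y in lborel. y \<in> ball x r \<longrightarrow> P y"
  shows "AE y in lborel. y \<in> \<Omega> \<longrightarrow> P y"
proof -
  obtain r where r: "\<And>x. x \<in> \<Omega> \<Longrightarrow> r x > 0" "\<And>x. x \<in> \<Omega> \<Longrightarrow> AE y in lborel. y \<in> ball x (r x) \<longrightarrow> P y"
    using assms by metis
  obtain F where F: "F \<subseteq> (\<lambda>x. ball x (r x)) ` \<Omega>" "countable F" "\<Union>F = (\<Union>x\<in>\<Omega>. ball x (r x))"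
    using Lindelof[of "(\<lambda>x. ball x (r x)) ` \<Omega>"] by auto
  have "AE y in lborel. \<forall>U\<in>F. y \<in> U \<longrightarrow> P y"
    using F r(2) by (intro AE_ball_countable') auto
  then show ?thesis
  proof eventually_elim
    case (elim y)
    show ?case
    proof
      assume "y \<in> \<Omega>"
      then have "y \<in> \<Union>F" using F(3) r(1) by force
      with elim show "P y" by blast
    qed
  qed
qed

lemma integrable_indicator_times:
  "A \<in> sets M \<Longrightarrow> integrable M f \<Longrightarrow> integrable M (\<lambda>x. indicator A x * (f x :: real))"
  using integrable_mult_indicator[of A M f] by simp

text \<open>The positive and negative parts of \<open>h\<close> are densities of two measures that
  agree on open boxes. Boxes form an intersection-stable generator exhausted by sets of finite
  measure, so the measures coincide, and uniqueness of densities makes the two parts equal almost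
  everywhere.\<close>

lemma AE_zero_if_boxes:
  fixes h :: "'a::euclidean_space \<Rightarrow> real"
  assumes h: "integrable lborel h"
    and box: "\<And>a b. (LINT x|lborel. indicator (box a b) x * h x) = 0"
  shows "AE x in lborel. h x = 0"
proof -
  have [measurable]: "h \<in> borel_measurable borel" using h by auto
  have hp: "integrable lborel (\<lambda>x. max 0 (h x))" "integrable lborel (\<lambda>x. max 0 (- h x))"
    using h by (auto intro!: integrable_max)
  have emb: "emeasure (density lborel (\<lambda>x. ennreal (g x))) (box a b) = ennreal (LINT x|lborel. indicator (box a b) x * g x)"
    if g: "integrable lborel g" "\<And>x. g x \<ge> 0" for g :: "'a \<Rightarrow> real" and a b
  proof -
    have [measurable]: "g \<in> borel_measurable borel" using g by auto
    have "emeasure (density lborel (\<lambda>x. ennreal (g x))) (box a b) = (\<integral>\<^sup>+x. ennreal (indicator (box a b) x * g x) \<partial>lborel)"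
      by (subst emeasure_density) (auto intro!: nn_integral_cong simp: indicator_def)
    also have "\<dots> = ennreal (LINT x|lborel. indicator (box a b) x * g x)"
      by (rule nn_integral_eq_integral)
         (use g in \<open>auto intro!: integrable_indicator_times\<close>)
    finally show ?thesis .
  qed
  have eq: "(LINT x|lborel. indicator (box a b) x * max 0 (h x)) = (LINT x|lborel. indicator (box a b) x * max 0 (- h x))" for a b
  proof -
    have "(LINT x|lborel. indicator (box a b) x * max 0 (h x)) - (LINT x|lborel. indicator (box a b) x * max 0 (- h x))
       = (LINT x|lborel. indicator (box a b) x * max 0 (h x) - indicator (box a b) x * max 0 (- h x))"
      by (rule Bochner_Integration.integral_diff[symmetric])
         (use hp in \<open>auto intro!: integrable_indicator_times\<close>)
    also have "\<dots> = (LINT x|lborel. indicator (box a b) x * h x)"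
      by (rule Bochner_Integration.integral_cong) (auto simp: indicator_def)
    finally show ?thesis using box by simp
  qed
  have "density lborel (\<lambda>x. ennreal (max 0 (h x))) = density lborel (\<lambda>x. ennreal (max 0 (- h x)))" (is "?M = ?N")
  proof (rule measure_eqI_generator_eq)
    let ?E = "range (\<lambda>(a, b). box a b::'a set)"
    show "Int_stable ?E"
      by (auto simp: Int_stable_def box_Int_box)
    show "?E \<subseteq> Pow UNIV" "sets ?M = sigma_sets UNIV ?E" "sets ?N = sigma_sets UNIV ?E"
      by (simp_all add: borel_eq_box)
    let ?A = "\<lambda>n::nat. box (- (real n *\<^sub>R One)) (real n *\<^sub>R One) :: 'a set"
    show "range ?A \<subseteq> ?E" "(\<Union>i. ?A i) = UNIV"
      unfolding UN_box_eq_UNIV by auto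
    show "emeasure ?M (?A i) \<noteq> \<infinity>" for i
      by (subst emb) (use hp in auto)
    show "emeasure ?M X = emeasure ?N X" if "X \<in> ?E" for X
      using that by (auto simp: emb hp eq)
  qed
  then have "AE x in lborel. ennreal (max 0 (h x)) = ennreal (max 0 (- h x))"
    by (subst (asm) sigma_finite_measure.density_unique_iff[OF sigma_finite_lborel]) auto
  then show ?thesis
    by eventually_elim (auto simp: max_def split: if_splits)
qed

lemma integrable_mult_continuous_on_compact:
  fixes v k :: "'a::euclidean_space \<Rightarrow> real"
  assumes "integrable lborel v" "compact A" "\<And>y. y \<notin> A \<Longrightarrow> v y = 0"
    "k \<in> borel_measurable borel" "continuous_on A k"
  shows "integrable lborel (\<lambda>y. v y * k y)"
proof -
  obtain C where C: "\<And>y. y \<in> A \<Longrightarrow> \<bar>k y\<bar> \<le> C"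
    using compact_imp_bounded[OF compact_continuous_image[OF assms(5,2)]]
    by (metis bounded_real imageI)
  have [measurable]: "k \<in> borel_measurable borel" "v \<in> borel_measurable borel" using assms by auto
  show ?thesis
  proof (rule Bochner_Integration.integrable_bound)
    show "integrable lborel (\<lambda>y. C * v y)" using assms(1) by simp
    show "AE y in lborel. norm (v y * k y) \<le> norm (C * v y)"
    proof (rule AE_I2)
      fix y show "norm (v y * k y) \<le> norm (C * v y)"
      proof (cases "y \<in> A")
        case True
        then have "\<bar>k y\<bar> \<le> \<bar>C\<bar>" using C[of y] by linarith
        then have "\<bar>v y\<bar> * \<bar>k y\<bar> \<le> \<bar>v y\<bar> * \<bar>C\<bar>" by (rule mult_left_mono) simp
        then show ?thesis by (simp add: abs_mult mult.commute)
      qed (use assms(3) in simp)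
    qed
  qed measurable
qed

text \<open>Dominated convergence of the normalised remainders. The derivative \<open>k'\<close> is
  bounded on the compact product of the parameter ball and \<open>A\<close>, so the mean value
  inequality bounds each remainder by a multiple of |v|. The parameter serves later as a point of
  space, a translation or a mollification scale.\<close>

lemma has_derivative_param_integral:
  fixes K :: "'p::euclidean_space \<Rightarrow> 'a::euclidean_space \<Rightarrow> real" and k' :: "'p \<Rightarrow> 'a \<Rightarrow> 'p"
  assumes v: "integrable lborel v" and A: "compact A" "\<And>y. y \<notin> A \<Longrightarrow> v y = 0" and "\<delta> > 0"
    and meas: "\<And>p. K p \<in> borel_measurable borel" "\<And>p. k' p \<in> borel_measurable borel"
    and contK: "\<And>p. p \<in> cball p0 \<delta> \<Longrightarrow> continuous_on A (K p)"
    and der: "\<And>p y. p \<in> cball p0 \<delta> \<Longrightarrow> y \<in> A \<Longrightarrow> ((\<lambda>p. K p y) has_derivative (\<lambda>h. h \<bullet> k' p y)) (at p)"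
    and cont: "continuous_on (cball p0 \<delta> \<times> A) (\<lambda>z. k' (fst z) (snd z))"
  shows "((\<lambda>p. LINT y|lborel. v y * K p y) has_derivative
    (\<lambda>h. h \<bullet> (LINT y|lborel. v y *\<^sub>R k' p0 y))) (at p0)"
proof -
  have [measurable]: "v \<in> borel_measurable borel" using v by auto
  have [measurable]: "k' p \<in> borel_measurable borel" for p by (rule meas)
  have [measurable]: "K p \<in> borel_measurable borel" for p by (rule meas)
  have "compact ((\<lambda>z. k' (fst z) (snd z)) ` (cball p0 \<delta> \<times> A))"
    by (intro compact_continuous_image cont compact_Times A) auto
  then obtain C0 where C0: "\<And>p y. p \<in> cball p0 \<delta> \<Longrightarrow> y \<in> A \<Longrightarrow> norm (k' p y) \<le> C0"
  proof -
    assume *: "\<And>C0. (\<And>p y. p \<in> cball p0 \<delta> \<Longrightarrow> y \<in> A \<Longrightarrow> norm (k' p y) \<le> C0) \<Longrightarrow> thesis"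
    assume "compact ((\<lambda>z. k' (fst z) (snd z)) ` (cball p0 \<delta> \<times> A))"
    then obtain C0 where "\<forall>z \<in> (\<lambda>z. k' (fst z) (snd z)) ` (cball p0 \<delta> \<times> A). norm z \<le> C0"
      using compact_imp_bounded bounded_iff by metis
    then show thesis by (intro *[of C0]) force
  qed
  define C where "C = max 0 C0"
  have C: "C \<ge> 0" "\<And>p y. p \<in> cball p0 \<delta> \<Longrightarrow> y \<in> A \<Longrightarrow> norm (k' p y) \<le> C"
    using C0 by (auto simp: C_def max.coboundedI2)
  have intK: "integrable lborel (\<lambda>y. v y * K p y)" if "p \<in> cball p0 \<delta>" for p
    by (rule integrable_mult_continuous_on_compact[OF v A]) (use that contK in auto)
  have intk: "integrable lborel (\<lambda>y. v y *\<^sub>R k' p0 y)"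
  proof (rule Bochner_Integration.integrable_bound)
    show "integrable lborel (\<lambda>y. C * v y)" using v by simp
    show "AE y in lborel. norm (v y *\<^sub>R k' p0 y) \<le> norm (C * v y)"
    proof (rule AE_I2)
      fix y show "norm (v y *\<^sub>R k' p0 y) \<le> norm (C * v y)"
      proof (cases "y \<in> A")
        case True
        then have "norm (k' p0 y) \<le> C" using C(2)[of p0 y] \<open>\<delta> > 0\<close> by simp
        then have "\<bar>v y\<bar> * norm (k' p0 y) \<le> \<bar>v y\<bar> * C" by (rule mult_left_mono) simp
        then show ?thesis using C(1) by (simp add: abs_mult mult.commute)
      qed (use A(2) in simp)
    qed
  qed measurable
  define F where "F p = (LINT y|lborel. v y * K p y)" for p
  define D where "D = (LINT y|lborel. v y *\<^sub>R k' p0 y)"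
  \<comment> \<open>The first-order remainder of the integrand divided by |h|; its integral is the
    remainder quotient of \<open>F\<close>, so only its convergence to 0 is at stake.\<close>
  define q where "q h y = v y * ((K (p0 + h) y - K p0 y - h \<bullet> k' p0 y) / norm h)" for h y
  have lip: "\<bar>K (p0 + h) y - K p0 y\<bar> \<le> C * norm h" if "norm h \<le> \<delta>" "y \<in> A" for h y
  proof -
    have "norm (K (p0 + h) y - K p0 y) \<le> C * norm (p0 + h - p0)"
    proof (rule differentiable_bound[of "cball p0 \<delta>" "\<lambda>p. K p y" "\<lambda>p h. h \<bullet> k' p y"])
      fix p assume p: "p \<in> cball p0 \<delta>"
      show "((\<lambda>p. K p y) has_derivative (\<lambda>h. h \<bullet> k' p y)) (at p within cball p0 \<delta>)"
        using der[OF p that(2)] by (rule has_derivative_at_withinI)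
      show "onorm (\<lambda>h. h \<bullet> k' p y) \<le> C"
        by (rule onorm_bound[OF C(1)])
           (use C(2)[OF p that(2)] norm_ge_zero in
            \<open>metis Cauchy_Schwarz_ineq2 mult.commute mult_right_mono order_trans real_norm_def\<close>)
    qed (use that \<open>\<delta> > 0\<close> in \<open>auto simp: dist_norm\<close>)
    then show ?thesis by simp
  qed
  have bq: "norm (q h y) \<le> 2 * C * \<bar>v y\<bar>" if "norm h \<le> \<delta>" "h \<noteq> 0" for h y
  proof (cases "y \<in> A")
    case True
    have "\<bar>h \<bullet> k' p0 y\<bar> \<le> C * norm h"
      using Cauchy_Schwarz_ineq2[of h "k' p0 y"] C(2)[of p0 y] True \<open>\<delta> > 0\<close>
      by (metis centre_in_cball less_imp_le mult.commute mult_right_mono norm_ge_zero order_trans)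
    then have "\<bar>K (p0 + h) y - K p0 y - h \<bullet> k' p0 y\<bar> \<le> 2 * C * norm h"
      using lip[OF that(1) True] by linarith
    then have "\<bar>K (p0 + h) y - K p0 y - h \<bullet> k' p0 y\<bar> / norm h \<le> 2 * C"
      using that(2) by (simp add: divide_simps)
    then have "\<bar>v y\<bar> * (\<bar>K (p0 + h) y - K p0 y - h \<bullet> k' p0 y\<bar> / norm h) \<le> \<bar>v y\<bar> * (2 * C)"
      by (rule mult_left_mono) simp
    then show ?thesis by (simp add: q_def abs_mult mult_ac)
  qed (use A(2) C in \<open>simp add: q_def\<close>)
  have eqF: "(F (p0 + h) - F p0 - h \<bullet> D) / norm h = (LINT y|lborel. q h y)" if "norm h \<le> \<delta>" for h
  proof -
    have "(LINT y|lborel. q h y) = (LINT y|lborel. (v y * K (p0 + h) y - v y * K p0 y - h \<bullet> (v y *\<^sub>R k' p0 y)) / norm h)"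
      by (simp add: q_def algebra_simps diff_divide_distrib)
    also have "\<dots> = (LINT y|lborel. v y * K (p0 + h) y - v y * K p0 y - h \<bullet> (v y *\<^sub>R k' p0 y)) / norm h"
      by simp
    also have "(LINT y|lborel. v y * K (p0 + h) y - v y * K p0 y - h \<bullet> (v y *\<^sub>R k' p0 y))
       = F (p0 + h) - F p0 - h \<bullet> D"
    proof -
      have i: "integrable lborel (\<lambda>y. v y * K (p0 + h) y)" "integrable lborel (\<lambda>y. v y * K p0 y)"
        using that \<open>\<delta> > 0\<close> by (auto intro!: intK simp: dist_norm)
      have "integrable lborel (\<lambda>y. h \<bullet> (v y *\<^sub>R k' p0 y))"
        using intk by (rule integrable_inner_right)
      moreover have "(LINT y|lborel. h \<bullet> (v y *\<^sub>R k' p0 y)) = h \<bullet> D"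
        unfolding D_def using intk by (rule integral_inner_right)
      ultimately show ?thesis
        unfolding F_def using i by simp
    qed
    finally show ?thesis by simp
  qed
  have "(\<lambda>h. norm (F (p0 + h) - F p0 - h \<bullet> D) / norm h) \<midarrow>0\<rightarrow> 0"
    unfolding tendsto_at_iff_sequentially
  proof (intro allI impI)
    fix X :: "nat \<Rightarrow> 'p" assume X: "\<forall>i. X i \<in> UNIV - {0}" "X \<longlonglongrightarrow> 0"
    \<comment> \<open>The sequence is shifted by \<open>N\<close> so that all its terms lie within
      \<open>\<delta>\<close>, where the majorant is valid.\<close>
    then obtain N where N: "\<And>i. i \<ge> N \<Longrightarrow> norm (X i) \<le> \<delta>"
      using LIMSEQ_D[OF X(2) \<open>\<delta> > 0\<close>] by (metis diff_zero less_imp_le)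
    have X': "(\<lambda>i. X (i + N)) \<longlonglongrightarrow> 0" using X(2) by (rule LIMSEQ_ignore_initial_segment)
    have "(\<lambda>i. LINT y|lborel. q (X (i + N)) y) \<longlonglongrightarrow> (LINT y|(lborel::'a measure). 0)"
    proof (rule integral_dominated_convergence)
      show "integrable lborel (\<lambda>y. 2 * C * \<bar>v y\<bar>)" using v by simp
      show "AE y in lborel. norm (q (X (i + N)) y) \<le> 2 * C * \<bar>v y\<bar>" for i
        using bq X(1) N by (intro AE_I2) auto
      show "AE y in lborel. (\<lambda>i. q (X (i + N)) y) \<longlonglongrightarrow> 0"
      proof (rule AE_I2)
        fix y show "(\<lambda>i. q (X (i + N)) y) \<longlonglongrightarrow> 0"
        proof (cases "y \<in> A")
          case True
          have "(\<lambda>h. norm (K (p0 + h) y - K p0 y - h \<bullet> k' p0 y) / norm h) \<midarrow>0\<rightarrow> 0"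
            using der[of p0 y] True \<open>\<delta> > 0\<close> unfolding has_derivative_at by simp
          then have "(\<lambda>i. norm (K (p0 + X (i + N)) y - K p0 y - X (i + N) \<bullet> k' p0 y) / norm (X (i + N))) \<longlonglongrightarrow> 0"
            using X' X(1) unfolding tendsto_at_iff_sequentially comp_def
            by (elim allE[of _ "\<lambda>i. X (i + N)"]) simp
          then have "(\<lambda>i. (K (p0 + X (i + N)) y - K p0 y - X (i + N) \<bullet> k' p0 y) / norm (X (i + N))) \<longlonglongrightarrow> 0"
            by (subst tendsto_rabs_zero_iff[symmetric]) simp
          then show ?thesis unfolding q_def by (rule tendsto_mult_right_zero)
        qed (use A(2) in \<open>simp add: q_def\<close>)
      qed
    qed (simp_all add: q_def)
    then have "(\<lambda>i. \<bar>(F (p0 + X (i + N)) - F p0 - X (i + N) \<bullet> D) / norm (X (i + N))\<bar>) \<longlonglongrightarrow> 0"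
      by (subst eqF) (use N in \<open>auto intro: tendsto_rabs_zero\<close>)
    then have "(\<lambda>i. norm (F (p0 + X (i + N)) - F p0 - X (i + N) \<bullet> D) / norm (X (i + N))) \<longlonglongrightarrow> 0"
      by simp
    then show "((\<lambda>h. norm (F (p0 + h) - F p0 - h \<bullet> D) / norm h) \<circ> X) \<longlonglongrightarrow> 0"
      unfolding comp_def by (rule LIMSEQ_offset)
  qed
  then have "(F has_derivative (\<lambda>h. h \<bullet> D)) (at p0)"
    unfolding has_derivative_at by (simp add: bounded_linear_inner_left)
  then show ?thesis unfolding F_def D_def .
qed

lemma has_derivative_param_integral_real:
  fixes K :: "real \<Rightarrow> 'a::euclidean_space \<Rightarrow> real" and k' :: "real \<Rightarrow> 'a \<Rightarrow> real"
  assumes v: "integrable lborel v" and A: "compact A" "\<And>y. y \<notin> A \<Longrightarrow> v y = 0" and "\<delta> > 0"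
    and meas: "\<And>p. K p \<in> borel_measurable borel" "\<And>p. k' p \<in> borel_measurable borel"
    and contK: "\<And>p. p \<in> cball p0 \<delta> \<Longrightarrow> continuous_on A (K p)"
    and der: "\<And>p y. p \<in> cball p0 \<delta> \<Longrightarrow> y \<in> A \<Longrightarrow> ((\<lambda>p. K p y) has_real_derivative k' p y) (at p)"
    and cont: "continuous_on (cball p0 \<delta> \<times> A) (\<lambda>z. k' (fst z) (snd z))"
  shows "((\<lambda>p. LINT y|lborel. v y * K p y) has_real_derivative (LINT y|lborel. v y * k' p0 y)) (at p0)"
proof -
  have "((\<lambda>p. LINT y|lborel. v y * K p y) has_derivative
    (\<lambda>h. h \<bullet> (LINT y|lborel. v y *\<^sub>R k' p0 y))) (at p0)"
    by (rule has_derivative_param_integral[OF v A \<open>\<delta> > 0\<close> meas contK _ cont])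
       (use der in \<open>auto simp: has_field_derivative_def mult_commute_abs\<close>)
  then show ?thesis
    by (simp add: has_field_derivative_def mult_commute_abs)
qed

subsection \<open>Integration by parts\<close>

lemma continuous_on_grad: "C1_on U f \<Longrightarrow> continuous_on U (grad f)"
  unfolding C1_on_def grad_def by (intro continuous_on_vec_lambda) auto

lemma C1_on_continuous_on: "C1_on U f \<Longrightarrow> continuous_on U f"
  unfolding C1_on_def
  by (meson continuous_at_imp_continuous_on differentiable_imp_continuous_within)

lemma C1_onI:
  assumes "\<And>x. x \<in> U \<Longrightarrow> (f has_derivative (\<lambda>h. g x \<bullet> h)) (at x)" "\<And>i. continuous_on U (\<lambda>x. g x $ i)"
  shows "C1_on U f"
  unfolding C1_on_def
proof (intro conjI ballI allI)
  show "f differentiable at x" if "x \<in> U" for x using assms(1)[OF that] differentiable_def by blast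
  show "continuous_on U (partial i f)" for i
    using assms(2)[of i] by (rule continuous_on_eq) (simp add: partial_eqI_grad[OF assms(1)])
qed

lemma C1_on_mult:
  assumes "C1_on U f" "C1_on U g"
  shows "C1_on U (\<lambda>x. f x * g x)"
    and "x \<in> U \<Longrightarrow> grad (\<lambda>x. f x * g x) x = f x *\<^sub>R grad g x + g x *\<^sub>R grad f x"
proof -
  have *: "((\<lambda>x. f x * g x) has_derivative (\<lambda>h. (f x *\<^sub>R grad g x + g x *\<^sub>R grad f x) \<bullet> h)) (at x)"
    if "x \<in> U" for x
    by (rule has_derivative_eq_rhs, rule has_derivative_mult; (rule has_derivative_grad)?)
       (use assms that in \<open>auto simp: C1_on_def inner_add_left fun_eq_iff\<close>)
  have cont: "continuous_on U f" "continuous_on U g" "continuous_on U (partial i f)" "continuous_on U (partial i g)" for i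
    using assms C1_on_continuous_on by (auto simp: C1_on_def)
  show "C1_on U (\<lambda>x. f x * g x)"
    by (rule C1_onI[OF *]) (simp_all add: continuous_on_add continuous_on_mult cont)
  show "x \<in> U \<Longrightarrow> grad (\<lambda>x. f x * g x) x = f x *\<^sub>R grad g x + g x *\<^sub>R grad f x"
    by (rule grad_eqI[OF *])
qed

lemma C1_on_chain:
  fixes f :: "real^'n::finite \<Rightarrow> real"
  assumes "C1_on U f" and F: "\<And>x. x \<in> U \<Longrightarrow> (F has_real_derivative F' (f x)) (at (f x))"
    and F': "continuous_on U (\<lambda>x. F' (f x))"
  shows "C1_on U (\<lambda>x. F (f x))"
    and "x \<in> U \<Longrightarrow> grad (\<lambda>x. F (f x)) x = F' (f x) *\<^sub>R grad f x"
proof -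
  have *: "((\<lambda>x. F (f x)) has_derivative (\<lambda>h. (F' (f x) *\<^sub>R grad f x) \<bullet> h)) (at x)"
    if "x \<in> U" for x
  proof -
    have "f differentiable at x" using assms(1) that by (auto simp: C1_on_def)
    from has_derivative_compose[OF has_derivative_grad[OF this] F[OF that, unfolded has_field_derivative_def]]
    show ?thesis by simp
  qed
  show "C1_on U (\<lambda>x. F (f x))"
    by (rule C1_onI[OF *])
       (use assms in \<open>simp_all add: C1_on_def continuous_on_mult\<close>)
  show "x \<in> U \<Longrightarrow> grad (\<lambda>x. F (f x)) x = F' (f x) *\<^sub>R grad f x"
    by (rule grad_eqI[OF *])
qed

lemma smooth_elem_C1_on: "smooth_elem f \<Longrightarrow> C1_on U f"
  by (auto simp: C1_on_def intro: smooth_elem_differentiable smooth_elem_continuous_on smooth_elem_partial)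

lemma test_fun_C1_on: "test_fun \<Omega> \<xi> \<Longrightarrow> C1_on U \<xi>"
proof -
  assume "test_fun \<Omega> \<xi>"
  then have s: "(\<forall>x. ipartial is \<xi> differentiable (at x)) \<and> continuous_on UNIV (ipartial is \<xi>)" for "is"
    by (auto simp: test_fun_def smooth_fun_on_def)
  show ?thesis unfolding C1_on_def
    using s[of "[]"] s[of "[_]"] by (auto intro: continuous_on_subset)
qed

lemma test_fun_support:
  assumes "test_fun \<Omega> \<xi>"
  obtains K where "compact K" "K \<subseteq> \<Omega>" "\<And>x. x \<notin> K \<Longrightarrow> \<xi> x = 0"
proof
  show "compact (closure {x. \<xi> x \<noteq> 0})" "closure {x. \<xi> x \<noteq> 0} \<subseteq> \<Omega>"
    using assms by (auto simp: test_fun_def)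
  show "\<xi> x = 0" if "x \<notin> closure {x. \<xi> x \<noteq> 0}" for x
    using that closure_subset[of "{x. \<xi> x \<noteq> 0}"] by blast
qed

lemma partial_zero_outside:
  assumes "open \<Omega>" "compact K" "\<And>x. x \<in> \<Omega> - K \<Longrightarrow> f x = 0" "x \<in> \<Omega> - K"
  shows "partial i f x = 0"
proof -
  have "open (\<Omega> - K)" using assms by (simp add: compact_imp_closed open_Diff)
  from partial_cong_open[OF this assms(4), of f "\<lambda>_. 0" i] assms(3)
  have "partial i f x = partial i (\<lambda>_. 0) x" by blast
  also have "\<dots> = 0" by (rule partial_eqI[where f' = "\<lambda>_. 0"]) simp
  finally show ?thesis .
qed

lemma set_integrable_continuous_compact_support:
  fixes f :: "'a::euclidean_space \<Rightarrow> real"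
  assumes "open \<Omega>" "compact K" "K \<subseteq> \<Omega>" "continuous_on \<Omega> f" "\<And>x. x \<in> \<Omega> - K \<Longrightarrow> f x = 0"
  shows "set_integrable lborel \<Omega> f"
proof -
  have "set_integrable lborel K f"
    using borel_integrable_compact[OF assms(2) continuous_on_subset[OF assms(4,3)]]
    by (simp add: set_integrable_def)
  then show ?thesis
    unfolding set_integrable_def
    by (rule Bochner_Integration.integrable_cong[THEN iffD1, rotated -1])
       (use assms in \<open>auto simp: indicator_def\<close>)
qed

text \<open>By translation invariance the integral of \<zeta>(y + \<tau> e) does not depend on
  \<tau>; differentiating under the integral at \<tau> = 0 gives the claim without iterated
  integrals.\<close>

lemma integral_partial_C1c:
  fixes \<zeta> :: "real^'n::finite \<Rightarrow> real"
  assumes C1: "C1_on UNIV \<zeta>" and K: "compact K" "\<And>x. x \<notin> K \<Longrightarrow> \<zeta> x = 0"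
  shows "(LINT x|lborel. partial i \<zeta> x) = 0"
proof -
  define e where "e = (axis i 1 :: real^'n)"
  \<comment> \<open>The unit enlargement of \<open>K\<close> carries all translates with |\<tau>|
    \<le> 1, so its indicator can play the part of the integrable weight.\<close>
  define A where "A = {x + y | x y. x \<in> K \<and> y \<in> cball 0 1}"
  have cA: "compact A" unfolding A_def by (rule compact_sums) (use K in auto)
  have cont: "continuous_on S \<zeta>" "continuous_on S (partial i \<zeta>)" for S
    using C1 C1_on_continuous_on continuous_on_subset unfolding C1_on_def by (metis subset_UNIV)+
  have inA: "z \<in> A" if "z + \<tau> *\<^sub>R e \<in> K" "\<bar>\<tau>\<bar> \<le> 1" for z \<tau>
    unfolding A_def
    by (rule CollectI, rule exI[of _ "z + \<tau> *\<^sub>R e"], rule exI[of _ "- \<tau> *\<^sub>R e"])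
       (use that in \<open>simp add: e_def\<close>)
  have der: "((\<lambda>\<tau>. \<zeta> (y + \<tau> *\<^sub>R e)) has_real_derivative partial i \<zeta> (y + \<tau> *\<^sub>R e)) (at \<tau>)" for y \<tau>
  proof -
    have "(\<zeta> has_derivative (\<lambda>h. grad \<zeta> (y + \<tau> *\<^sub>R e) \<bullet> h)) (at (y + \<tau> *\<^sub>R e))"
      using C1 by (intro has_derivative_grad) (auto simp: C1_on_def)
    moreover have "((\<lambda>\<tau>. y + \<tau> *\<^sub>R e) has_derivative (\<lambda>h. h *\<^sub>R e)) (at \<tau>)"
      by (auto intro!: derivative_eq_intros)
    ultimately have "((\<lambda>\<tau>. \<zeta> (y + \<tau> *\<^sub>R e)) has_derivative (\<lambda>h. grad \<zeta> (y + \<tau> *\<^sub>R e) \<bullet> (h *\<^sub>R e))) (at \<tau>)"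
      using has_derivative_compose by blast
    then show ?thesis by (simp add: has_field_derivative_def e_def inner_axis mult_commute_abs)
  qed
  have "((\<lambda>\<tau>. LINT y|lborel. indicator A y * \<zeta> (y + \<tau> *\<^sub>R e)) has_real_derivative
     (LINT y|lborel. indicator A y * partial i \<zeta> (y + 0 *\<^sub>R e))) (at 0)"
  proof (rule has_derivative_param_integral_real[where A = A and \<delta> = 1])
    show "integrable lborel (indicat_real A)"
      using borel_integrable_compact[OF cA, of "\<lambda>_. 1::real"] by simp
    show "continuous_on (cball 0 1 \<times> A) (\<lambda>z. partial i \<zeta> (snd z + fst z *\<^sub>R e))"
      by (rule continuous_on_compose2[OF cont(2)[of UNIV]]) (auto intro!: continuous_intros)
    show "continuous_on A (\<lambda>y. \<zeta> (y + p *\<^sub>R e))" for p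
      by (rule continuous_on_compose2[OF cont(1)[of UNIV]]) (auto intro!: continuous_intros)
    have [measurable]: "\<zeta> \<in> borel_measurable borel" "partial i \<zeta> \<in> borel_measurable borel"
      using cont[of UNIV] by (auto intro: borel_measurable_continuous_onI)
    show "(\<lambda>y. \<zeta> (y + p *\<^sub>R e)) \<in> borel_measurable borel"
         "(\<lambda>y. partial i \<zeta> (y + p *\<^sub>R e)) \<in> borel_measurable borel" for p by measurable
  qed (use der cA in \<open>auto simp: indicator_def\<close>)
  moreover have "((\<lambda>\<tau>. LINT y|lborel. indicator A y * \<zeta> (y + \<tau> *\<^sub>R e)) has_real_derivative 0) (at 0)"
  proof (rule has_field_derivative_transform_within_open[where S = "ball 0 1" and f = "\<lambda>_. LINT y|lborel. \<zeta> y"])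
    fix \<tau> :: real assume "\<tau> \<in> ball 0 1"
    then have \<tau>: "\<bar>\<tau>\<bar> \<le> 1" by simp
    have [measurable]: "\<zeta> \<in> borel_measurable borel" using cont[of UNIV] by (auto intro: borel_measurable_continuous_onI)
    have "(LINT y|lborel. \<zeta> y) = (LINT y|distr lborel borel ((+) (\<tau> *\<^sub>R e)). \<zeta> y)"
      by (simp add: lborel_distr_plus)
    also have "\<dots> = (LINT y|lborel. \<zeta> (\<tau> *\<^sub>R e + y))"
      by (subst integral_distr) auto
    also have "\<dots> = (LINT y|lborel. indicator A y * \<zeta> (y + \<tau> *\<^sub>R e))"
      using inA[OF _ \<tau>] K(2)
      by (intro Bochner_Integration.integral_cong) (auto simp: indicator_def add.commute)
    finally show "(LINT y|lborel. \<zeta> y) = (LINT y|lborel. indicator A y * \<zeta> (y + \<tau> *\<^sub>R e))" .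
  qed auto
  ultimately have "(LINT y|lborel. indicator A y * partial i \<zeta> (y + 0 *\<^sub>R e)) = 0"
    by (rule DERIV_unique)
  moreover have "partial i \<zeta> x = 0" if "x \<notin> A" for x
  proof (rule partial_zero_outside[OF open_UNIV K(1)])
    show "x \<in> UNIV - K" using inA[of x 0] that by auto
  qed (use K in auto)
  then have "(LINT y|lborel. indicator A y * partial i \<zeta> (y + 0 *\<^sub>R e)) = (LINT x|lborel. partial i \<zeta> x)"
    by (intro Bochner_Integration.integral_cong) (auto simp: indicator_def)
  ultimately show ?thesis by simp
qed

text \<open>Nothing is known of \<open>\<zeta>\<close> outside \<open>\<Omega>\<close>, so it is
  replaced by its extension by zero. That extension is C^1 everywhere because
  \<open>\<Omega>\<close> and the complement of \<open>K\<close> are open and cover the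
  space.\<close>

lemma integral_partial_C1c_on:
  fixes \<zeta> :: "real^'n::finite \<Rightarrow> real"
  assumes "open \<Omega>" and C1: "C1_on \<Omega> \<zeta>" and K: "compact K" "K \<subseteq> \<Omega>" "\<And>x. x \<in> \<Omega> - K \<Longrightarrow> \<zeta> x = 0"
  shows "(LINT x:\<Omega>|lborel. partial i \<zeta> x) = 0"
proof -
  define z where "z x = (if x \<in> \<Omega> then \<zeta> x else 0)" for x
  have eq1: "partial i z x = partial i \<zeta> x" if "x \<in> \<Omega>" for x i
    using partial_cong_open[OF \<open>open \<Omega>\<close> that, of z \<zeta>] by (simp add: z_def)
  have z0: "z x = 0" if "x \<notin> K" for x using K that by (auto simp: z_def)
  have oK: "open (- K)" using K by (simp add: compact_imp_closed open_Compl)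
  have eq0: "partial i z x = 0" if "x \<notin> K" for x i
    using partial_zero_outside[OF open_UNIV K(1), of z] z0 that by blast
  have dz: "z differentiable (at x)" for x
  proof (cases "x \<in> \<Omega>")
    case True
    then obtain D where "(\<zeta> has_derivative D) (at x)"
      using C1 by (auto simp: C1_on_def differentiable_def)
    then have "(z has_derivative D) (at x)"
      by (rule has_derivative_transform_within_open[OF _ \<open>open \<Omega>\<close> True]) (simp add: z_def)
    then show ?thesis by (auto simp: differentiable_def)
  next
    case False
    have "((\<lambda>_. 0) has_derivative (\<lambda>_. 0)) (at x)" by simp
    then have "(z has_derivative (\<lambda>_. 0)) (at x)"
      by (rule has_derivative_transform_within_open[OF _ oK]) (use False K z0 in auto)
    then show ?thesis by (auto simp: differentiable_def)
  qed
  have cz: "continuous_on UNIV (partial i z)" for i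
  proof -
    have "continuous_on (\<Omega> \<union> (- K)) (partial i z)"
    proof (rule continuous_on_open_Un[OF \<open>open \<Omega>\<close> oK])
      show "continuous_on \<Omega> (partial i z)"
        using C1 by (auto simp: C1_on_def eq1 cong: continuous_on_cong)
      show "continuous_on (- K) (partial i z)"
        by (subst continuous_on_cong[OF refl, of _ _ "\<lambda>_. 0"]) (auto simp: eq0)
    qed
    moreover have "\<Omega> \<union> (- K) = UNIV" using K by auto
    ultimately show ?thesis by simp
  qed
  have "C1_on UNIV z" using dz cz by (auto simp: C1_on_def)
  then have "(LINT x|lborel. partial i z x) = 0" by (rule integral_partial_C1c[OF _ K(1) z0])
  also have "(LINT x|lborel. partial i z x) = (LINT x:\<Omega>|lborel. partial i \<zeta> x)"
    unfolding set_lebesgue_integral_def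
  proof (rule Bochner_Integration.integral_cong)
    fix x show "partial i z x = indicator \<Omega> x *\<^sub>R partial i \<zeta> x"
      using eq1[of x i] eq0[of x i] K(2) by (cases "x \<in> \<Omega>") (auto simp: indicator_def)
  qed simp
  finally show ?thesis .
qed

lemma integration_by_parts:
  fixes f g :: "real^'n::finite \<Rightarrow> real"
  assumes "open \<Omega>" and f: "C1_on \<Omega> f" and g: "C1_on \<Omega> g"
    and K: "compact K" "K \<subseteq> \<Omega>" "\<And>x. x \<in> \<Omega> - K \<Longrightarrow> g x = 0"
  shows "(LINT x:\<Omega>|lborel. f x * partial i g x) = - (LINT x:\<Omega>|lborel. partial i f x * g x)"
proof -
  have pg: "partial i g x = 0" if "x \<in> \<Omega> - K" for x
    by (rule partial_zero_outside[OF \<open>open \<Omega>\<close> K(1) K(3) that])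
  have cont: "continuous_on \<Omega> f" "continuous_on \<Omega> g" "continuous_on \<Omega> (partial i f)" "continuous_on \<Omega> (partial i g)"
    using f g C1_on_continuous_on by (auto simp: C1_on_def)
  have "(LINT x:\<Omega>|lborel. partial i (\<lambda>x. f x * g x) x) = 0"
    by (rule integral_partial_C1c_on[OF \<open>open \<Omega>\<close> C1_on_mult(1)[OF f g] K(1,2)]) (use K in simp)
  also have "(LINT x:\<Omega>|lborel. partial i (\<lambda>x. f x * g x) x) = (LINT x:\<Omega>|lborel. f x * partial i g x + partial i f x * g x)"
  proof (rule set_lebesgue_integral_cong)
    show "\<forall>x. x \<in> \<Omega> \<longrightarrow> partial i (\<lambda>x. f x * g x) x = f x * partial i g x + partial i f x * g x"
    proof (intro allI impI)
      fix x assume "x \<in> \<Omega>"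
      from C1_on_mult(2)[OF f g this] have "grad (\<lambda>x. f x * g x) x $ i = (f x *\<^sub>R grad g x + g x *\<^sub>R grad f x) $ i"
        by (rule arg_cong)
      then show "partial i (\<lambda>x. f x * g x) x = f x * partial i g x + partial i f x * g x"
        by (simp add: mult.commute)
    qed
  qed (use \<open>open \<Omega>\<close> in auto)
  also have "\<dots> = (LINT x:\<Omega>|lborel. f x * partial i g x) + (LINT x:\<Omega>|lborel. partial i f x * g x)"
    by (intro set_integral_add set_integrable_continuous_compact_support[OF \<open>open \<Omega>\<close> K(1,2)])
       (simp_all add: continuous_on_mult cont K pg)
  finally show ?thesis by simp
qed

subsection \<open>The fundamental lemma of the calculus of variations\<close>

text \<open>The parameter \<open>k\<close> sharpens the bump without moving its support: exp(-1/(k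
  s)) tends to 1 as k grows for every s > 0, so the products converge boundedly to the indicator of
  the open box.\<close>

definition boxbump :: "real^'n::finite \<Rightarrow> real^'n \<Rightarrow> real \<Rightarrow> real^'n \<Rightarrow> real" where
  "boxbump a b k x = (\<Prod>i\<in>UNIV. eflat 0 (k * (x $ i - a $ i)) * eflat 0 (k * (b $ i - x $ i)))"

lemma boxbump_smooth_elem: "smooth_elem (boxbump a b k)"
  unfolding boxbump_def by (intro smooth_elem_intros)

lemma eflat_0_bounds: "0 \<le> eflat 0 s" "eflat 0 s \<le> 1"
  by (auto simp: eflat_0)

lemma boxbump_bounds: "0 \<le> boxbump a b k x" "boxbump a b k x \<le> 1"
  unfolding boxbump_def by (auto intro!: prod_nonneg prod_le_1 mult_le_one eflat_0_bounds mult_nonneg_nonneg)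

lemma boxbump_zero:
  assumes "x \<notin> box a b" "k > 0" shows "boxbump a b k x = 0"
proof -
  obtain i where "\<not> (a $ i < x $ i \<and> x $ i < b $ i)" using assms by (auto simp: mem_box_cart)
  then have "k * (x $ i - a $ i) \<le> 0 \<or> k * (b $ i - x $ i) \<le> 0" using assms(2)
    by (auto simp: mult_le_0_iff)
  then show ?thesis unfolding boxbump_def
    by (intro prod_zero bexI[of _ i]) (auto simp: eflat_nonpos)
qed

lemma eflat_0_tendsto: "s > 0 \<Longrightarrow> (\<lambda>n. eflat 0 (real (Suc n) * s)) \<longlonglongrightarrow> 1"
proof -
  assume s: "s > 0"
  have "(\<lambda>n. exp (- (inverse (real (Suc n)) * inverse s))) \<longlonglongrightarrow> exp (- (0 * inverse s))"
    by (intro tendsto_intros LIMSEQ_inverse_real_of_nat)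
  moreover have "eflat 0 (real (Suc n) * s) = exp (- (inverse (real (Suc n)) * inverse s))" for n
    using s by (simp add: eflat_0 divide_inverse del: of_nat_Suc)
  ultimately show ?thesis by simp
qed

lemma boxbump_tendsto: "(\<lambda>n. boxbump a b (real (Suc n)) x) \<longlonglongrightarrow> indicator (box a b) x"
proof (cases "x \<in> box a b")
  case True
  have "(\<lambda>n. boxbump a b (real (Suc n)) x) \<longlonglongrightarrow> (\<Prod>i\<in>(UNIV::'a set). 1 * 1)"
    unfolding boxbump_def
    by (intro tendsto_prod tendsto_mult eflat_0_tendsto) (use True in \<open>auto simp: mem_box_cart\<close>)
  then show ?thesis using True by simp
qed (simp add: boxbump_zero del: of_nat_Suc)

text \<open>Box bumps are admissible tests and converge boundedly to indicators of boxes, so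
  \<open>h\<close> has integral zero over every small box. Measure uniqueness then gives h = 0 near
  each point.\<close>

lemma fundamental_lemma:
  fixes h :: "real^'n::finite \<Rightarrow> real"
  assumes U: "open U"
    and int: "\<And>K. compact K \<Longrightarrow> K \<subseteq> U \<Longrightarrow> set_integrable lborel K h"
    and zero: "\<And>\<xi>. test_fun U \<xi> \<Longrightarrow> (LINT x:U|lborel. h x * \<xi> x) = 0"
  shows "AE x in lborel. x \<in> U \<longrightarrow> h x = 0"
proof (rule AE_local)
  fix x0 assume "x0 \<in> U"
  then obtain a b where ab: "x0 \<in> box a b" "cbox a b \<subseteq> U"
    using U by (metis open_contains_cbox)
  define h1 where "h1 x = indicator (box a b) x * h x" for x
  have hc: "integrable lborel (\<lambda>x. indicator (cbox a b) x * h x)"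
    using int[OF compact_cbox ab(2)] by (simp add: set_integrable_def)
  have h1: "integrable lborel h1"
  proof -
    have "integrable lborel (\<lambda>x. indicator (box a b) x * (indicator (cbox a b) x * h x))"
      by (rule integrable_indicator_times[OF _ hc]) simp
    moreover have "(\<lambda>x. indicator (box a b) x * (indicator (cbox a b) x * h x)) = h1"
      using box_subset_cbox[of a b] by (auto simp: h1_def indicator_def fun_eq_iff)
    ultimately show ?thesis by simp
  qed
  have bx: "(LINT x|lborel. indicator (box c d) x * h1 x) = 0" for c d
  proof -
    \<comment> \<open>The intersection with the reference box is again a box, whose bumps are
      supported in \<open>U\<close> even if the box from \<open>c\<close> to \<open>d\<close> leaves
      it.\<close>
    obtain p q where pq: "box c d \<inter> box a b = box p q"
      using box_Int_box[of c d a b] by (rule that)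
    have pqa: "box p q \<subseteq> box a b" using pq by blast
    have [measurable]: "h1 \<in> borel_measurable borel" using h1 by auto
    have [measurable]: "boxbump p q k \<in> borel_measurable borel" for k
      by (intro borel_measurable_continuous_onI smooth_elem_continuous_on boxbump_smooth_elem)
    have "(\<lambda>n. LINT x|lborel. h1 x * boxbump p q (real (Suc n)) x) \<longlonglongrightarrow> (LINT x|lborel. h1 x * indicator (box p q) x)"
    proof (rule integral_dominated_convergence)
      show "integrable lborel (\<lambda>x. \<bar>h1 x\<bar>)" using h1 by simp
      show "AE x in lborel. norm (h1 x * boxbump p q (real (Suc n)) x) \<le> \<bar>h1 x\<bar>" for n
        using boxbump_bounds[of p q "real (Suc n)"] by (intro AE_I2) (simp add: abs_mult mult_left_le)
      show "AE x in lborel. (\<lambda>n. h1 x * boxbump p q (real (Suc n)) x) \<longlonglongrightarrow> h1 x * indicator (box p q) x"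
        by (intro AE_I2 tendsto_intros boxbump_tendsto)
    qed auto
    moreover have "(LINT x|lborel. h1 x * boxbump p q (real (Suc n)) x) = 0" for n
    proof -
      have "test_fun U (boxbump p q (real (Suc n)))"
        by (rule smooth_elem_test_fun[OF boxbump_smooth_elem compact_cbox ab(2)], rule boxbump_zero)
           (use pqa box_subset_cbox[of a b] in auto)
      then have "0 = (LINT x:U|lborel. h x * boxbump p q (real (Suc n)) x)" using zero by simp
      also have "\<dots> = (LINT x|lborel. h1 x * boxbump p q (real (Suc n)) x)"
        unfolding set_lebesgue_integral_def
      proof (rule Bochner_Integration.integral_cong)
        fix x
        have "boxbump p q (real (Suc n)) x = 0" if "x \<notin> box a b"
          by (rule boxbump_zero) (use that pqa in auto)
        then show "indicator U x *\<^sub>R (h x * boxbump p q (real (Suc n)) x) = h1 x * boxbump p q (real (Suc n)) x"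
          using ab(2) box_subset_cbox[of a b] unfolding h1_def
          by (cases "x \<in> box a b") (auto simp: indicator_def)
      qed simp
      finally show ?thesis by simp
    qed
    ultimately have "(LINT x|lborel. h1 x * indicator (box p q) x) = 0"
      by (simp add: LIMSEQ_const_iff)
    moreover have "(\<lambda>x. h1 x * indicator (box p q) x) = (\<lambda>x. indicator (box c d) x * h1 x)"
      unfolding pq[symmetric] by (auto simp: h1_def indicator_def fun_eq_iff)
    ultimately show ?thesis by simp
  qed
  have ae: "AE x in lborel. h1 x = 0" by (rule AE_zero_if_boxes[OF h1 bx])
  obtain r where r: "r > 0" "ball x0 r \<subseteq> box a b" using ab(1) open_box open_contains_ball by blast
  have "AE x in lborel. x \<in> ball x0 r \<longrightarrow> h x = 0"
    using ae by eventually_elim (use r in \<open>auto simp: h1_def indicator_def\<close>)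
  then show "\<exists>r>0. AE x in lborel. x \<in> ball x0 r \<longrightarrow> h x = 0" using r by blast
qed

subsection \<open>Mollification kernels\<close>

text \<open>The type token fixes the dimension, on which the normalising constant depends. The
  factor 2 is that of D|z|^2 = 2z and makes D\<kappa>_t equal to -(z/t^2) \<rho>_t without a further
  constant.\<close>

definition bump_mass :: "(real^'n::finite) itself \<Rightarrow> real" where
  "bump_mass _ = (LINT z|(lborel::(real^'n) measure). 2 * eflat 1 (1 - z \<bullet> z))"

text \<open>Every index is divided by the same mass, that of the mollifier, so that a spatial
  derivative leads from \<open>ker k\<close> to \<open>ker (Suc k)\<close> with no change of
  normalisation.\<close>

definition ker :: "nat \<Rightarrow> real \<Rightarrow> real^'n::finite \<Rightarrow> real" where
  "ker k t z = eflat k (1 - (z \<bullet> z) / t^2) / (bump_mass TYPE(real^'n) * t ^ CARD('n))"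

text \<open>\<open>Rho\<close> is the mollifier of mass one and \<open>Kap\<close> the kernel with
  $\partial_t\rho_t = t\,\Delta\kappa_t$; the prefixes \<open>D\<close>, \<open>H\<close>, \<open>T\<close> mark first, second and third spatial
  derivatives. The formulas result from differentiating $\mathrm{eflat}\,0\,(1-|z|^2/t^2)$.\<close>

definition Kap :: "real \<Rightarrow> real^'n::finite \<Rightarrow> real" where
  "Kap t z = ker 0 t z"

definition Rho :: "real \<Rightarrow> real^'n::finite \<Rightarrow> real" where
  "Rho t z = 2 * ker 1 t z"

definition DKap :: "'n \<Rightarrow> real \<Rightarrow> real^'n::finite \<Rightarrow> real" where
  "DKap j t z = - (2 * z $ j / t^2) * ker 1 t z"

definition DRho :: "'n \<Rightarrow> real \<Rightarrow> real^'n::finite \<Rightarrow> real" where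
  "DRho j t z = - (4 * z $ j / t^2) * ker 2 t z"

definition HKap :: "'n \<Rightarrow> 'n \<Rightarrow> real \<Rightarrow> real^'n::finite \<Rightarrow> real" where
  "HKap i j t z = - (2 * of_bool (i = j) / t^2) * ker 1 t z + 4 * z $ i * z $ j / t^4 * ker 2 t z"

definition TKap :: "'n \<Rightarrow> 'n \<Rightarrow> 'n \<Rightarrow> real \<Rightarrow> real^'n::finite \<Rightarrow> real" where
  "TKap i j k t z = 4 * (of_bool (i = j) * z $ k + of_bool (i = k) * z $ j + of_bool (j = k) * z $ i) / t^4 * ker 2 t z
     - 8 * z $ i * z $ j * z $ k / t^6 * ker 3 t z"

lemmas kernel_defs = Kap_def Rho_def DKap_def DRho_def HKap_def TKap_def

lemma bump_integrable: "integrable lborel (\<lambda>z::real^'n::finite. 2 * eflat 1 (1 - z \<bullet> z))"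
proof -
  have "set_integrable lborel UNIV (\<lambda>z::real^'n::finite. 2 * eflat 1 (1 - z \<bullet> z))"
  proof (rule set_integrable_continuous_compact_support[of _ "cball 0 1"])
    fix z :: "real^'n" assume "z \<in> UNIV - cball 0 1"
    then have "norm z * norm z \<ge> 1 * 1" by (intro mult_mono) auto
    then show "2 * eflat 1 (1 - z \<bullet> z) = 0"
      by (simp add: eflat_nonpos dot_square_norm power2_eq_square)
  qed (auto intro!: continuous_intros)
  then show ?thesis by (simp add: set_integrable_def)
qed

text \<open>Were the mass zero, the nonnegative integrand would vanish almost everywhere, although
  it is positive on the unit ball.\<close>

lemma bump_mass_pos: "bump_mass TYPE(real^'n::finite) > 0"
proof -
  have nn: "2 * eflat 1 (1 - z \<bullet> z) \<ge> 0" for z :: "real^'n" by (simp add: eflat_1)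
  have "bump_mass TYPE(real^'n) \<ge> 0" unfolding bump_mass_def
    by (rule Bochner_Integration.integral_nonneg) (rule nn)
  moreover have "bump_mass TYPE(real^'n) \<noteq> 0"
  proof
    assume "bump_mass TYPE(real^'n) = 0"
    then have "AE z in (lborel::(real^'n) measure). 2 * eflat 1 (1 - z \<bullet> z) = 0"
      unfolding bump_mass_def using bump_integrable nn
      by (subst (asm) integral_nonneg_eq_0_iff_AE) auto
    then have "AE z in (lborel::(real^'n) measure). z \<notin> ball 0 1"
    proof eventually_elim
      case (elim z)
      have "norm z * norm z < 1 * 1" if "norm z < 1"
        using that by (intro mult_strict_mono') auto
      then show ?case using elim by (auto simp: eflat_1 dot_square_norm power2_eq_square split: if_splits)
    qed
    then have "emeasure lborel (ball (0::real^'n) 1) = 0"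
      by (subst (asm) AE_iff_measurable[where N = "ball 0 1"]) auto
    then show False
      using content_ball_pos[of 1 "0::real^'n"] by (simp add: measure_def)
  qed
  ultimately show ?thesis by linarith
qed

lemma ker_zero: "t > 0 \<Longrightarrow> norm z \<ge> t \<Longrightarrow> ker k t z = 0"
proof -
  assume t: "t > 0" "norm z \<ge> t"
  then have "t^2 \<le> z \<bullet> z" by (metis dot_square_norm less_imp_le power_mono)
  then have "1 - (z \<bullet> z) / t^2 \<le> 0" using t(1) by (simp add: divide_simps)
  then show ?thesis by (simp add: ker_def eflat_nonpos)
qed

lemma ker_bound: "\<exists>C\<ge>0. \<forall>t>0. \<forall>z::real^'n::finite. \<bar>ker k t z\<bar> \<le> C / t ^ CARD('n)"
proof -
  obtain C where C: "C \<ge> 0" "\<And>s. s \<le> 1 \<Longrightarrow> \<bar>eflat k s\<bar> \<le> C" using eflat_bounded[of k] by blast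
  define c where "c = bump_mass TYPE(real^'n)"
  have c: "c > 0" unfolding c_def by (rule bump_mass_pos)
  have "\<bar>ker k t z\<bar> \<le> (C / c) / t ^ CARD('n)" if "t > 0" for t and z :: "real^'n"
  proof -
    have "\<bar>eflat k (1 - (z \<bullet> z) / t^2)\<bar> \<le> C" by (rule C) simp
    then show ?thesis using c that
      by (simp add: ker_def c_def[symmetric] abs_mult divide_right_mono)
  qed
  then show ?thesis using C c by (intro exI[of _ "C / c"]) auto
qed

lemma ker_has_derivative:
  "(ker k t has_derivative (\<lambda>h. - (2 * (z \<bullet> h) / t^2) * ker (Suc k) t z)) (at (z::real^'n::finite))"
proof -
  have "((\<lambda>z. 1 - (z \<bullet> z) * c) has_derivative (\<lambda>h. - (2 * (z \<bullet> h) * c))) (at z)" for c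
    by (auto intro!: derivative_eq_intros simp: inner_commute)
  from this[of "1 / t^2"] have 1: "((\<lambda>z. 1 - (z \<bullet> z) / t^2) has_derivative (\<lambda>h. - (2 * (z \<bullet> h) / t^2))) (at z)"
    by simp
  have "((\<lambda>z. eflat k (1 - (z \<bullet> z) / t^2)) has_derivative
     (\<lambda>h. eflat (Suc k) (1 - (z \<bullet> z) / t^2) * (- (2 * (z \<bullet> h) / t^2)))) (at z)"
    using has_derivative_compose[OF 1 eflat_has_derivative[unfolded has_field_derivative_def]] by simp
  from has_derivative_mult_right[OF this, of "1 / (bump_mass TYPE(real^'n) * t ^ CARD('n))"]
  show ?thesis by (simp add: ker_def[abs_def] mult_ac)
qed

lemma ker_has_derivative_scale:
  fixes z :: "real^'n::finite"
  assumes "t > 0"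
  shows "((\<lambda>t. ker k t z) has_real_derivative
    (2 * (z \<bullet> z) / t^3 * ker (Suc k) t z - CARD('n) / t * ker k t z)) (at t)"
proof -
  define c where "c = bump_mass TYPE(real^'n)"
  have c: "c > 0" unfolding c_def by (rule bump_mass_pos)
  define E where "E = eflat k (1 - (z \<bullet> z) / t^2)"
  define E' where "E' = eflat (Suc k) (1 - (z \<bullet> z) / t^2)"
  have "((\<lambda>t. 1 - (z \<bullet> z) / t^2) has_real_derivative (2 * (z \<bullet> z) / t^3)) (at t)"
    using assms by (auto intro!: derivative_eq_intros simp: field_simps power2_eq_square power3_eq_cube)
  from DERIV_chain2[OF eflat_has_derivative this]
  have 1: "((\<lambda>t. eflat k (1 - (z \<bullet> z) / t^2)) has_real_derivative E' * (2 * (z \<bullet> z) / t^3)) (at t)"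
    by (simp add: E'_def)
  have 2: "((\<lambda>t. c * t ^ CARD('n)) has_real_derivative c * (CARD('n) * t ^ (CARD('n) - 1))) (at t)"
    by (auto intro!: derivative_eq_intros)
  have "((\<lambda>t. eflat k (1 - (z \<bullet> z) / t^2) / (c * t ^ CARD('n))) has_real_derivative
     (E' * (2 * (z \<bullet> z) / t^3) * (c * t ^ CARD('n)) - E * (c * (CARD('n) * t ^ (CARD('n) - 1)))) /
      ((c * t ^ CARD('n)) * (c * t ^ CARD('n)))) (at t)"
    unfolding E_def by (rule DERIV_divide[OF 1 2]) (use c assms in simp)
  moreover have "(E' * (2 * (z \<bullet> z) / t^3) * (c * t ^ CARD('n)) - E * (c * (CARD('n) * t ^ (CARD('n) - 1)))) /
      ((c * t ^ CARD('n)) * (c * t ^ CARD('n))) = 2 * (z \<bullet> z) / t^3 * (E' / (c * t ^ CARD('n))) - CARD('n) / t * (E / (c * t ^ CARD('n)))"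
  proof -
    \<comment> \<open>The dimension is at least one, so t^n = t t^(n-1); the identity that follows
      is stated with t^(n-1) abstracted.\<close>
    obtain m where m: "CARD('n) = Suc m" by (metis Suc_pred zero_less_card_finite)
    have "(E' * X * (c * T) - E * (c * (n * T'))) / ((c * T) * (c * T)) = X * (E' / (c * T)) - n / t * (E / (c * T))"
      if "T = t * T'" "T' \<noteq> 0" for X T T' n :: real
      using c assms that by (simp add: divide_simps) (simp add: algebra_simps)
    from this[of "t ^ CARD('n)" "t ^ (CARD('n) - 1)" "2 * (z \<bullet> z) / t^3" "CARD('n)"] assms m
    show ?thesis by simp
  qed
  ultimately show ?thesis by (simp add: ker_def c_def E_def E'_def)
qed

lemma continuous_on_ker [continuous_intros]:
  assumes "continuous_on S f" "continuous_on S g" "\<And>x. x \<in> S \<Longrightarrow> f x \<noteq> 0"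
  shows "continuous_on S (\<lambda>x. ker k (f x) (g x :: real^'n::finite))"
  unfolding ker_def using assms bump_mass_pos[where 'n='n]
  by (auto intro!: continuous_intros)

lemma ker_measurable [measurable]: "ker k t \<in> borel_measurable borel"
  unfolding ker_def by measurable

lemma ker_smooth_elem: "smooth_elem (\<lambda>y. ker k t (x - y))"
  unfolding ker_def inner_vec_def by (simp, intro smooth_elem_intros)

lemma kernel_smooth_elem:
  "smooth_elem (\<lambda>y. Kap t (x - y))" "smooth_elem (\<lambda>y. Rho t (x - y))" "smooth_elem (\<lambda>y. DKap i t (x - y))"
  "smooth_elem (\<lambda>y. HKap i j t (x - y))"
  unfolding kernel_defs by (simp_all, intro smooth_elem_intros ker_smooth_elem; fail | intro smooth_elem_intros ker_smooth_elem)+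

lemma kernel_zero:
  assumes "t > 0" "norm z \<ge> t"
  shows "Kap t z = 0" "Rho t z = 0" "DKap i t z = 0" "DRho i t z = 0" "HKap i j t z = 0" "TKap i j k t z = 0"
  using assms by (simp_all add: kernel_defs ker_zero)

lemma kernel_measurable [measurable]:
  "Kap t \<in> borel_measurable borel" "Rho t \<in> borel_measurable borel" "DKap i t \<in> borel_measurable borel"
  "DRho i t \<in> borel_measurable borel" "HKap i j t \<in> borel_measurable borel" "TKap i j k t \<in> borel_measurable borel"
  unfolding kernel_defs by measurable

lemma continuous_on_kernel [continuous_intros]:
  assumes "continuous_on S f" "continuous_on S g" "\<And>x. x \<in> S \<Longrightarrow> f x \<noteq> 0"
  shows "continuous_on S (\<lambda>x. Rho (f x) (g x))" "continuous_on S (\<lambda>x. DKap i (f x) (g x))"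
    "continuous_on S (\<lambda>x. DRho i (f x) (g x))" "continuous_on S (\<lambda>x. HKap i j (f x) (g x))"
    "continuous_on S (\<lambda>x. TKap i j k (f x) (g x))"
  unfolding kernel_defs using assms
  by (auto intro!: continuous_intros)

lemma Rho_nonneg: "t > 0 \<Longrightarrow> Rho t (z::real^'n::finite) \<ge> 0"
  using bump_mass_pos[where 'n='n] by (simp add: Rho_def ker_def eflat_1)

text \<open>On the support |z| \<le> t, and D\<kappa>_t = -(z/t^2) \<rho>_t. This bound lets
  convolutions with D\<kappa>_t be controlled by convolutions with the mollifier itself.\<close>

lemma DKap_le_Rho:
  assumes "t > 0" shows "\<bar>DKap j t z\<bar> \<le> Rho t z / t"
proof (cases "norm z \<ge> t")
  case False
  have "\<bar>z $ j\<bar> \<le> norm z" by (rule component_le_norm_cart)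
  then have "\<bar>z $ j\<bar> \<le> t" using False by simp
  then have "\<bar>z $ j\<bar> / t^2 \<le> 1 / t" using assms by (simp add: divide_simps power2_eq_square)
  then have "\<bar>z $ j\<bar> / t^2 * Rho t z \<le> 1 / t * Rho t z"
    by (rule mult_right_mono) (rule Rho_nonneg[OF assms])
  moreover have "\<bar>DKap j t z\<bar> = \<bar>z $ j\<bar> / t^2 * Rho t z"
    using Rho_nonneg[OF assms, of z] by (simp add: DKap_def Rho_def abs_mult)
  ultimately show ?thesis by simp
qed (use assms in \<open>simp add: kernel_zero\<close>)

lemma HKap_bound:
  "\<exists>C\<ge>0. \<forall>t>0. \<forall>z::real^'n::finite. \<forall>i j. \<bar>HKap i j t z\<bar> \<le> C / t^2 / t ^ CARD('n) * indicator (cball 0 t) z"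
proof -
  obtain C1 where C1: "C1 \<ge> 0" "\<And>t z. t > 0 \<Longrightarrow> \<bar>ker 1 t (z::real^'n)\<bar> \<le> C1 / t ^ CARD('n)" using ker_bound by blast
  obtain C2 where C2: "C2 \<ge> 0" "\<And>t z. t > 0 \<Longrightarrow> \<bar>ker 2 t (z::real^'n)\<bar> \<le> C2 / t ^ CARD('n)" using ker_bound by blast
  have "\<bar>HKap i j t z\<bar> \<le> (2 * C1 + 4 * C2) / t^2 / t ^ CARD('n) * indicator (cball 0 t) z"
    if t: "t > 0" for t and z :: "real^'n" and i j
  proof (cases "norm z \<le> t")
    case True
    have a: "\<bar>z $ i\<bar> \<le> t" "\<bar>z $ j\<bar> \<le> t" using True component_le_norm_cart order_trans by blast+
    have "\<bar>z $ i\<bar> * \<bar>z $ j\<bar> \<le> t * t" by (rule mult_mono) (use a t in auto)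
    then have "\<bar>4 * z $ i * z $ j / t^4\<bar> \<le> 4 / t^2"
      using t by (simp add: abs_mult divide_simps power4_eq_xxxx power2_eq_square)
    then have "\<bar>4 * z $ i * z $ j / t^4 * ker 2 t z\<bar> \<le> 4 / t^2 * (C2 / t ^ CARD('n))"
      unfolding abs_mult by (rule mult_mono) (use C2 t in auto)
    moreover have "\<bar>- (2 * of_bool (i = j) / t^2)\<bar> \<le> 2 / t^2" by simp
    then have "\<bar>- (2 * of_bool (i = j) / t^2) * ker 1 t z\<bar> \<le> 2 / t^2 * (C1 / t ^ CARD('n))"
      unfolding abs_mult by (rule mult_mono) (use C1 t in auto)
    ultimately have "\<bar>HKap i j t z\<bar> \<le> 2 / t^2 * (C1 / t ^ CARD('n)) + 4 / t^2 * (C2 / t ^ CARD('n))"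
      unfolding HKap_def by (meson abs_triangle_ineq add_mono order_trans)
    also have "\<dots> = (2 * C1 + 4 * C2) / t^2 / t ^ CARD('n)"
      by (simp add: add_divide_distrib)
    finally show ?thesis using True by simp
  qed (use t in \<open>simp add: kernel_zero\<close>)
  then show ?thesis using C1 C2 by (intro exI[of _ "2 * C1 + 4 * C2"]) auto
qed

lemma Rho_has_derivative: "(Rho t has_derivative (\<lambda>h. h \<bullet> (\<chi> i. DRho i t z))) (at z)"
proof -
  have "(Rho t has_derivative (\<lambda>h. 2 * (- (2 * (z \<bullet> h) / t^2) * ker 2 t z))) (at z)"
    unfolding Rho_def[abs_def] using has_derivative_mult_right[OF ker_has_derivative[of 1 t z], of 2]
    by (simp add: numeral_2_eq_2)
  moreover have "2 * (- (2 * (z \<bullet> h) / t^2) * ker 2 t z) = h \<bullet> (\<chi> i. DRho i t z)" for h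
    by (simp add: inner_vec_def DRho_def sum_distrib_left sum_distrib_right sum_divide_distrib sum_negf mult_ac)
  ultimately show ?thesis by simp
qed

lemma partial_shift:
  assumes "(f has_derivative D) (at (x - y))"
  shows "partial i (\<lambda>y. f (x - y)) y = - D (axis i 1)"
proof -
  interpret bounded_linear D using assms by (rule has_derivative_bounded_linear)
  have "((\<lambda>y. x - y) has_derivative (\<lambda>h. - h)) (at y)"
    by (auto intro!: derivative_eq_intros)
  from has_derivative_compose[OF this assms] have "((\<lambda>y. f (x - y)) has_derivative (\<lambda>h. D (- h))) (at y)" .
  from partial_eqI[OF this] show ?thesis by (simp add: neg)
qed

lemma coord_has_derivative: "((\<lambda>z::real^'n::finite. z $ i) has_derivative (\<lambda>h. h $ i)) (at z)"
  by (rule bounded_linear_imp_has_derivative) (rule bounded_linear_vec_nth)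

text \<open>The derivatives are taken in the integration variable \<open>y\<close>, since the
  kernels act as test functions there; hence the minus signs.\<close>

lemma partial_kernel:
  "partial i (\<lambda>y. Rho t (x - y)) y = - DRho i t (x - y)"
  "partial i (\<lambda>y. Kap t (x - y)) y = - DKap i t (x - y)"
  "partial i (\<lambda>y. DKap j t (x - y)) y = - HKap i j t (x - y)"
  "partial k (\<lambda>y. HKap i j t (x - y)) y = - TKap i j k t (x - y)"
proof -
  note kd = ker_has_derivative
  show "partial i (\<lambda>y. Rho t (x - y)) y = - DRho i t (x - y)"
    by (subst partial_shift[OF Rho_has_derivative]) (simp add: inner_axis')
  show "partial i (\<lambda>y. Kap t (x - y)) y = - DKap i t (x - y)"
    unfolding Kap_def
    by (subst partial_shift[OF kd]) (simp add: inner_axis DKap_def)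
  show "partial i (\<lambda>y. DKap j t (x - y)) y = - HKap i j t (x - y)"
  proof -
    have eq: "DKap j t = (\<lambda>z. (- 2 / t^2 * z $ j) * ker 1 t z)"
      by (simp add: DKap_def fun_eq_iff)
    show ?thesis unfolding eq
      apply (subst partial_shift[OF has_derivative_mult[OF has_derivative_mult_right[OF coord_has_derivative] kd]])
      apply (simp add: inner_axis)
      apply (simp add: axis_def HKap_def eval_nat_numeral of_bool_def)
      apply (simp add: algebra_simps add_divide_distrib)
      done
  qed
  show "partial k (\<lambda>y. HKap i j t (x - y)) y = - TKap i j k t (x - y)"
  proof -
    have eq: "HKap i j t = (\<lambda>z. (- 2 / t^2 * of_bool (i = j)) * ker 1 t z + (4 / t^4 * (z $ i * z $ j)) * ker 2 t z)"
      by (simp add: HKap_def fun_eq_iff)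
    show ?thesis unfolding eq
      apply (subst partial_shift[OF has_derivative_add[OF has_derivative_mult_right[OF kd]
          has_derivative_mult[OF has_derivative_mult_right[OF has_derivative_mult[OF coord_has_derivative coord_has_derivative]] kd]]])
      apply (simp add: inner_axis)
      apply (simp add: axis_def TKap_def eval_nat_numeral of_bool_def)
      apply (simp add: algebra_simps add_divide_distrib)
      apply (simp only: add_divide_distrib[symmetric])
      apply (simp add: algebra_simps)
      done
  qed
qed

text \<open>Conceptually the scale derivative of \<rho>_t is -div(z \<rho>_t)/t, and z \<rho>_t =
  -t^2 D\<kappa>_t. The proof compares the two explicit expressions in \<open>ker 1\<close> and
  \<open>ker 2\<close>.\<close>

lemma Rho_has_derivative_scale:
  fixes z :: "real^'n::finite"
  assumes "t > 0"
  shows "((\<lambda>t. Rho t z) has_real_derivative t * (\<Sum>k\<in>UNIV. HKap k k t z)) (at t)"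
proof -
  have "((\<lambda>t. Rho t z) has_real_derivative
    2 * (2 * (z \<bullet> z) / t^3 * ker 2 t z - CARD('n) / t * ker 1 t z)) (at t)"
    unfolding Rho_def using DERIV_cmult[OF ker_has_derivative_scale[OF assms, of 1 z], of 2]
    by (simp add: numeral_2_eq_2)
  moreover have "(\<Sum>k\<in>UNIV. HKap k k t z) = - (2 * CARD('n) / t^2) * ker 1 t z + 4 * (z \<bullet> z) / t^4 * ker 2 t z"
    by (simp add: HKap_def sum.distrib sum_subtractf inner_vec_def sum_distrib_left sum_distrib_right sum_divide_distrib mult.assoc)
  moreover have "t * (- (2 * CARD('n) / t^2) * a + 4 * (z \<bullet> z) / t^4 * b) = 2 * (2 * (z \<bullet> z) / t^3 * b - CARD('n) / t * a)" for a b
    using assms by (simp add: field_simps power2_eq_square power3_eq_cube power4_eq_xxxx)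
  ultimately show ?thesis by simp
qed

text \<open>This is the i-th spatial derivative of the identity for \<open>Rho\<close>. In the trace
  of the third derivatives the two Kronecker terms with i = k contribute 2 z_i and the remaining one
  n z_i.\<close>

lemma DRho_has_derivative_scale:
  fixes z :: "real^'n::finite"
  assumes "t > 0"
  shows "((\<lambda>t. DRho i t z) has_real_derivative t * (\<Sum>k\<in>UNIV. TKap i k k t z)) (at t)"
proof -
  have *: "((\<lambda>t. - (4 * z $ i / t^2)) has_real_derivative (8 * z $ i / t^3)) (at t)"
    using assms by (auto intro!: derivative_eq_intros simp: field_simps power2_eq_square power3_eq_cube)
  have "((\<lambda>t. DRho i t z) has_real_derivative
    (8 * z $ i / t^3) * ker 2 t z + (2 * (z \<bullet> z) / t^3 * ker 3 t z - CARD('n) / t * ker 2 t z) * (- (4 * z $ i / t^2))) (at t)"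
    unfolding DRho_def using DERIV_mult[OF * ker_has_derivative_scale[OF assms, of 2 z]]
    by (simp add: eval_nat_numeral)
  moreover have "(\<Sum>k\<in>UNIV. TKap i k k t z) = 4 * (2 * z $ i + CARD('n) * z $ i) / t^4 * ker 2 t z - 8 * z $ i * (z \<bullet> z) / t^6 * ker 3 t z"
  proof -
    have "(\<Sum>k\<in>UNIV. TKap i k k t z) =
      4 * (\<Sum>k\<in>UNIV. of_bool (i = k) * z $ k + of_bool (i = k) * z $ k + z $ i) / t^4 * ker 2 t z - 8 * z $ i * (\<Sum>k\<in>UNIV. z $ k * z $ k) / t^6 * ker 3 t z"
      by (simp add: TKap_def sum_subtractf sum_distrib_left sum_distrib_right sum_divide_distrib mult.assoc)
    also have "(\<Sum>k\<in>UNIV. of_bool (i = k) * z $ k + of_bool (i = k) * z $ k + z $ i) = 2 * z $ i + CARD('n) * z $ i"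
    proof -
      have "(\<Sum>k\<in>UNIV. of_bool (i = k) * z $ k) = z $ i"
        by (subst sum.remove[of _ i]) (auto intro!: sum.neutral)
      then show ?thesis by (simp only: sum.distrib) simp
    qed
    finally show ?thesis by (simp add: inner_vec_def)
  qed
  moreover have "t * (4 * (2 * z $ i + CARD('n) * z $ i) / t^4 * b - 8 * z $ i * (z \<bullet> z) / t^6 * c)
     = (8 * z $ i / t^3) * b + (2 * (z \<bullet> z) / t^3 * c - CARD('n) / t * b) * (- (4 * z $ i / t^2))" for b c
    using assms by (simp add: divide_simps) (simp add: algebra_simps eval_nat_numeral)
  ultimately show ?thesis by simp
qed

text \<open>The substitution y = x - t w has Jacobian t^n, which cancels the power of t in
  \<open>ker\<close>.\<close>

lemma integral_Rho: 
  assumes "t > 0" shows "(LINT y|lborel. Rho t (x - y :: real^'n::finite)) = 1"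
proof -
  define c where "c = bump_mass TYPE(real^'n)"
  have c: "c > 0" unfolding c_def by (rule bump_mass_pos)
  have "(LINT y|lborel. Rho t (x - y)) =
    (LINT y|density (distr lborel borel (\<lambda>w. x + (- t) *\<^sub>R w)) (\<lambda>_. \<bar>- t\<bar> ^ DIM(real^'n)). Rho t (x - y))"
    using lborel_affine[of "- t" x] assms by simp
  also have "\<dots> = (LINT w|lborel. t ^ CARD('n) * Rho t (t *\<^sub>R (w::real^'n)))"
  proof -
    have [measurable]: "(\<lambda>y. Rho t (x - y)) \<in> borel_measurable borel" by measurable
    show ?thesis using assms
      by (subst integral_real_density) (auto simp: integral_distr simp del: integral_mult_right_zero)
  qed
  also have "\<dots> = (LINT w|lborel. (2 * eflat 1 (1 - w \<bullet> (w::real^'n))) / c)"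
    using assms c by (intro Bochner_Integration.integral_cong) 
      (auto simp: Rho_def ker_def c_def[symmetric] power2_eq_square)
  also have "\<dots> = (LINT w|lborel. (2 * eflat 1 (1 - (w::real^'n) \<bullet> w))) / c"
    by (rule integral_divide_zero)
  also have "\<dots> = 1" using c unfolding bump_mass_def[symmetric] c_def[symmetric]
    by (simp add: c_def bump_mass_def)
  finally show ?thesis .
qed

subsection \<open>Convolution with the kernels\<close>

text \<open>Functions on \<open>\<Omega>\<close> are cut off to a compact set before they are
  convolved; against such functions every continuous kernel is integrable, with no growth
  condition.\<close>

definition cs_integrable :: "('a::euclidean_space \<Rightarrow> real) \<Rightarrow> bool" where
  "cs_integrable v \<longleftrightarrow> integrable lborel v \<and> (\<exists>A. compact A \<and> (\<forall>y. y \<notin> A \<longrightarrow> v y = 0))"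

definition convolve :: "('a::euclidean_space \<Rightarrow> real) \<Rightarrow> ('a \<Rightarrow> real) \<Rightarrow> 'a \<Rightarrow> real" where
  "convolve k v x = (LINT y|lborel. v y * k (x - y))"

lemma cs_integrable_measurable [measurable_dest]: "cs_integrable v \<Longrightarrow> v \<in> borel_measurable borel"
  by (auto simp: cs_integrable_def)

lemma cs_integrable_integrable:
  assumes "cs_integrable v" "k \<in> borel_measurable borel" "continuous_on UNIV k"
  shows "integrable lborel (\<lambda>y. v y * k y)"
proof -
  from assms(1) obtain A where "integrable lborel v" "compact A" "\<And>y. y \<notin> A \<Longrightarrow> v y = 0"
    by (auto simp: cs_integrable_def)
  then show ?thesis
    by (rule integrable_mult_continuous_on_compact) (use assms continuous_on_subset in auto)
qed

text \<open>Meant for a coefficient that is continuous on a closed ball and arbitrary elsewhere: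
  multiplying it by the indicator of \<open>S\<close> restores measurability and does not affect the
  product with \<open>v\<close>.\<close>

lemma cs_integrable_mult_continuous:
  fixes v k :: "'a::euclidean_space \<Rightarrow> real"
  assumes "cs_integrable v" "closed S" "continuous_on S k" "\<And>y. y \<notin> S \<Longrightarrow> v y = 0"
  shows "cs_integrable (\<lambda>y. v y * k y)"
proof -
  from assms(1) obtain A where A: "integrable lborel v" "compact A" "\<And>y. y \<notin> A \<Longrightarrow> v y = 0"
    by (auto simp: cs_integrable_def)
  have S: "S \<in> sets borel" using assms(2) by simp
  have "(\<lambda>y. indicator S y *\<^sub>R k y) \<in> borel_measurable borel"
    by (rule borel_measurable_continuous_on_indicator[OF S assms(3)])
  then have m: "(\<lambda>y. indicator S y * k y) \<in> borel_measurable borel" by simp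
  have "continuous_on (A \<inter> S) (\<lambda>y. indicator S y * k y)"
    using continuous_on_subset[OF assms(3), of "A \<inter> S"]
    by (rule continuous_on_eq) auto
  then have "integrable lborel (\<lambda>y. v y * (indicator S y * k y))"
    using A assms(2,4) m
    by (intro integrable_mult_continuous_on_compact[where A = "A \<inter> S"]) (auto intro: compact_Int_closed)
  moreover have "(\<lambda>y. v y * (indicator S y * k y)) = (\<lambda>y. v y * k y)"
    using assms(4) by (auto simp: indicator_def fun_eq_iff)
  ultimately show ?thesis unfolding cs_integrable_def using A by auto
qed

lemma cs_integrableI_continuous:
  fixes v :: "'a::euclidean_space \<Rightarrow> real"
  assumes "continuous_on UNIV v" "compact A" "\<And>y. y \<notin> A \<Longrightarrow> v y = 0"
  shows "cs_integrable v"
  unfolding cs_integrable_def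
  using set_integrable_continuous_compact_support[of UNIV A v] assms
  by (auto simp: set_integrable_def)

lemma cs_integrableI_indicator:
  fixes v :: "'a::euclidean_space \<Rightarrow> real"
  assumes "compact K" "set_integrable lborel K v"
  shows "cs_integrable (\<lambda>x. indicator K x * v x)"
  using assms by (auto simp: cs_integrable_def set_integrable_def intro!: exI[of _ K])

lemma cs_integrable_kernel:
  assumes "cs_integrable v" "t > 0"
  shows "integrable lborel (\<lambda>y. v y * Rho t (x - y))" "integrable lborel (\<lambda>y. v y * DKap i t (x - y))"
    "integrable lborel (\<lambda>y. v y * DRho i t (x - y))" "integrable lborel (\<lambda>y. v y * HKap i j t (x - y))"
    "integrable lborel (\<lambda>y. v y * TKap i j k t (x - y))"
  using assms by (auto intro!: cs_integrable_integrable continuous_intros)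

lemma convolve_Rho_has_derivative:
  assumes "cs_integrable v" "t > 0"
  shows "(convolve (Rho t) v has_derivative (\<lambda>h. (\<chi> i. convolve (DRho i t) v x) \<bullet> h)) (at x)"
proof -
  from assms(1) obtain A where A: "integrable lborel v" "compact A" "\<And>y. y \<notin> A \<Longrightarrow> v y = 0"
    by (auto simp: cs_integrable_def)
  have c: "continuous_on S (\<lambda>z. \<chi> i. DRho i t (fst z - snd z))" for S
    using assms(2) by (auto intro!: continuous_intros)
  have d: "((\<lambda>x. Rho t (x - y)) has_derivative (\<lambda>h. h \<bullet> (\<chi> i. DRho i t (p - y)))) (at p)" for p y
    by (rule has_derivative_compose[of "\<lambda>x. x - y" "\<lambda>h. h", OF _ Rho_has_derivative])
       (auto intro!: derivative_eq_intros)
  have m: "(\<lambda>y. \<chi> i. DRho i t (p - y)) \<in> borel_measurable borel" for p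
    using assms(2) by (intro borel_measurable_continuous_onI) (auto intro!: continuous_intros)
  have D: "(convolve (Rho t) v has_derivative (\<lambda>h. h \<bullet> (LINT y|lborel. v y *\<^sub>R (\<chi> i. DRho i t (x - y))))) (at x)"
    unfolding convolve_def[abs_def]
    by (rule has_derivative_param_integral[OF A, where \<delta> = 1])
       (use c d m assms(2) in \<open>auto intro!: continuous_intros\<close>)
  have i: "integrable lborel (\<lambda>y. v y *\<^sub>R (\<chi> i. DRho i t (x - y)))"
  proof -
    have "(\<lambda>y. v y *\<^sub>R (\<chi> i. DRho i t (x - y))) = (\<lambda>y. \<Sum>i\<in>UNIV. (v y * DRho i t (x - y)) *\<^sub>R axis i 1)"
      by (auto simp: fun_eq_iff vec_eq_iff axis_def if_distrib cong: if_cong)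
    moreover have "integrable lborel (\<lambda>y. \<Sum>i\<in>UNIV. (v y * DRho i t (x - y)) *\<^sub>R (axis i 1 :: real^'a))"
      by (intro Bochner_Integration.integrable_sum integrable_scaleR_left cs_integrable_kernel assms)
    ultimately show ?thesis by simp
  qed
  have "(LINT y|lborel. v y *\<^sub>R (\<chi> i. DRho i t (x - y))) = (\<chi> i. convolve (DRho i t) v x)"
  proof (subst vec_eq_iff, intro allI)
    fix j
    have "(LINT y|lborel. v y *\<^sub>R (\<chi> i. DRho i t (x - y))) $ j = (LINT y|lborel. v y *\<^sub>R (\<chi> i. DRho i t (x - y))) \<bullet> axis j 1"
      by (simp add: inner_axis)
    also have "\<dots> = (LINT y|lborel. (v y *\<^sub>R (\<chi> i. DRho i t (x - y))) \<bullet> axis j 1)"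
      by (rule integral_inner_left[symmetric]) (rule i)
    also have "\<dots> = convolve (DRho j t) v x" by (simp add: inner_axis convolve_def)
    finally show "(LINT y|lborel. v y *\<^sub>R (\<chi> i. DRho i t (x - y))) $ j = (\<chi> i. convolve (DRho i t) v x) $ j" by simp
  qed
  with D show ?thesis by (simp add: inner_commute)
qed

lemma convolve_scale_aux:
  fixes K K' :: "real \<Rightarrow> real^'n::finite \<Rightarrow> real"
  assumes "cs_integrable v" "t > 0"
    and "\<And>t. K t \<in> borel_measurable borel" "\<And>t. K' t \<in> borel_measurable borel"
    and "\<And>t. t > 0 \<Longrightarrow> continuous_on UNIV (K t)"
    and "\<And>t z. t > 0 \<Longrightarrow> ((\<lambda>t. K t z) has_real_derivative K' t z) (at t)"
    and "continuous_on ({0<..} \<times> UNIV) (\<lambda>z. K' (fst z) (snd z))"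
  shows "((\<lambda>t. convolve (K t) v x) has_real_derivative convolve (K' t) v x) (at t)"
proof -
  from assms(1) obtain A where A: "integrable lborel v" "compact A" "\<And>y. y \<notin> A \<Longrightarrow> v y = 0"
    by (auto simp: cs_integrable_def)
  \<comment> \<open>The kernels degenerate at scale 0; the radius t/2 keeps the parameter interval
    away from it.\<close>
  have pos: "s > 0" if "s \<in> cball t (t / 2)" for s
  proof -
    have "\<bar>t - s\<bar> \<le> t / 2" using that by (simp add: dist_real_def)
    then show ?thesis using assms(2) by linarith
  qed
  show ?thesis unfolding convolve_def
  proof (rule has_derivative_param_integral_real[OF A, where \<delta> = "t / 2"])
    show "(\<lambda>y. K p (x - y)) \<in> borel_measurable borel" "(\<lambda>y. K' p (x - y)) \<in> borel_measurable borel" for p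
      using measurable_compose[OF _ assms(3), of "\<lambda>y. x - y"] measurable_compose[OF _ assms(4), of "\<lambda>y. x - y"] by auto
    show "continuous_on A (\<lambda>y. K p (x - y))" if "p \<in> cball t (t / 2)" for p
      by (rule continuous_on_compose2[OF assms(5)[OF pos[OF that]]]) (auto intro!: continuous_intros)
    show "continuous_on (cball t (t / 2) \<times> A) (\<lambda>z. K' (fst z) (x - snd z))"
    proof -
      have "continuous_on (cball t (t / 2) \<times> A) (\<lambda>z. (\<lambda>z. K' (fst z) (snd z)) (fst z, x - snd z))"
        by (rule continuous_on_compose2[OF assms(7)]) (use pos in \<open>auto intro!: continuous_intros\<close>)
      then show ?thesis by simp
    qed
  qed (use assms pos in auto)
qed

lemma convolve_sum:
  assumes "finite S" "\<And>k. k \<in> S \<Longrightarrow> integrable lborel (\<lambda>y. v y * K k (x - y))"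
  shows "convolve (\<lambda>z. c * (\<Sum>k\<in>S. K k z)) v x = c * (\<Sum>k\<in>S. convolve (K k) v x)"
proof -
  have "convolve (\<lambda>z. c * (\<Sum>k\<in>S. K k z)) v x = (LINT y|lborel. c * (\<Sum>k\<in>S. v y * K k (x - y)))"
    unfolding convolve_def by (simp add: sum_distrib_left mult.left_commute)
  also have "\<dots> = c * (\<Sum>k\<in>S. convolve (K k) v x)"
    unfolding convolve_def using assms by simp
  finally show ?thesis .
qed

lemma convolve_Rho_scale:
  fixes v :: "real^'n::finite \<Rightarrow> real"
  assumes "cs_integrable v" "t > 0"
  shows "((\<lambda>t. convolve (Rho t) v x) has_real_derivative t * (\<Sum>k\<in>UNIV. convolve (HKap k k t) v x)) (at t)"
proof -
  have "((\<lambda>t. convolve (Rho t) v x) has_real_derivative convolve (\<lambda>z. t * (\<Sum>k\<in>UNIV. HKap k k t z)) v x) (at t)"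
    by (rule convolve_scale_aux[OF assms]) 
       (auto intro!: continuous_intros Rho_has_derivative_scale)
  then show ?thesis by (simp add: convolve_sum cs_integrable_kernel assms)
qed

lemma convolve_DRho_scale:
  fixes v :: "real^'n::finite \<Rightarrow> real"
  assumes "cs_integrable v" "t > 0"
  shows "((\<lambda>t. convolve (DRho i t) v x) has_real_derivative t * (\<Sum>k\<in>UNIV. convolve (TKap i k k t) v x)) (at t)"
proof -
  have "((\<lambda>t. convolve (DRho i t) v x) has_real_derivative convolve (\<lambda>z. t * (\<Sum>k\<in>UNIV. TKap i k k t z)) v x) (at t)"
    by (rule convolve_scale_aux[OF assms]) 
       (auto intro!: continuous_intros DRho_has_derivative_scale)
  then show ?thesis by (simp add: convolve_sum cs_integrable_kernel assms)
qed

text \<open>Tested with kernels centred at \<open>x\<close>, a weak equation becomes a pointwise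
  identity between convolutions at \<open>x\<close>.\<close>

lemma kernel_test_fun:
  assumes "t > 0" "cball x t \<subseteq> U"
  shows "test_fun U (\<lambda>y. Rho t (x - y))" "test_fun U (\<lambda>y. DKap i t (x - y))" "test_fun U (\<lambda>y. HKap i j t (x - y))"
proof -
  have z: "t \<le> norm (x - y)" if "y \<notin> cball x t" for y using that by (simp add: dist_norm)
  show "test_fun U (\<lambda>y. Rho t (x - y))" "test_fun U (\<lambda>y. DKap i t (x - y))" "test_fun U (\<lambda>y. HKap i j t (x - y))"
    by (rule smooth_elem_test_fun[OF kernel_smooth_elem(2) compact_cball assms(2)] smooth_elem_test_fun[OF kernel_smooth_elem(3) compact_cball assms(2)]
      smooth_elem_test_fun[OF kernel_smooth_elem(4) compact_cball assms(2)]; use z assms(1) in \<open>simp add: kernel_zero\<close>)+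
qed

lemma convolve_cong:
  assumes "\<And>y. y \<in> cball x t \<Longrightarrow> v y = w y" "\<And>z. norm z \<ge> t \<Longrightarrow> k z = 0"
  shows "convolve k v x = convolve k w x"
  unfolding convolve_def
proof (rule Bochner_Integration.integral_cong)
  fix y show "v y * k (x - y) = w y * k (x - y)"
    using assms(1)[of y] assms(2)[of "x - y"] by (cases "y \<in> cball x t") (auto simp: dist_norm)
qed simp

lemma abs_convolve_le:
  assumes "integrable lborel (\<lambda>y. w y * k' (x - y))" "\<And>y. \<bar>v y * k (x - y)\<bar> \<le> w y * k' (x - y)"
  shows "\<bar>convolve k v x\<bar> \<le> convolve k' w x"
proof -
  have "\<bar>convolve k v x\<bar> \<le> (LINT y|lborel. \<bar>v y * k (x - y)\<bar>)"
    unfolding convolve_def by (rule integral_abs_bound)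
  also have "\<dots> \<le> convolve k' w x"
    unfolding convolve_def
    by (rule integral_mono'[OF assms]) (rule order_trans[OF abs_ge_zero assms(2)])
  finally show ?thesis .
qed

lemma convolve_Rho_nonneg:
  assumes "t > 0" "\<And>y. v y \<ge> 0" shows "convolve (Rho t) v x \<ge> 0"
  unfolding convolve_def
  by (intro Bochner_Integration.integral_nonneg mult_nonneg_nonneg assms Rho_nonneg)

text \<open>The integral of a non-integrable function is 0 by convention, so the value 1 already
  proves integrability.\<close>

lemma integrable_Rho: "t > 0 \<Longrightarrow> integrable lborel (\<lambda>y. Rho t (x - y))"
  using not_integrable_integral_eq[of lborel "\<lambda>y. Rho t (x - y)"] integral_Rho[of t x] by fastforce

text \<open>The mollifier has mass one and is supported in the ball of radius t. The constant
  \<open>c\<close> is free: the value of \<open>v\<close> at \<open>x\<close> yields convergence, 0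
  yields a sup bound.\<close>

lemma convolve_Rho_close:
  fixes v :: "real^'n::finite \<Rightarrow> real"
  assumes "cs_integrable v" "t > 0" "\<And>y. y \<in> cball x t \<Longrightarrow> \<bar>v y - c\<bar> \<le> \<omega>"
  shows "\<bar>convolve (Rho t) v x - c\<bar> \<le> \<omega>"
proof -
  have "convolve (Rho t) v x - c = (LINT y|lborel. v y * Rho t (x - y)) - (LINT y|lborel. c * Rho t (x - y))"
    using integral_Rho[OF assms(2), of x] by (simp add: convolve_def)
  also have "\<dots> = (LINT y|lborel. v y * Rho t (x - y) - c * Rho t (x - y))"
    using cs_integrable_kernel(1)[OF assms(1,2), of x] integrable_Rho[OF assms(2), of x]
    by (intro Bochner_Integration.integral_diff[symmetric]) auto
  finally have eq: "convolve (Rho t) v x - c = (LINT y|lborel. (v y - c) * Rho t (x - y))"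
    by (simp add: left_diff_distrib)
  have "\<bar>(v y - c) * Rho t (x - y)\<bar> \<le> \<omega> * Rho t (x - y)" for y
  proof (cases "y \<in> cball x t")
    case True
    then show ?thesis using assms(3)[OF True] Rho_nonneg[OF assms(2), of "x - y"]
      by (simp add: abs_mult mult_right_mono)
  next
    case False
    then have "Rho t (x - y) = 0" by (intro kernel_zero assms) (simp add: dist_norm)
    then show ?thesis by simp
  qed
  then have "\<bar>LINT y|lborel. (v y - c) * Rho t (x - y)\<bar> \<le> (LINT y|lborel. \<omega> * Rho t (x - y))"
    using integrable_Rho[OF assms(2)]
    by (intro integral_abs_bound[THEN order_trans] integral_mono') (auto intro!: order_trans[OF abs_ge_zero])
  also have "\<dots> = \<omega>" using integral_Rho[OF assms(2), of x] by simp
  finally show ?thesis using eq by simp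
qed

lemma convolve_Rho_tendsto:
  fixes v :: "real^'n::finite \<Rightarrow> real"
  assumes v: "cs_integrable v" "isCont v x" and t: "\<And>n. t n > 0" "t \<longlonglongrightarrow> 0"
  shows "(\<lambda>n. convolve (Rho (t n)) v x) \<longlonglongrightarrow> v x"
proof (rule LIMSEQ_I)
  fix e :: real assume "e > 0"
  then obtain d where d: "d > 0" "\<And>y. dist y x < d \<Longrightarrow> dist (v y) (v x) < e / 2"
    using v(2) unfolding continuous_at_eps_delta by (metis half_gt_zero)
  obtain N where N: "\<And>n. n \<ge> N \<Longrightarrow> norm (t n - 0) < d" using LIMSEQ_D[OF t(2) d(1)] by blast
  have "norm (convolve (Rho (t n)) v x - v x) < e" if "n \<ge> N" for n
  proof -
    have "\<bar>convolve (Rho (t n)) v x - v x\<bar> \<le> e / 2"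
    proof (rule convolve_Rho_close[OF v(1) t(1)])
      fix y assume "y \<in> cball x (t n)"
      then have "dist y x < d" using N[OF that] t(1)[of n] by (simp add: dist_commute)
      then show "\<bar>v y - v x\<bar> \<le> e / 2" using d(2)[of y] by (simp add: dist_real_def)
    qed
    then show ?thesis using \<open>e > 0\<close> by simp
  qed
  then show "\<exists>N. \<forall>n\<ge>N. norm (convolve (Rho (t n)) v x - v x) < e" by blast
qed

lemma integral_HKap:
  assumes "t > 0" shows "(LINT y|lborel. HKap i j t (x - y :: real^'n::finite)) = 0"
proof -
  have "(LINT y|lborel. partial i (\<lambda>y. DKap j t (x - y)) y) = 0"
  proof (rule integral_partial_C1c[OF smooth_elem_C1_on[OF kernel_smooth_elem(3)] compact_cball[of x t]])
    show "y \<notin> cball x t \<Longrightarrow> DKap j t (x - y) = 0" for y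
      by (rule kernel_zero[OF assms]) (simp add: dist_norm)
  qed
  then show ?thesis by (simp add: partial_kernel)
qed

lemma integrable_HKap:
  assumes "t > 0" shows "integrable lborel (\<lambda>y. HKap i j t (x - y :: real^'n::finite))"
proof -
  have "integrable lborel (\<lambda>y. indicator (cball x t) y * HKap i j t (x - y))"
  proof (rule cs_integrable_kernel(4)[OF _ assms])
    show "cs_integrable (indicator (cball x t) :: real^'n \<Rightarrow> real)"
      using borel_integrable_compact[OF compact_cball[of x t], of "\<lambda>_. 1::real"]
      by (auto simp: cs_integrable_def intro!: exI[of _ "cball x t"])
  qed
  moreover have "indicator (cball x t) y * HKap i j t (x - y) = HKap i j t (x - y)" for y
    using kernel_zero(5)[OF assms, of "x - y"] by (auto simp: indicator_def dist_norm)
  ultimately show ?thesis by simp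
qed

text \<open>D^2\<kappa>_t has mean zero, so \<open>c\<close> can be subtracted from \<open>v\<close>
  and only the oscillation \<omega> on the ball counts. The kernel has size t^(-2-n) on a ball of
  volume proportional to t^n. The constant is uniform in all data, since the bound is used both with
  \<open>c = 0\<close> and with \<open>c\<close> a point value.\<close>

lemma convolve_HKap_bound:
  "\<exists>C\<ge>0. \<forall>v (x::real^'n::finite) t c \<omega> i j. cs_integrable v \<longrightarrow> t > 0 \<longrightarrow> (\<forall>y\<in>cball x t. \<bar>v y - c\<bar> \<le> \<omega>) \<longrightarrow>
     \<bar>convolve (HKap i j t) v x\<bar> \<le> C * \<omega> / t^2"
proof -
  obtain C where C: "C \<ge> 0" "\<And>t z i j. t > 0 \<Longrightarrow> \<bar>HKap i j t (z::real^'n)\<bar> \<le> C / t^2 / t ^ CARD('n) * indicator (cball 0 t) z"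
    using HKap_bound by blast
  define V where "V = unit_ball_vol (real DIM(real^'n))"
  have V: "V \<ge> 0" by (simp add: V_def)
  have "\<bar>convolve (HKap i j t) v x\<bar> \<le> (C * V) * \<omega> / t^2"
    if v: "cs_integrable v" and t: "t > 0" and cl: "\<And>y. y \<in> cball x t \<Longrightarrow> \<bar>v y - c\<bar> \<le> \<omega>" for v and x :: "real^'n" and t c \<omega> i j
  proof -
    have "convolve (HKap i j t) v x = (LINT y|lborel. v y * HKap i j t (x - y)) - (LINT y|lborel. c * HKap i j t (x - y))"
      using integral_HKap[OF t, of i j x] by (simp add: convolve_def)
    also have "\<dots> = (LINT y|lborel. v y * HKap i j t (x - y) - c * HKap i j t (x - y))"
      using cs_integrable_kernel(4)[OF v t, of i j x] integrable_HKap[OF t, of i j x]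
      by (intro Bochner_Integration.integral_diff[symmetric]) auto
    finally have eq: "convolve (HKap i j t) v x = (LINT y|lborel. (v y - c) * HKap i j t (x - y))"
      by (simp add: left_diff_distrib)
    have b: "\<bar>(v y - c) * HKap i j t (x - y)\<bar> \<le> (\<omega> * (C / t^2 / t ^ CARD('n))) * indicator (cball x t) y" for y
    proof (cases "y \<in> cball x t")
      case True
      have "\<bar>HKap i j t (x - y)\<bar> \<le> C / t^2 / t ^ CARD('n)"
        using C(2)[OF t, of i j "x - y"] C(1) t by (auto simp: indicator_def split: if_splits intro: order_trans)
      then have "\<bar>v y - c\<bar> * \<bar>HKap i j t (x - y)\<bar> \<le> \<omega> * (C / t^2 / t ^ CARD('n))"
        using cl[OF True] by (intro mult_mono) auto
      then show ?thesis using True by (simp add: abs_mult)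
    next
      case False
      then have "HKap i j t (x - y) = 0" by (intro kernel_zero t) (simp add: dist_norm)
      then show ?thesis using False by simp
    qed
    have ii: "integrable lborel (indicator (cball x t) :: real^'n \<Rightarrow> real)"
      using borel_integrable_compact[OF compact_cball[of x t], of "\<lambda>_. 1::real"] by simp
    have "\<bar>LINT y|lborel. (v y - c) * HKap i j t (x - y)\<bar> \<le> (LINT y|lborel. (\<omega> * (C / t^2 / t ^ CARD('n))) * indicator (cball x t) y)"
    proof (intro integral_abs_bound[THEN order_trans] integral_mono')
      show "integrable lborel (\<lambda>y. (\<omega> * (C / t^2 / t ^ CARD('n))) * indicator (cball x t) y)"
        using ii by (rule integrable_mult_right)
    qed (rule b, rule order_trans[OF abs_ge_zero b])
    also have "\<dots> = (\<omega> * (C / t^2 / t ^ CARD('n))) * measure lborel (cball x t)" by simp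
    also have "measure lborel (cball x t) = V * t ^ CARD('n)"
      using t by (simp add: content_cball V_def)
    also have "(\<omega> * (C / t^2 / t ^ CARD('n))) * (V * t ^ CARD('n)) = (C * V) * \<omega> / t^2"
      using t by simp
    finally show ?thesis using eq by simp
  qed
  note H = this
  have "C * V \<ge> 0" using C V by simp
  then show ?thesis using H by (intro exI[of _ "C * V"] conjI allI impI) blast+
qed

lemma Rho_even: "Rho t (- z) = Rho t z"
  by (simp add: Rho_def ker_def)

text \<open>Mollification is self-adjoint by Fubini because \<rho>_t is even. It allows the
  mollifier to be moved from an integrable function to a continuous one.\<close>

lemma convolve_Rho_swap:
  fixes v w :: "real^'n::finite \<Rightarrow> real"
  assumes v: "cs_integrable v" and w: "cs_integrable w" and t: "t > 0"
  shows "(LINT y|lborel. v y * convolve (Rho t) w y) = (LINT x|lborel. w x * convolve (Rho t) v x)"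
proof -
  have [measurable]: "v \<in> borel_measurable borel" "w \<in> borel_measurable borel" using v w by measurable
  obtain C where C: "C \<ge> 0" "\<And>z. \<bar>ker 1 t (z::real^'n)\<bar> \<le> C"
  proof -
    obtain C where "C \<ge> 0" "\<And>z. \<bar>ker 1 t (z::real^'n)\<bar> \<le> C / t ^ CARD('n)" using ker_bound t by blast
    then show ?thesis using that[of "C / t ^ CARD('n)"] t by simp
  qed
  have iv: "integrable lborel v" "integrable lborel w" using v w by (auto simp: cs_integrable_def)
  \<comment> \<open>An integrable product majorant, obtained from the sup bound of \<rho>_t at the
    fixed scale, that makes Fubini applicable.\<close>
  define P where "P = (\<lambda>(y, x). \<bar>v y\<bar> * \<bar>w x\<bar> * (2 * C))"
  have "integrable (lborel \<Otimes>\<^sub>M lborel) P"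
  proof (rule lborel_pair.Fubini_integrable)
    show "P \<in> borel_measurable (lborel \<Otimes>\<^sub>M lborel)" unfolding P_def by measurable
    show "integrable lborel (\<lambda>y. LINT x|lborel. norm (P (y, x)))"
      using iv C(1) by (simp add: P_def abs_mult)
    show "AE y in lborel. integrable lborel (\<lambda>x. P (y, x))"
      using iv by (simp add: P_def)
  qed
  then have "integrable (lborel \<Otimes>\<^sub>M lborel) (\<lambda>(y, x). v y * (w x * Rho t (y - x)))"
  proof (rule Bochner_Integration.integrable_bound)
    show "(\<lambda>(y, x). v y * (w x * Rho t (y - x))) \<in> borel_measurable (lborel \<Otimes>\<^sub>M lborel)" by measurable
    have "\<bar>v y * (w x * Rho t (y - x))\<bar> \<le> \<bar>v y\<bar> * \<bar>w x\<bar> * (2 * C)" for x y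
    proof -
      have "\<bar>Rho t (y - x)\<bar> \<le> 2 * C" using C(2)[of "y - x"] by (simp add: Rho_def abs_mult)
      then have "\<bar>v y\<bar> * \<bar>w x\<bar> * \<bar>Rho t (y - x)\<bar> \<le> \<bar>v y\<bar> * \<bar>w x\<bar> * (2 * C)" by (intro mult_left_mono) auto
      then show ?thesis by (simp add: abs_mult mult.assoc)
    qed
    then show "AE z in lborel \<Otimes>\<^sub>M lborel. norm (case z of (y, x) \<Rightarrow> v y * (w x * Rho t (y - x))) \<le> norm (P z)"
      using C(1) by (intro AE_I2) (auto simp: P_def abs_mult)
  qed
  from lborel_pair.Fubini_integral[OF this]
  have F: "(LINT x|lborel. LINT y|lborel. v y * (w x * Rho t (y - x))) = (LINT y|lborel. LINT x|lborel. v y * (w x * Rho t (y - x)))" .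
  have a: "(LINT x|lborel. v y * (w x * Rho t (y - x))) = v y * convolve (Rho t) w y" for y
    unfolding convolve_def by (rule integral_mult_right_zero)
  have b: "(LINT y|lborel. v y * (w x * Rho t (y - x))) = w x * convolve (Rho t) v x" for x
  proof -
    have "(LINT y|lborel. v y * (w x * Rho t (y - x))) = (LINT y|lborel. w x * (v y * Rho t (x - y)))"
      using Rho_even[of t "x - _"] by (intro Bochner_Integration.integral_cong) (auto simp: mult_ac)
    then show ?thesis unfolding convolve_def by simp
  qed
  show ?thesis using F unfolding a b by (rule sym)
qed

text \<open>\<open>v\<close> is merely integrable, so its mollifications are tested with \<xi>.
  Moving the mollifier onto \<xi> gives the limit \<integral>v \<xi>, while uniform convergence
  gives \<integral>M \<xi>; the fundamental lemma concludes.\<close>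

lemma AE_eq_mollification_limit:
  fixes v M :: "real^'n::finite \<Rightarrow> real"
  assumes U: "open U" and v: "cs_integrable v" and M: "continuous_on U M"
    and t: "\<And>n. t n > 0" "t \<longlonglongrightarrow> 0" and e: "e \<longlonglongrightarrow> 0"
    and unif: "\<And>n x. x \<in> U \<Longrightarrow> \<bar>convolve (Rho (t n)) v x - M x\<bar> \<le> e n"
  shows "AE x in lborel. x \<in> U \<longrightarrow> v x = M x"
proof -
  have "AE x in lborel. x \<in> U \<longrightarrow> v x - M x = 0"
  proof (rule fundamental_lemma[OF U])
    fix K assume K: "compact K" "K \<subseteq> U"
    have "set_integrable lborel K v"
      unfolding set_integrable_def using v K
      by (auto simp: cs_integrable_def borel_compact intro!: integrable_indicator_times)
    moreover have "set_integrable lborel K M"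
      using borel_integrable_compact[OF K(1) continuous_on_subset[OF M K(2)]] by (simp add: set_integrable_def)
    ultimately show "set_integrable lborel K (\<lambda>x. v x - M x)" by (rule set_integral_diff)
  next
    fix \<xi> assume \<xi>: "test_fun U \<xi>"
    obtain K where K: "compact K" "K \<subseteq> U" "\<And>x. x \<notin> K \<Longrightarrow> \<xi> x = 0" by (rule test_fun_support[OF \<xi>], rule that)
    have c\<xi>: "continuous_on S \<xi>" for S using C1_on_continuous_on[OF test_fun_C1_on[OF \<xi>]] .
    have ci: "cs_integrable \<xi>" by (rule cs_integrableI_continuous[OF c\<xi> K(1,3)])
    have iv: "integrable lborel v" and i\<xi>: "integrable lborel \<xi>" using v ci by (auto simp: cs_integrable_def)
    have [measurable]: "v \<in> borel_measurable borel" "\<xi> \<in> borel_measurable borel" using v ci by measurable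
    obtain D where D: "\<And>x. \<bar>\<xi> x\<bar> \<le> D"
    proof -
      obtain D where "\<And>x. x \<in> K \<Longrightarrow> \<bar>\<xi> x\<bar> \<le> D"
        using compact_imp_bounded[OF compact_continuous_image[OF c\<xi> K(1)]] by (metis bounded_real imageI)
      then have "\<bar>\<xi> x\<bar> \<le> max 0 D" for x using K(3)[of x] by (cases "x \<in> K") (auto simp: max.coboundedI2)
      then show ?thesis using that by blast
    qed
    have cvm: "convolve (Rho s) \<xi> \<in> borel_measurable borel" "convolve (Rho s) v \<in> borel_measurable borel" if "s > 0" for s
      using convolve_Rho_has_derivative[OF ci that] convolve_Rho_has_derivative[OF v that]
      by (auto intro!: borel_measurable_continuous_onI continuous_at_imp_continuous_on has_derivative_continuous)
    have "(\<lambda>n. LINT y|lborel. v y * convolve (Rho (t n)) \<xi> y) \<longlonglongrightarrow> (LINT y|lborel. v y * \<xi> y)"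
    proof (rule integral_dominated_convergence)
      show "integrable lborel (\<lambda>y. D * \<bar>v y\<bar>)" using iv by simp
      show "AE y in lborel. norm (v y * convolve (Rho (t n)) \<xi> y) \<le> D * \<bar>v y\<bar>" for n
      proof (rule AE_I2)
        fix y
        have "\<bar>convolve (Rho (t n)) \<xi> y - 0\<bar> \<le> D" by (rule convolve_Rho_close[OF ci t(1)]) (simp add: D)
        then have "\<bar>v y\<bar> * \<bar>convolve (Rho (t n)) \<xi> y\<bar> \<le> \<bar>v y\<bar> * D" by (intro mult_left_mono) auto
        then show "norm (v y * convolve (Rho (t n)) \<xi> y) \<le> D * \<bar>v y\<bar>" by (simp add: abs_mult mult.commute)
      qed
      show "AE y in lborel. (\<lambda>n. v y * convolve (Rho (t n)) \<xi> y) \<longlonglongrightarrow> v y * \<xi> y"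
        using c\<xi>[of UNIV] by (intro AE_I2 tendsto_intros convolve_Rho_tendsto ci t) (auto simp: continuous_on_eq_continuous_at)
      show "(\<lambda>y. v y * convolve (Rho (t n)) \<xi> y) \<in> borel_measurable lborel" for n
        using cvm(1)[OF t(1)[of n]] by simp
    qed simp
    then have 1: "(\<lambda>n. LINT x|lborel. \<xi> x * convolve (Rho (t n)) v x) \<longlonglongrightarrow> (LINT y|lborel. v y * \<xi> y)"
      by (simp add: convolve_Rho_swap[OF v ci t(1)])
    \<comment> \<open>\<open>M\<close> is controlled only on \<open>U\<close>; cutting it off to the
      support of \<xi> makes it integrable on the whole space.\<close>
    define M' where "M' x = indicator K x * M x" for x
    have cM: "cs_integrable M'" unfolding M'_def
      by (rule cs_integrableI_indicator[OF K(1)])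
         (use borel_integrable_compact[OF K(1) continuous_on_subset[OF M K(2)]] in \<open>simp add: set_integrable_def\<close>)
    have iM: "integrable lborel (\<lambda>x. M' x * \<xi> x)" by (rule cs_integrable_integrable[OF cM _ c\<xi>]) simp
    have "(\<lambda>n. (LINT x|lborel. \<xi> x * convolve (Rho (t n)) v x) - (LINT x|lborel. M' x * \<xi> x)) \<longlonglongrightarrow> 0"
    proof (rule Lim_null_comparison)
      show "(\<lambda>n. e n * (LINT x|lborel. \<bar>\<xi> x\<bar>)) \<longlonglongrightarrow> 0" using e by (rule tendsto_mult_left_zero)
      have "norm ((LINT x|lborel. \<xi> x * convolve (Rho (t n)) v x) - (LINT x|lborel. M' x * \<xi> x)) \<le> e n * (LINT x|lborel. \<bar>\<xi> x\<bar>)" for n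
      proof -
        have co: "continuous_on UNIV (convolve (Rho (t n)) v)"
          using convolve_Rho_has_derivative[OF v t(1)[of n]]
          by (auto intro!: continuous_at_imp_continuous_on has_derivative_continuous)
        have ix: "integrable lborel (\<lambda>x. \<xi> x * convolve (Rho (t n)) v x)"
          by (rule cs_integrable_integrable[OF ci cvm(2)[OF t(1)] co])
        have "(LINT x|lborel. \<xi> x * convolve (Rho (t n)) v x) - (LINT x|lborel. M' x * \<xi> x)
          = (LINT x|lborel. \<xi> x * convolve (Rho (t n)) v x - M' x * \<xi> x)"
          by (rule Bochner_Integration.integral_diff[symmetric]) (rule ix iM)+
        also have "norm \<dots> \<le> (LINT x|lborel. e n * \<bar>\<xi> x\<bar>)"
        proof (rule Bochner_Integration.integral_norm_bound_integral)
          show "norm (\<xi> x * convolve (Rho (t n)) v x - M' x * \<xi> x) \<le> e n * \<bar>\<xi> x\<bar>" for x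
          proof (cases "x \<in> K")
            case True
            then have "\<bar>convolve (Rho (t n)) v x - M x\<bar> \<le> e n" using unif K(2) by blast
            then have "\<bar>convolve (Rho (t n)) v x - M x\<bar> * \<bar>\<xi> x\<bar> \<le> e n * \<bar>\<xi> x\<bar>" by (rule mult_right_mono) simp
            then show ?thesis using True by (simp add: M'_def abs_mult[symmetric] algebra_simps)
          qed (simp add: K(3) M'_def)
        qed (use ix iM i\<xi> in auto)
        finally show ?thesis by simp
      qed
      then show "\<forall>\<^sub>F n in sequentially. norm ((LINT x|lborel. \<xi> x * convolve (Rho (t n)) v x) - (LINT x|lborel. M' x * \<xi> x)) \<le> e n * (LINT x|lborel. \<bar>\<xi> x\<bar>)"
        by simp
    qed
    then have "(\<lambda>n. LINT x|lborel. \<xi> x * convolve (Rho (t n)) v x) \<longlonglongrightarrow> (LINT x|lborel. M' x * \<xi> x)"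
      by (simp add: LIM_zero_iff)
    with 1 have eq: "(LINT y|lborel. v y * \<xi> y) = (LINT x|lborel. M' x * \<xi> x)" by (rule LIMSEQ_unique)
    have iv': "integrable lborel (\<lambda>x. v x * \<xi> x)" by (rule cs_integrable_integrable[OF v _ c\<xi>]) simp
    have "(LINT x:U|lborel. (v x - M x) * \<xi> x) = (LINT x|lborel. v x * \<xi> x - M' x * \<xi> x)"
      unfolding set_lebesgue_integral_def
    proof (rule Bochner_Integration.integral_cong)
      fix x show "indicator U x *\<^sub>R ((v x - M x) * \<xi> x) = v x * \<xi> x - M' x * \<xi> x"
        using K by (cases "x \<in> K") (auto simp: M'_def indicator_def algebra_simps)
    qed simp
    also have "\<dots> = 0" using eq iv' iM by simp
    finally show "(LINT x:U|lborel. (v x - M x) * \<xi> x) = 0" .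
  qed
  then show ?thesis by simp
qed

subsection \<open>Differential inequalities and limits of differentiable functions\<close>

text \<open>The function exp(C s) f(s) is nondecreasing, since f' \<ge> -C f. The estimate runs
  towards small arguments because a mollification is trivially bounded at a large scale and unknown
  at small ones.\<close>

lemma gronwall_backward:
  fixes f f' :: "real \<Rightarrow> real"
  assumes "t \<le> R" "\<And>s. t \<le> s \<Longrightarrow> s \<le> R \<Longrightarrow> (f has_real_derivative f' s) (at s)"
    and "\<And>s. t \<le> s \<Longrightarrow> s \<le> R \<Longrightarrow> \<bar>f' s\<bar> \<le> C * f s"
  shows "f t \<le> exp (C * (R - t)) * f R"
proof -
  have "exp (C * t) * f t \<le> exp (C * R) * f R"
  proof (rule DERIV_nonneg_imp_nondecreasing[OF assms(1)])
    fix s assume s: "t \<le> s" "s \<le> R"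
    have "((\<lambda>s. exp (C * s) * f s) has_real_derivative exp (C * s) * (C * f s + f' s)) (at s)"
      by (auto intro!: derivative_eq_intros assms(2) s simp: algebra_simps)
    moreover have "exp (C * s) * (C * f s + f' s) \<ge> 0" using assms(3)[OF s] by simp
    ultimately show "\<exists>y. ((\<lambda>s. exp (C * s) * f s) has_real_derivative y) (at s) \<and> 0 \<le> y" by blast
  qed
  then have "exp (- (C * t)) * (exp (C * t) * f t) \<le> exp (- (C * t)) * (exp (C * R) * f R)"
    by (rule mult_left_mono) simp
  moreover have "exp (- (C * t)) * (exp (C * t) * f t) = f t" by (simp add: exp_minus)
  moreover have "exp (C * (R - t)) = exp (- (C * t)) * exp (C * R)"
    by (simp add: exp_add[symmetric] algebra_simps)
  ultimately show ?thesis by simp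
qed

lemma difference_le_of_derivative_bound:
  fixes f f' G G' :: "real \<Rightarrow> real"
  assumes "s \<le> t"
    and "\<And>r. s \<le> r \<Longrightarrow> r \<le> t \<Longrightarrow> (f has_real_derivative f' r) (at r)"
    and "\<And>r. s \<le> r \<Longrightarrow> r \<le> t \<Longrightarrow> (G has_real_derivative G' r) (at r)"
    and "\<And>r. s \<le> r \<Longrightarrow> r \<le> t \<Longrightarrow> \<bar>f' r\<bar> \<le> G' r"
  shows "\<bar>f t - f s\<bar> \<le> G t - G s"
proof -
  have "G s - f s \<le> G t - f t"
    by (rule DERIV_nonneg_imp_nondecreasing[OF assms(1)])
       (use assms in \<open>force intro!: derivative_eq_intros simp: abs_le_iff\<close>)
  moreover have "G s + f s \<le> G t + f t"
    by (rule DERIV_nonneg_imp_nondecreasing[OF assms(1)])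
       (use assms in \<open>force intro!: derivative_eq_intros simp: abs_le_iff\<close>)
  ultimately show ?thesis by linarith
qed

text \<open>\<open>G\<close> is a primitive of a majorant of |f'| and vanishes at 0, so increments
  of \<open>f\<close> are bounded by increments of \<open>G\<close>. The derivative may blow up at
  0, as t^(-1/2) does, and the rate of convergence comes for free.\<close>

lemma limit_at_zero_of_derivative_bound:
  fixes f f' G G' :: "real \<Rightarrow> real"
  assumes "R > 0"
    and f: "\<And>s. 0 < s \<Longrightarrow> s \<le> R \<Longrightarrow> (f has_real_derivative f' s) (at s)"
    and G: "\<And>s. 0 < s \<Longrightarrow> s \<le> R \<Longrightarrow> (G has_real_derivative G' s) (at s)"
    and b: "\<And>s. 0 < s \<Longrightarrow> s \<le> R \<Longrightarrow> \<bar>f' s\<bar> \<le> G' s"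
    and lim: "(G \<longlongrightarrow> 0) (at_right 0)"
  shows "\<exists>l. \<forall>t. 0 < t \<longrightarrow> t \<le> R \<longrightarrow> \<bar>f t - l\<bar> \<le> G t"
proof -
  define \<tau> where "\<tau> n = R / real (Suc n)" for n
  have \<tau>: "0 < \<tau> n" "\<tau> n \<le> R" for n using \<open>R > 0\<close> by (auto simp: \<tau>_def divide_simps)
  have "\<tau> \<longlonglongrightarrow> 0"
    using tendsto_mult[OF tendsto_const[of R] LIMSEQ_inverse_real_of_nat] by (simp add: \<tau>_def[abs_def] divide_inverse)
  then have \<tau>0: "filterlim \<tau> (at_right 0) sequentially"
    using \<tau> by (auto simp: filterlim_at intro!: always_eventually less_imp_neq[symmetric])
  have G\<tau>: "(\<lambda>n. G (\<tau> n)) \<longlonglongrightarrow> 0" using filterlim_compose[OF lim \<tau>0] .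
  have diff: "\<bar>f t - f s\<bar> \<le> G t - G s" if "0 < s" "s \<le> t" "t \<le> R" for s t
    by (rule difference_le_of_derivative_bound[where f = f and f' = f' and G' = G', OF that(2)])
       (use f G b that in auto)
  have d2: "\<bar>f (\<tau> m) - f (\<tau> n)\<bar> \<le> \<bar>G (\<tau> m) - G (\<tau> n)\<bar>" for m n
    using diff[of "\<tau> m" "\<tau> n"] diff[of "\<tau> n" "\<tau> m"] \<tau>[of m] \<tau>[of n]
    by (cases "\<tau> m \<le> \<tau> n") auto
  have "Cauchy (\<lambda>n. f (\<tau> n))"
  proof (rule metric_CauchyI)
    fix e :: real assume "e > 0"
    from metric_CauchyD[OF LIMSEQ_imp_Cauchy[OF G\<tau>] this]
    obtain M where "\<forall>m\<ge>M. \<forall>n\<ge>M. dist (G (\<tau> m)) (G (\<tau> n)) < e" by blast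
    then have "\<forall>m\<ge>M. \<forall>n\<ge>M. dist (f (\<tau> m)) (f (\<tau> n)) < e"
      using d2 unfolding dist_real_def by (meson le_less_trans)
    then show "\<exists>M. \<forall>m\<ge>M. \<forall>n\<ge>M. dist (f (\<tau> m)) (f (\<tau> n)) < e" by blast
  qed
  then obtain l where l: "(\<lambda>n. f (\<tau> n)) \<longlonglongrightarrow> l" by (auto simp: convergent_eq_Cauchy[symmetric])
  have "\<bar>f t - l\<bar> \<le> G t" if t: "0 < t" "t \<le> R" for t
  proof (rule tendsto_le[OF sequentially_bot])
    show "(\<lambda>n. \<bar>f t - f (\<tau> n)\<bar>) \<longlonglongrightarrow> \<bar>f t - l\<bar>" by (intro tendsto_intros l)
    show "(\<lambda>n. G t - G (\<tau> n)) \<longlonglongrightarrow> G t" using tendsto_diff[OF tendsto_const G\<tau>] by simp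
    have "\<forall>\<^sub>F n in sequentially. \<tau> n < t"
      using order_tendstoD(2)[OF \<open>\<tau> \<longlonglongrightarrow> 0\<close> t(1)] .
    then show "\<forall>\<^sub>F n in sequentially. \<bar>f t - f (\<tau> n)\<bar> \<le> G t - G (\<tau> n)"
      by eventually_elim (use diff \<tau> t in auto)
  qed
  then show ?thesis by blast
qed

text \<open>Gradients that converge uniformly, component by component, pass to the limit. The limit
  function produced by \<open>has_derivative_sequence\<close> is only some pointwise limit;
  uniqueness of limits identifies it with \<open>F\<close>.\<close>

lemma has_derivative_limit:
  fixes f :: "nat \<Rightarrow> real^'n::finite \<Rightarrow> real" and g :: "nat \<Rightarrow> real^'n \<Rightarrow> real^'n"
  assumes der: "\<And>n x. x \<in> ball x0 R \<Longrightarrow> (f n has_derivative (\<lambda>h. g n x \<bullet> h)) (at x)"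
    and unif: "\<And>i \<epsilon>. \<epsilon> > 0 \<Longrightarrow> \<forall>\<^sub>F n in sequentially. \<forall>x\<in>ball x0 R. \<bar>g n x $ i - G x $ i\<bar> \<le> \<epsilon>"
    and lim: "\<And>x. x \<in> ball x0 R \<Longrightarrow> (\<lambda>n. f n x) \<longlonglongrightarrow> F x"
    and x: "x \<in> ball x0 R"
  shows "(F has_derivative (\<lambda>h. G x \<bullet> h)) (at x)"
proof -
  have "\<exists>F'. \<forall>x\<in>ball x0 R. (\<lambda>n. f n x) \<longlonglongrightarrow> F' x \<and> (F' has_derivative (\<lambda>h. G x \<bullet> h)) (at x within ball x0 R)"
  proof (rule has_derivative_sequence[where f' = "\<lambda>n x h. g n x \<bullet> h" and l = "F x" and ?x0.0 = x])
    show "(f n has_derivative (\<lambda>h. g n x \<bullet> h)) (at x within ball x0 R)" if "x \<in> ball x0 R" for n x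
      using der[OF that] by (rule has_derivative_at_withinI)
    fix e :: real assume "e > 0"
    define \<epsilon> where "\<epsilon> = e / CARD('n)"
    have "\<epsilon> > 0" using \<open>e > 0\<close> by (simp add: \<epsilon>_def)
    then have "\<forall>\<^sub>F n in sequentially. \<forall>i. \<forall>x\<in>ball x0 R. \<bar>g n x $ i - G x $ i\<bar> \<le> \<epsilon>"
      using unif by (intro eventually_all_finite) auto
    then show "\<forall>\<^sub>F n in sequentially. \<forall>x\<in>ball x0 R. \<forall>h::real^'n. norm (g n x \<bullet> h - G x \<bullet> h) \<le> e * norm h"
    proof eventually_elim
      case (elim n)
      show ?case
      proof (intro ballI allI)
        fix x h :: "real^'n" assume "x \<in> ball x0 R"
        have "norm (g n x - G x) \<le> (\<Sum>i\<in>UNIV. \<bar>(g n x - G x) $ i\<bar>)" by (rule norm_le_l1_cart)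
        also have "\<dots> \<le> (\<Sum>i\<in>(UNIV::'n set). \<epsilon>)"
          by (rule sum_mono) (use elim \<open>x \<in> ball x0 R\<close> in auto)
        also have "\<dots> = e" by (simp add: \<epsilon>_def)
        finally have "norm (g n x - G x) * norm h \<le> e * norm h" by (rule mult_right_mono) simp
        then show "norm (g n x \<bullet> h - G x \<bullet> h) \<le> e * norm h"
          using Cauchy_Schwarz_ineq2[of "g n x - G x" h] by (simp add: inner_diff_left)
      qed
    qed
  qed (use lim x in auto)
  then obtain F' where F': "\<And>x. x\<in>ball x0 R \<Longrightarrow> (\<lambda>n. f n x) \<longlonglongrightarrow> F' x"
    "\<And>x. x\<in>ball x0 R \<Longrightarrow> (F' has_derivative (\<lambda>h. G x \<bullet> h)) (at x within ball x0 R)" by blast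
  have "(F' has_derivative (\<lambda>h. G x \<bullet> h)) (at x)"
    using F'(2)[OF x] at_within_open[OF x open_ball] by simp
  then show ?thesis
    by (rule has_derivative_transform_within_open[OF _ open_ball x])
       (use F'(1) lim LIMSEQ_unique in blast)
qed

subsection \<open>Regularity of weak solutions of a linear first order system\<close>

lemma convolve_diff_cmult:
  assumes "cs_integrable u" "cs_integrable v" "t > 0"
  shows "convolve (Rho t) (\<lambda>y. u y - c * v y) x = convolve (Rho t) u x - c * convolve (Rho t) v x"
proof -
  have "convolve (Rho t) (\<lambda>y. u y - c * v y) x = (LINT y|lborel. u y * Rho t (x - y) - c * (v y * Rho t (x - y)))"
    unfolding convolve_def by (simp add: algebra_simps)
  also have "\<dots> = convolve (Rho t) u x - c * convolve (Rho t) v x"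
    unfolding convolve_def using cs_integrable_kernel(1)[OF assms(1,3), of x] cs_integrable_kernel(1)[OF assms(2,3), of x]
    by simp
  finally show ?thesis .
qed

text \<open>Nonnegativity of \<open>m\<close> is what closes the estimate: since |D\<kappa>_t| \<le>
  \<rho>_t/t, the convolution of m b with D\<kappa>_t is absorbed into \<rho>_t * m itself, and
  Gronwall applies in the scale. The radius 2R makes all kernels of scale at most R centred in the
  ball of radius R admissible. The limit is asserted along the scales 1/(n+1), independent of
  \<open>x0\<close> and \<open>R\<close>, so that local limits agree.\<close>

lemma first_order_regularity_local:
  fixes m :: "real^'n::finite \<Rightarrow> real" and b :: "real^'n \<Rightarrow> real^'n"
  assumes R: "R > 0" and m: "cs_integrable m" "\<And>y. m y \<ge> 0" "\<And>y. y \<notin> cball x0 (2 * R) \<Longrightarrow> m y = 0"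
    and b: "continuous_on (cball x0 (2 * R)) b"
    and weak: "\<And>\<xi> i. test_fun (ball x0 (2 * R)) \<xi> \<Longrightarrow>
      (LINT y|lborel. m y * partial i \<xi> y) = (LINT y|lborel. m y * b y $ i * \<xi> y)"
  shows "\<exists>M. (\<forall>x\<in>ball x0 R. (\<lambda>n. convolve (Rho (1 / real (Suc n))) m x) \<longlonglongrightarrow> M x \<and> M x \<ge> 0 \<and>
      (M has_derivative (\<lambda>h. (- M x *\<^sub>R b x) \<bullet> h)) (at x)) \<and>
      (AE x in lborel. x \<in> ball x0 R \<longrightarrow> m x = M x)"
proof -
  define mb where "mb i y = m y * b y $ i" for i y
  have cmb: "cs_integrable (mb i)" for i
    unfolding mb_def using m(3) b
    by (intro cs_integrable_mult_continuous[OF m(1) closed_cball]) (auto intro!: continuous_intros)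
  obtain B where B: "\<And>y. y \<in> cball x0 (2 * R) \<Longrightarrow> norm (b y) \<le> B"
    using compact_imp_bounded[OF compact_continuous_image[OF b compact_cball]] by (metis bounded_iff imageI)
  have B0: "B \<ge> 0" using B[of x0] R norm_ge_zero order_trans by (metis centre_in_cball less_eq_real_def mult_pos_pos zero_less_numeral)
  have Bi: "\<bar>b y $ i\<bar> \<le> B" if "y \<in> cball x0 (2 * R)" for y i
    using B[OF that] component_le_norm_cart order_trans by blast
  have sub: "cball x t \<subseteq> ball x0 (2 * R)" if "x \<in> ball x0 R" "t \<le> R" for x t
  proof
    fix y assume "y \<in> cball x t"
    then show "y \<in> ball x0 (2 * R)" using that dist_triangle[of x0 y x] by simp
  qed
  define w where "w t x = convolve (Rho t) m x" for t x
  have w0: "w t x \<ge> 0" if "t > 0" for t x unfolding w_def using convolve_Rho_nonneg[OF that m(2)] .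
  \<comment> \<open>The weak equation tested with the mollifier: D(\<rho>_t * m) = -\<rho>_t * (m
    b).\<close>
  have w1: "convolve (DRho i t) m x = - convolve (Rho t) (mb i) x" if "x \<in> ball x0 R" "0 < t" "t \<le> R" for i x t
    using weak[OF kernel_test_fun(1)[OF that(2) sub[OF that(1,3)]], of i]
    by (simp add: partial_kernel convolve_def mb_def)
  \<comment> \<open>Tested with D_k \<kappa>_t, each term of \<Delta>\<kappa>_t * m loses one
    derivative of the kernel.\<close>
  have w2: "convolve (HKap k k t) m x = - convolve (DKap k t) (mb k) x" if "x \<in> ball x0 R" "0 < t" "t \<le> R" for k x t
    using weak[OF kernel_test_fun(2)[OF that(2) sub[OF that(1,3)]], of k k]
    by (simp add: partial_kernel convolve_def mb_def)
  have w3: "\<bar>convolve (DKap k t) (mb k) x\<bar> \<le> B / t * w t x" if "0 < t" for k x t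
  proof -
    have "\<bar>convolve (DKap k t) (mb k) x\<bar> \<le> convolve (Rho t) (\<lambda>y. B / t * m y) x"
    proof (rule abs_convolve_le)
      show "integrable lborel (\<lambda>y. B / t * m y * Rho t (x - y))"
        using integrable_mult_right[OF cs_integrable_kernel(1)[OF m(1) that, of x], of "B / t"] by (simp add: mult.assoc)
      show "\<bar>mb k y * DKap k t (x - y)\<bar> \<le> B / t * m y * Rho t (x - y)" for y
      proof (cases "y \<in> cball x0 (2 * R)")
        case True
        have "\<bar>b y $ k\<bar> * \<bar>DKap k t (x - y)\<bar> \<le> B * (Rho t (x - y) / t)"
          by (rule mult_mono[OF Bi[OF True] DKap_le_Rho[OF that] B0]) simp
        then have "m y * (\<bar>b y $ k\<bar> * \<bar>DKap k t (x - y)\<bar>) \<le> m y * (B * (Rho t (x - y) / t))"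
          by (rule mult_left_mono[OF _ m(2)])
        then show ?thesis using m(2)[of y] by (simp add: mb_def abs_mult mult_ac)
      qed (simp add: mb_def m(3))
    qed
    also have "\<dots> = B / t * w t x"
      unfolding w_def convolve_def by (simp only: mult.assoc integral_mult_right_zero)
    finally show ?thesis .
  qed
  \<comment> \<open>The trace has n terms, each at most (B/t) w, and the prefactor t of the scale
    derivative cancels 1/t.\<close>
  define C where "C = CARD('n) * B"
  have C0: "C \<ge> 0" using B0 by (simp add: C_def)
  define w' where "w' t x = t * (\<Sum>k\<in>UNIV. convolve (HKap k k t) m x)" for t x
  have dw: "((\<lambda>t. w t x) has_real_derivative w' t x) (at t)" if "t > 0" for t x
    unfolding w_def w'_def by (rule convolve_Rho_scale[OF m(1) that])
  have w'b: "\<bar>w' t x\<bar> \<le> C * w t x" if "x \<in> ball x0 R" "0 < t" "t \<le> R" for t x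
  proof -
    have "\<bar>\<Sum>k\<in>UNIV. convolve (HKap k k t) m x\<bar> \<le> (\<Sum>k\<in>(UNIV::'n set). B / t * w t x)"
      by (rule order_trans[OF sum_abs], rule sum_mono) (use w2[OF that] w3[OF that(2)] in simp)
    also have "\<dots> = C / t * w t x" by (simp add: C_def)
    finally have "t * \<bar>\<Sum>k\<in>UNIV. convolve (HKap k k t) m x\<bar> \<le> t * (C / t * w t x)"
      using that(2) by (intro mult_left_mono) auto
    then show ?thesis using that(2) by (simp add: w'_def abs_mult)
  qed
  \<comment> \<open>At the fixed scale R the mollification is bounded by the sup of the kernel times
    the mass of \<open>m\<close>; Gronwall carries this bound down to every smaller scale.\<close>
  obtain W where W: "W \<ge> 0" "\<And>x t. x \<in> ball x0 R \<Longrightarrow> 0 < t \<Longrightarrow> t \<le> R \<Longrightarrow> w t x \<le> W"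
  proof -
    obtain c where c: "c \<ge> 0" "\<And>z. \<bar>ker 1 R (z::real^'n)\<bar> \<le> c / R ^ CARD('n)" using ker_bound R by blast
    define W0 where "W0 = (LINT y|lborel. m y * (2 * (c / R ^ CARD('n))))"
    have wR: "w R x \<le> W0" for x
      unfolding w_def convolve_def W0_def
    proof (rule integral_mono)
      show "integrable lborel (\<lambda>y. m y * Rho R (x - y))" by (rule cs_integrable_kernel(1)[OF m(1) R])
      show "integrable lborel (\<lambda>y. m y * (2 * (c / R ^ CARD('n))))" using m(1) by (simp add: cs_integrable_def)
      show "m y * Rho R (x - y) \<le> m y * (2 * (c / R ^ CARD('n)))" for y
        using c(2)[of "x - y"] by (intro mult_left_mono m(2)) (simp add: Rho_def abs_le_iff)
    qed
    have "w t x \<le> exp (C * R) * W0" if "x \<in> ball x0 R" "0 < t" "t \<le> R" for x t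
    proof -
      have "w t x \<le> exp (C * (R - t)) * w R x"
        by (rule gronwall_backward[OF that(3), of "\<lambda>t. w t x" "\<lambda>t. w' t x"]) (use dw w'b that in auto)
      also have "\<dots> \<le> exp (C * R) * W0"
        using that C0 by (intro mult_mono wR w0[OF R]) (auto intro!: mult_left_mono)
      finally show ?thesis .
    qed
    moreover have "W0 \<ge> 0" using wR[of x0] w0[OF R, of x0] by linarith
    ultimately show ?thesis using that[of "exp (C * R) * W0"] by auto
  qed
  define D where "D = C * W"
  have D0: "D \<ge> 0" using C0 W by (simp add: D_def)
  have "\<exists>l. \<forall>t. 0 < t \<longrightarrow> t \<le> R \<longrightarrow> \<bar>w t x - l\<bar> \<le> D * t" if x: "x \<in> ball x0 R" for x
  proof (rule limit_at_zero_of_derivative_bound[OF R, of "\<lambda>t. w t x" "\<lambda>t. w' t x" "\<lambda>t. D * t" "\<lambda>_. D"])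
    show "\<bar>w' s x\<bar> \<le> D" if "0 < s" "s \<le> R" for s
      using w'b[OF x that] mult_left_mono[OF W(2)[OF x that] C0] by (simp add: D_def)
    show "((\<lambda>t. D * t) \<longlongrightarrow> 0) (at_right 0)"
      by (auto intro!: tendsto_eq_intros)
  qed (auto intro!: dw derivative_eq_intros)
  then obtain M where M: "\<And>x t. x \<in> ball x0 R \<Longrightarrow> 0 < t \<Longrightarrow> t \<le> R \<Longrightarrow> \<bar>w t x - M x\<bar> \<le> D * t"
    by metis
  define \<tau> where "\<tau> n = 1 / real (Suc n)" for n
  have \<tau>: "0 < \<tau> n" for n by (auto simp: \<tau>_def)
  have \<tau>0: "\<tau> \<longlonglongrightarrow> 0"
    using LIMSEQ_inverse_real_of_nat by (simp add: \<tau>_def[abs_def] divide_inverse)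
  have ev\<tau>: "\<forall>\<^sub>F n in sequentially. \<tau> n < a" if "a > 0" for a using order_tendstoD(2)[OF \<tau>0 that] .
  have limM: "(\<lambda>n. w (\<tau> n) x) \<longlonglongrightarrow> M x" if x: "x \<in> ball x0 R" for x
  proof (rule LIM_zero_cancel, rule Lim_null_comparison)
    show "(\<lambda>n. D * \<tau> n) \<longlonglongrightarrow> 0" using \<tau>0 by (rule tendsto_mult_right_zero)
    show "\<forall>\<^sub>F n in sequentially. norm (w (\<tau> n) x - M x) \<le> D * \<tau> n"
      using ev\<tau>[OF R] by eventually_elim (use M x \<tau> in auto)
  qed
  have M0: "M x \<ge> 0" if x: "x \<in> ball x0 R" for x
    by (rule tendsto_lowerbound[OF limM[OF x] _ sequentially_bot]) (use w0 \<tau> in auto)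
  have key: "\<forall>\<^sub>F n in sequentially. \<forall>x\<in>ball x0 R. \<bar>convolve (DRho i (\<tau> n)) m x - (- M x * b x $ i)\<bar> \<le> \<epsilon>"
    if "\<epsilon> > 0" for \<epsilon> i
  proof -
    \<comment> \<open>The error splits into the oscillation of b, at most e1 W, and the distance of
      \<rho>_t * m from its limit, at most B D t; each receives \<epsilon>/2. Adding 1 to
      \<open>W\<close> avoids division by zero.\<close>
    define e1 where "e1 = \<epsilon> / (2 * (W + 1))"
    have e1: "e1 > 0" using that W by (simp add: e1_def)
    have e1W: "e1 * W \<le> \<epsilon> / 2"
      using that W by (simp add: e1_def divide_simps)
    obtain d where d: "d > 0" "\<And>x y. x \<in> cball x0 (2*R) \<Longrightarrow> y \<in> cball x0 (2*R) \<Longrightarrow> dist y x < d \<Longrightarrow> dist (b y) (b x) < e1"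
      using compact_uniformly_continuous[OF b compact_cball] e1
      unfolding uniformly_continuous_on_def by metis
    have "\<forall>\<^sub>F n in sequentially. \<tau> n < R \<and> \<tau> n < d \<and> \<tau> n < \<epsilon> / (2 * (B * D + 1))"
      using that B0 D0 R d(1) by (intro eventually_conj ev\<tau>) (auto intro!: divide_pos_pos add_nonneg_pos mult_nonneg_nonneg)
    then show ?thesis
    proof eventually_elim
      case (elim n)
      show ?case
      proof
        fix x assume x: "x \<in> ball x0 R"
        define t where "t = \<tau> n"
        have t: "t > 0" "t \<le> R" "t < d" using elim \<tau>[of n] by (auto simp: t_def)
        have xc: "x \<in> cball x0 (2 * R)" using x R by auto
        have a: "\<bar>convolve (Rho t) (mb i) x - b x $ i * w t x\<bar> \<le> e1 * W"
        proof -
          have "convolve (Rho t) (mb i) x - b x $ i * w t x = convolve (Rho t) (\<lambda>y. mb i y - b x $ i * m y) x"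
            unfolding w_def by (rule convolve_diff_cmult[OF cmb m(1) t(1), symmetric])
          also have "\<bar>\<dots>\<bar> \<le> convolve (Rho t) (\<lambda>y. e1 * m y) x"
          proof (rule abs_convolve_le)
            show "integrable lborel (\<lambda>y. e1 * m y * Rho t (x - y))"
              using integrable_mult_right[OF cs_integrable_kernel(1)[OF m(1) t(1), of x], of e1] by (simp add: mult.assoc)
            fix y
            show "\<bar>(mb i y - b x $ i * m y) * Rho t (x - y)\<bar> \<le> e1 * m y * Rho t (x - y)"
            proof (cases "y \<in> cball x t")
              case True
              then have "dist (b y) (b x) < e1"
                using sub[OF x t(2)] t(3) xc by (intro d(2)) (auto simp: dist_commute)
              then have "norm ((b y - b x) $ i) \<le> e1"
                by (metis dist_norm component_le_norm_cart less_imp_le order_trans real_norm_def)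
              then have "\<bar>b y $ i - b x $ i\<bar> * (m y * Rho t (x - y)) \<le> e1 * (m y * Rho t (x - y))"
                by (intro mult_right_mono mult_nonneg_nonneg m(2) Rho_nonneg t(1)) simp
              moreover have "(mb i y - b x $ i * m y) * Rho t (x - y) = (b y $ i - b x $ i) * (m y * Rho t (x - y))"
                by (simp add: mb_def algebra_simps)
              moreover have "\<bar>m y * Rho t (x - y)\<bar> = m y * Rho t (x - y)"
                using m(2)[of y] Rho_nonneg[OF t(1), of "x - y"] by simp
              ultimately show ?thesis by (simp only: abs_mult[of "b y $ i - b x $ i"] mult.assoc)
            next
              case False
              then have "Rho t (x - y) = 0" by (intro kernel_zero t(1)) (simp add: dist_norm)
              then show ?thesis by simp
            qed
          qed
          also have "convolve (Rho t) (\<lambda>y. e1 * m y) x = e1 * w t x"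
            unfolding w_def convolve_def by (simp only: mult.assoc integral_mult_right_zero)
          also have "\<dots> \<le> e1 * W" using W(2)[OF x t(1,2)] e1 by simp
          finally show ?thesis .
        qed
        have "\<bar>b x $ i * w t x - b x $ i * M x\<bar> \<le> B * (D * t)"
          unfolding right_diff_distrib[symmetric] abs_mult
          by (rule mult_mono[OF Bi[OF xc] M[OF x t(1,2)] B0]) simp
        also have "B * (D * t) \<le> \<epsilon> / 2"
        proof -
          have "t * (2 * (B * D + 1)) \<le> \<epsilon>"
            using elim B0 D0 by (simp add: t_def pos_less_divide_eq add_nonneg_pos less_imp_le)
          then show ?thesis using t(1) by (simp add: algebra_simps)
        qed
        finally have bb: "\<bar>b x $ i * w t x - b x $ i * M x\<bar> \<le> \<epsilon> / 2" .
        have "convolve (DRho i t) m x = - convolve (Rho t) (mb i) x" by (rule w1[OF x t(1,2)])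
        moreover have "\<bar>- a - - q\<bar> \<le> \<epsilon>" if "\<bar>a - p\<bar> \<le> e1 * W" "\<bar>p - q\<bar> \<le> \<epsilon> / 2" for a p q
          using that e1W by linarith
        from this[OF a bb] have "\<bar>- convolve (Rho t) (mb i) x - - (b x $ i * M x)\<bar> \<le> \<epsilon>" .
        ultimately show "\<bar>convolve (DRho i (\<tau> n)) m x - (- M x * b x $ i)\<bar> \<le> \<epsilon>"
          unfolding t_def by (simp add: mult.commute)
      qed
    qed
  qed
  have dM: "(M has_derivative (\<lambda>h. (- M x *\<^sub>R b x) \<bullet> h)) (at x)" if x: "x \<in> ball x0 R" for x
  proof (rule has_derivative_limit[where f = "\<lambda>n. w (\<tau> n)" and g = "\<lambda>n x. \<chi> i. convolve (DRho i (\<tau> n)) m x" 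
      and G = "\<lambda>x. - M x *\<^sub>R b x", OF _ _ limM x])
    show "(w (\<tau> n) has_derivative (\<bullet>) (\<chi> i. convolve (DRho i (\<tau> n)) m x)) (at x)" for n x
      unfolding w_def[abs_def] by (rule convolve_Rho_has_derivative[OF m(1) \<tau>])
    show "\<forall>\<^sub>F n in sequentially. \<forall>x\<in>ball x0 R. \<bar>(\<chi> i. convolve (DRho i (\<tau> n)) m x) $ i - (- M x *\<^sub>R b x) $ i\<bar> \<le> \<epsilon>"
      if "\<epsilon> > 0" for i \<epsilon> using key[OF that, of i] by simp
  qed
  \<comment> \<open>The rate D t is available only for scales at most R, so the first
    \<open>N\<close> scales are dropped.\<close>
  obtain N where N: "\<And>n. n \<ge> N \<Longrightarrow> \<tau> n < R" using ev\<tau>[OF R] unfolding eventually_sequentially by blast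
  have "AE x in lborel. x \<in> ball x0 R \<longrightarrow> m x = M x"
  proof (rule AE_eq_mollification_limit[where t = "\<lambda>n. \<tau> (n + N)" and e = "\<lambda>n. D * \<tau> (n + N)", OF open_ball m(1)])
    show "continuous_on (ball x0 R) M"
      using dM has_derivative_continuous by (intro continuous_at_imp_continuous_on ballI) blast
    show "(\<lambda>n. \<tau> (n + N)) \<longlonglongrightarrow> 0" using \<tau>0 by (rule LIMSEQ_ignore_initial_segment)
    then show "(\<lambda>n. D * \<tau> (n + N)) \<longlonglongrightarrow> 0" by (rule tendsto_mult_right_zero)
    show "\<bar>convolve (Rho (\<tau> (n + N))) m x - M x\<bar> \<le> D * \<tau> (n + N)" if "x \<in> ball x0 R" for n x
      using M[OF that \<tau>, of "n + N"] N[of "n + N"] by (simp add: w_def)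
  qed (rule \<tau>)
  then show ?thesis using limM M0 dM unfolding w_def \<tau>_def by blast
qed

text \<open>The local representatives are glued by defining \<open>M\<close> globally as a limit of
  mollifications. A mollification at small scale sees only a small ball, so near each point
  \<open>M\<close> coincides with the representative obtained there.\<close>

lemma first_order_regularity:
  fixes m :: "real^'n::finite \<Rightarrow> real" and b :: "real^'n \<Rightarrow> real^'n"
  assumes \<Omega>: "open \<Omega>"
    and int: "\<And>K. compact K \<Longrightarrow> K \<subseteq> \<Omega> \<Longrightarrow> set_integrable lborel K m"
    and nn: "AE x in lborel. x \<in> \<Omega> \<longrightarrow> m x \<ge> 0"
    and b: "continuous_on \<Omega> b"
    and weak: "\<And>\<xi> i. test_fun \<Omega> \<xi> \<Longrightarrow>
      (LINT y:\<Omega>|lborel. m y * partial i \<xi> y) = (LINT y:\<Omega>|lborel. m y * b y $ i * \<xi> y)"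
  shows "\<exists>M. (\<forall>x\<in>\<Omega>. M x \<ge> 0 \<and> (M has_derivative (\<lambda>h. (- M x *\<^sub>R b x) \<bullet> h)) (at x)) \<and>
      (AE x in lborel. x \<in> \<Omega> \<longrightarrow> m x = M x)"
proof -
  \<comment> \<open>The absolute value turns nonnegativity almost everywhere into nonnegativity
    everywhere, as the local statement requires.\<close>
  define m0 where "m0 y = indicator \<Omega> y * \<bar>m y\<bar>" for y
  define M where "M x = lim (\<lambda>n. convolve (Rho (1 / real (Suc n))) m0 x)" for x
  have loc: "\<exists>R>0. (\<forall>x\<in>ball x0 R. M x \<ge> 0 \<and> (M has_derivative (\<lambda>h. (- M x *\<^sub>R b x) \<bullet> h)) (at x)) \<and>
      (AE x in lborel. x \<in> ball x0 R \<longrightarrow> m x = M x)" if x0: "x0 \<in> \<Omega>" for x0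
  proof -
    obtain e where e: "e > 0" "cball x0 e \<subseteq> \<Omega>" using \<Omega> x0 open_contains_cball by blast
    define R where "R = e / 2"
    have R: "R > 0" "cball x0 (2 * R) \<subseteq> \<Omega>" using e by (auto simp: R_def)
    define K where "K = cball x0 (2 * R)"
    define m1 where "m1 y = indicator K y * \<bar>m y\<bar>" for y
    have K: "compact K" "K \<subseteq> \<Omega>" using R by (auto simp: K_def)
    have aem: "AE y in lborel. indicator K y * m y = m1 y"
      using nn by eventually_elim (use K in \<open>auto simp: m1_def indicator_def\<close>)
    have c1: "cs_integrable m1" unfolding m1_def
      by (rule cs_integrableI_indicator[OF K(1)]) (rule set_integrable_abs[OF int[OF K]])
    have "\<exists>M. (\<forall>x\<in>ball x0 R. (\<lambda>n. convolve (Rho (1 / real (Suc n))) m1 x) \<longlonglongrightarrow> M x \<and> M x \<ge> 0 \<and>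
      (M has_derivative (\<lambda>h. (- M x *\<^sub>R b x) \<bullet> h)) (at x)) \<and>
      (AE x in lborel. x \<in> ball x0 R \<longrightarrow> m1 x = M x)"
    proof (rule first_order_regularity_local[OF R(1) c1])
      show "m1 y \<ge> 0" for y by (simp add: m1_def)
      show "m1 y = 0" if "y \<notin> cball x0 (2 * R)" for y using that by (simp add: m1_def K_def)
      show "continuous_on (cball x0 (2 * R)) b" by (rule continuous_on_subset[OF b R(2)])
      fix \<xi> i assume \<xi>: "test_fun (ball x0 (2 * R)) \<xi>"
      obtain K' where K': "compact K'" "K' \<subseteq> ball x0 (2 * R)" "\<And>x. x \<notin> K' \<Longrightarrow> \<xi> x = 0"
        by (rule test_fun_support[OF \<xi>], rule that)
      have K'K: "K' \<subseteq> K" using K'(2) by (auto simp: K_def)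
      have "test_fun \<Omega> \<xi>" using \<xi> R(2) ball_subset_cball unfolding test_fun_def by blast
      have p0: "partial i \<xi> x = 0" if "x \<notin> K'" for x
        using partial_zero_outside[OF open_UNIV K'(1), of \<xi> x i] K'(3) that by blast
      have c\<xi>: "continuous_on UNIV \<xi>" "continuous_on UNIV (partial i \<xi>)"
        using test_fun_C1_on[OF \<xi>, of UNIV] C1_on_continuous_on by (auto simp: C1_on_def)
      then have [measurable]: "\<xi> \<in> borel_measurable borel" "partial i \<xi> \<in> borel_measurable borel"
        by (auto intro: borel_measurable_continuous_onI)
      have [measurable]: "m1 \<in> borel_measurable borel" using c1 by measurable
      have [measurable]: "(\<lambda>y. indicator K y * m y) \<in> borel_measurable borel"
        using int[OF K] by (auto simp: set_integrable_def)
      have "cs_integrable (\<lambda>y. indicator K y * b y $ i)"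
        by (rule cs_integrableI_indicator[OF K(1)])
           (use borel_integrable_compact[OF K(1), of "\<lambda>y. b y $ i"] continuous_on_subset[OF b K(2)]
            in \<open>auto simp: set_integrable_def intro!: continuous_intros\<close>)
      then have [measurable]: "(\<lambda>y. indicator K y * b y $ i) \<in> borel_measurable borel" by measurable
      have ae: "AE y in lborel. F (indicator K y * m y) y = F (m1 y) y" for F :: "real \<Rightarrow> real^'n \<Rightarrow> real"
        using aem by eventually_elim simp
      have "(LINT y|lborel. m1 y * partial i \<xi> y) = (LINT y|lborel. (indicator K y * m y) * partial i \<xi> y)"
        by (rule integral_cong_AE[symmetric, OF _ _ ae[of "\<lambda>a y. a * partial i \<xi> y"]]) auto
      also have "\<dots> = (LINT y:\<Omega>|lborel. m y * partial i \<xi> y)"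
        unfolding set_lebesgue_integral_def
        using p0 K'K K(2) by (intro Bochner_Integration.integral_cong) (auto simp: indicator_def)
      also have "\<dots> = (LINT y:\<Omega>|lborel. m y * b y $ i * \<xi> y)" by (rule weak) fact
      also have "\<dots> = (LINT y|lborel. (indicator K y * m y) * (indicator K y * b y $ i) * \<xi> y)"
        unfolding set_lebesgue_integral_def
        using K'(3) K'K K(2) by (intro Bochner_Integration.integral_cong) (auto simp: indicator_def)
      also have "\<dots> = (LINT y|lborel. m1 y * (indicator K y * b y $ i) * \<xi> y)"
        by (rule integral_cong_AE[OF _ _ ae[of "\<lambda>a y. a * (indicator K y * b y $ i) * \<xi> y"]]) auto
      also have "\<dots> = (LINT y|lborel. m1 y * b y $ i * \<xi> y)"
        by (intro Bochner_Integration.integral_cong) (auto simp: indicator_def m1_def)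
      finally show "(LINT y|lborel. m1 y * partial i \<xi> y) = (LINT y|lborel. m1 y * b y $ i * \<xi> y)" .
    qed
    then obtain M1 where M1: "\<And>x. x\<in>ball x0 R \<Longrightarrow> (\<lambda>n. convolve (Rho (1 / real (Suc n))) m1 x) \<longlonglongrightarrow> M1 x"
       "\<And>x. x\<in>ball x0 R \<Longrightarrow> M1 x \<ge> 0" "\<And>x. x\<in>ball x0 R \<Longrightarrow> (M1 has_derivative (\<lambda>h. (- M1 x *\<^sub>R b x) \<bullet> h)) (at x)"
      "AE x in lborel. x \<in> ball x0 R \<longrightarrow> m1 x = M1 x" by blast
    \<comment> \<open>Once the scale is below R, the kernel centred at \<open>x\<close> lives inside
      \<open>K\<close>, where the two truncations coincide.\<close>
    have MM: "M x = M1 x" if x: "x \<in> ball x0 R" for x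
    proof -
      have "(\<lambda>n. 1 / real (Suc n)) \<longlonglongrightarrow> 0"
        using LIMSEQ_inverse_real_of_nat by (simp add: divide_inverse)
      from order_tendstoD(2)[OF this R(1)]
      have "\<forall>\<^sub>F n in sequentially. convolve (Rho (1 / real (Suc n))) m1 x = convolve (Rho (1 / real (Suc n))) m0 x"
      proof eventually_elim
        case (elim n)
        show ?case
        proof (rule convolve_cong)
          fix y assume "y \<in> cball x (1 / real (Suc n))"
          then have "y \<in> K" using x elim dist_triangle[of x0 y x] by (simp add: K_def)
          then show "m1 y = m0 y" using K(2) by (auto simp: m0_def m1_def)
        qed (auto intro!: kernel_zero)
      qed
      then have "(\<lambda>n. convolve (Rho (1 / real (Suc n))) m0 x) \<longlonglongrightarrow> M1 x"
        by (rule Lim_transform_eventually[OF M1(1)[OF x]])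
      then show ?thesis unfolding M_def by (rule limI)
    qed
    have "(M has_derivative (\<lambda>h. (- M x *\<^sub>R b x) \<bullet> h)) (at x)" if x: "x \<in> ball x0 R" for x
      using has_derivative_transform_within_open[OF M1(3)[OF x] open_ball x, of M] MM x by auto
    moreover have "AE x in lborel. x \<in> ball x0 R \<longrightarrow> m x = M x"
      using M1(4) aem
    proof eventually_elim
      case (elim x)
      show ?case
      proof
        assume x: "x \<in> ball x0 R"
        then have "x \<in> K" using R by (auto simp: K_def)
        then show "m x = M x" using elim x MM by auto
      qed
    qed
    ultimately show ?thesis using R(1) M1(2) MM by (intro exI[of _ R]) auto
  qed
  have "\<forall>x\<in>\<Omega>. M x \<ge> 0 \<and> (M has_derivative (\<lambda>h. (- M x *\<^sub>R b x) \<bullet> h)) (at x)"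
    using loc centre_in_ball by blast
  moreover have "AE x in lborel. x \<in> \<Omega> \<longrightarrow> m x = M x"
    by (rule AE_local) (use loc in blast)
  ultimately show ?thesis by blast
qed

text \<open>On a segment ending at a zero of \<open>M\<close> the derivative is bounded by a
  constant times \<open>M\<close>, so Gronwall forces \<open>M\<close> to vanish along the segment.
  The zero set is thus open as well as closed, and connectedness leaves only the empty set.\<close>

lemma first_order_positive:
  fixes M :: "real^'n::finite \<Rightarrow> real"
  assumes \<Omega>: "open \<Omega>" "connected \<Omega>"
    and M: "\<And>x. x \<in> \<Omega> \<Longrightarrow> M x \<ge> 0" "\<And>x. x \<in> \<Omega> \<Longrightarrow> (M has_derivative (\<lambda>h. (- M x *\<^sub>R b x) \<bullet> h)) (at x)"
    and b: "continuous_on \<Omega> b"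
    and nz: "x1 \<in> \<Omega>" "M x1 \<noteq> 0"
    and x: "x \<in> \<Omega>"
  shows "M x > 0"
proof -
  define Z where "Z = {x \<in> \<Omega>. M x = 0}"
  have cM: "continuous_on \<Omega> M"
    using M(2) has_derivative_continuous by (intro continuous_at_imp_continuous_on ballI) blast
  have "closedin (top_of_set \<Omega>) Z"
    unfolding Z_def by (rule continuous_closedin_preimage_constant[OF cM])
  moreover have "open Z"
    unfolding open_contains_ball
  proof
    fix x0 assume x0: "x0 \<in> Z"
    then obtain e where e: "e > 0" "cball x0 e \<subseteq> \<Omega>"
      using \<Omega>(1) open_contains_cball unfolding Z_def by blast
    obtain B where B: "\<And>y. y \<in> cball x0 e \<Longrightarrow> norm (b y) \<le> B"
      using compact_imp_bounded[OF compact_continuous_image[OF continuous_on_subset[OF b e(2)] compact_cball]]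
      by (metis bounded_iff imageI)
    have "M y = 0" if y: "y \<in> ball x0 e" for y
    proof -
      define p where "p s = y + s *\<^sub>R (x0 - y)" for s
      have pin: "p s \<in> cball x0 e" if "0 \<le> s" "s \<le> 1" for s
      proof -
        have "x0 - p s = (1 - s) *\<^sub>R (x0 - y)" by (simp add: p_def algebra_simps)
        then have "norm (x0 - p s) = \<bar>1 - s\<bar> * norm (x0 - y)" by simp
        also have "\<dots> \<le> 1 * norm (x0 - y)" by (rule mult_right_mono) (use that in auto)
        finally show ?thesis using y by (simp add: dist_norm)
      qed
      define f' where "f' s = - M (p s) * (b (p s) \<bullet> (x0 - y))" for s
      have d: "((\<lambda>s. M (p s)) has_real_derivative f' s) (at s)" if "0 \<le> s" "s \<le> 1" for s
      proof -
        have "(p has_derivative (\<lambda>h. h *\<^sub>R (x0 - y))) (at s)"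
          unfolding p_def[abs_def] by (auto intro!: derivative_eq_intros)
        from has_derivative_compose[OF this M(2)] pin[OF that] e(2)
        have "((\<lambda>s. M (p s)) has_derivative (\<lambda>h. (- M (p s) *\<^sub>R b (p s)) \<bullet> (h *\<^sub>R (x0 - y)))) (at s)" by blast
        moreover have "(\<lambda>h. (- M (p s) *\<^sub>R b (p s)) \<bullet> (h *\<^sub>R (x0 - y))) = (*) (f' s)"
          by (simp add: f'_def fun_eq_iff)
        ultimately show ?thesis by (simp add: has_field_derivative_def)
      qed
      \<comment> \<open>The segment is parametrised to reach the zero \<open>x0\<close> at s = 1,
        the end from which the backward estimate starts.\<close>
      have "M (p 0) \<le> exp (B * e * (1 - 0)) * M (p 1)"
      proof (rule gronwall_backward[of 0 1 "\<lambda>s. M (p s)" f'])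
        fix s :: real assume s: "0 \<le> s" "s \<le> 1"
        have "\<bar>b (p s) \<bullet> (x0 - y)\<bar> \<le> norm (b (p s)) * norm (x0 - y)" by (rule Cauchy_Schwarz_ineq2)
        also have "\<dots> \<le> B * e" using B[OF pin[OF s]] y
          by (intro mult_mono) (auto simp: dist_norm intro: order_trans[OF norm_ge_zero])
        finally have "M (p s) * \<bar>b (p s) \<bullet> (x0 - y)\<bar> \<le> M (p s) * (B * e)"
          using M(1)[of "p s"] pin[OF s] e(2) by (intro mult_left_mono) auto
        then show "\<bar>f' s\<bar> \<le> B * e * M (p s)"
          using M(1)[of "p s"] pin[OF s] e(2) by (auto simp: f'_def abs_mult mult_ac)
      qed (use d in auto)
      moreover have "p 0 = y" "p 1 = x0" by (simp_all add: p_def)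
      ultimately have "M y \<le> 0" using x0 by (simp add: Z_def)
      moreover have "y \<in> \<Omega>" using y e(2) by auto
      ultimately show ?thesis using M(1)[of y] by simp
    qed
    then show "\<exists>e>0. ball x0 e \<subseteq> Z" using e by (auto simp: Z_def subset_iff intro!: exI[of _ e])
  qed
  then have "openin (top_of_set \<Omega>) Z" by (auto intro!: open_subset simp: Z_def)
  ultimately have "Z = {} \<or> Z = \<Omega>" using \<Omega>(2) unfolding connected_clopen by blast
  moreover have "Z \<noteq> \<Omega>" using nz by (auto simp: Z_def)
  ultimately have "x \<notin> Z" by simp
  then show ?thesis using M(1)[OF x] x by (simp add: Z_def)
qed

section \<open>Symmetry of second derivatives, and auxiliary facts on convolutions and finite
  sums\<close>

lemma smooth_elem_partial_eqs:
  assumes "smooth_elem f" "smooth_elem g"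
  shows "partial i (\<lambda>x. f x + g x) = (\<lambda>x. partial i f x + partial i g x)"
    and "partial i (\<lambda>x. f x * g x) = (\<lambda>x. f x * partial i g x + partial i f x * g x)"
    and "partial i (\<lambda>x. eflat k (f x)) = (\<lambda>x. eflat (Suc k) (f x) * partial i f x)"
proof -
  have d: "(f has_derivative (\<lambda>h. grad f x \<bullet> h)) (at x)" "(g has_derivative (\<lambda>h. grad g x \<bullet> h)) (at x)" for x
    using assms by (auto intro: has_derivative_grad smooth_elem_differentiable)
  show "partial i (\<lambda>x. f x + g x) = (\<lambda>x. partial i f x + partial i g x)"
    by (rule ext, subst partial_eqI[OF has_derivative_add[OF d]]) (simp add: inner_axis)
  show "partial i (\<lambda>x. f x * g x) = (\<lambda>x. f x * partial i g x + partial i f x * g x)"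
    by (rule ext, subst partial_eqI[OF has_derivative_mult[OF d]]) (simp add: inner_axis)
  show "partial i (\<lambda>x. eflat k (f x)) = (\<lambda>x. eflat (Suc k) (f x) * partial i f x)"
    by (rule ext, subst partial_eqI[OF has_derivative_compose[OF d(1) eflat_has_derivative[unfolded has_field_derivative_def]]])
       (simp add: inner_axis)
qed

text \<open>Structural induction with the product and chain rules. The symmetry is needed on the
  side of the test function, where it expresses that a gradient is curl-free in the weak
  sense.\<close>

lemma smooth_elem_partial_commute:
  fixes f :: "real^'n::finite \<Rightarrow> real"
  assumes "smooth_elem f" shows "partial i (partial j f) = partial j (partial i f)"
  using assms
proof induction
  case (smooth_elem_const c)
  have "partial i (\<lambda>_::real^'n. c) = (\<lambda>_. 0)" for i and c :: real
    by (rule ext, rule partial_eqI[where f' = "\<lambda>_. 0"]) simp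
  then show ?case by metis
next
  case (smooth_elem_coord k)
  have 0: "partial i (\<lambda>_::real^'n. c) = (\<lambda>_. 0)" for i and c :: real
    by (rule ext, rule partial_eqI[where f' = "\<lambda>_. 0"]) simp
  have "partial i (\<lambda>x. x $ k) = (\<lambda>_. axis i 1 $ k)" for i
    by (rule ext, rule partial_eqI[OF coord_has_derivative])
  then show ?case by (simp add: 0)
next
  case (smooth_elem_add f g)
  then show ?case by (simp add: smooth_elem_partial_eqs smooth_elem_partial)
next
  case (smooth_elem_mult f g)
  have s: "smooth_elem (\<lambda>x. f x * partial i g x)" "smooth_elem (\<lambda>x. partial i f x * g x)" for i
    using smooth_elem_mult by (auto intro: smooth_elem_intros smooth_elem_partial)
  have e: "partial i (partial j (\<lambda>x. f x * g x)) = (\<lambda>x. (f x * partial i (partial j g) x + partial i f x * partial j g x)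
      + (partial j f x * partial i g x + partial i (partial j f) x * g x))" for i j
    by (simp add: smooth_elem_partial_eqs smooth_elem_partial smooth_elem_mult.hyps s)
  show ?case unfolding e by (simp add: smooth_elem_mult.IH algebra_simps)
next
  case (smooth_elem_eflat f k)
  have s: "smooth_elem (\<lambda>x. eflat k (f x))" for k using smooth_elem_eflat by (auto intro: smooth_elem_intros)
  have e1: "partial i (\<lambda>x. eflat k (f x)) = (\<lambda>x. eflat (Suc k) (f x) * partial i f x)" for i k
    by (rule smooth_elem_partial_eqs(3)[OF smooth_elem_eflat.hyps smooth_elem_eflat.hyps])
  have e2: "partial i (\<lambda>x. eflat k (f x) * partial j f x) = (\<lambda>x. eflat k (f x) * partial i (partial j f) x + eflat (Suc k) (f x) * partial i f x * partial j f x)" for i j k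
    by (simp add: smooth_elem_partial_eqs(2)[OF s smooth_elem_partial[OF smooth_elem_eflat.hyps]] e1)
  show ?case unfolding e1 e2 by (simp add: smooth_elem_eflat.IH mult_ac)
qed

lemma DRho_bounded:
  assumes t: "t > 0" shows "\<exists>D\<ge>0. \<forall>z::real^'n::finite. \<bar>DRho k t z\<bar> \<le> D"
proof -
  have c0: "continuous_on (cball 0 t) (DRho k t :: real^'n \<Rightarrow> real)" using t by (auto intro!: continuous_intros)
  obtain D where D: "\<And>z::real^'n. z \<in> cball 0 t \<Longrightarrow> \<bar>DRho k t z\<bar> \<le> D"
    using compact_imp_bounded[OF compact_continuous_image[OF c0 compact_cball]] by (metis bounded_real imageI)
  have "\<bar>DRho k t (z::real^'n)\<bar> \<le> \<bar>D\<bar>" for z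
    using D[of z] kernel_zero(4)[OF t, of z k] by (cases "norm z \<le> t") auto
  then show ?thesis by (intro exI[of _ "\<bar>D\<bar>"]) auto
qed

lemma continuous_on_convolve_DRho:
  fixes v :: "real^'n::finite \<Rightarrow> real"
  assumes v: "cs_integrable v" and t: "t > 0"
  shows "continuous_on UNIV (convolve (DRho k t) v)"
proof (rule continuous_at_imp_continuous_on, rule ballI)
  fix x
  have iv: "integrable lborel v" using v by (auto simp: cs_integrable_def)
  have [measurable]: "v \<in> borel_measurable borel" using v by measurable
  obtain D where D: "D \<ge> 0" "\<And>z::real^'n. \<bar>DRho k t z\<bar> \<le> D" using DRho_bounded[OF t] by blast
  have c: "continuous_on UNIV (DRho k t :: real^'n \<Rightarrow> real)" using t by (auto intro!: continuous_intros)
  show "isCont (convolve (DRho k t) v) x"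
    unfolding isCont_def tendsto_at_iff_sequentially comp_def
  proof (intro allI impI)
    fix X :: "nat \<Rightarrow> real^'n" assume X: "\<forall>i. X i \<in> UNIV - {x}" "X \<longlonglongrightarrow> x"
    show "(\<lambda>n. convolve (DRho k t) v (X n)) \<longlonglongrightarrow> convolve (DRho k t) v x"
      unfolding convolve_def
    proof (rule integral_dominated_convergence[where w = "\<lambda>y. D * \<bar>v y\<bar>"])
      show "AE y in lborel. norm (v y * DRho k t (X n - y)) \<le> D * \<bar>v y\<bar>" for n
        using D by (intro AE_I2) (simp add: abs_mult mult.commute[of D] mult_left_mono)
      show "AE y in lborel. (\<lambda>n. v y * DRho k t (X n - y)) \<longlonglongrightarrow> v y * DRho k t (x - y)"
      proof (intro AE_I2 tendsto_intros)
        fix y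
        have "isCont (DRho k t) (x - y)" using c by (simp add: continuous_on_eq_continuous_at)
        then show "(\<lambda>n. DRho k t (X n - y)) \<longlonglongrightarrow> DRho k t (x - y)"
          using X(2) by (intro isCont_tendsto_compose[where g = "DRho k t"] tendsto_intros)
      qed
    qed (use iv in auto)
  qed
qed

lemma set_integral_sum_finite:
  fixes f :: "'i \<Rightarrow> 'a \<Rightarrow> real"
  assumes "\<And>i. i \<in> I \<Longrightarrow> set_integrable M A (f i)"
  shows "(LINT x:A|M. (\<Sum>i\<in>I. f i x)) = (\<Sum>i\<in>I. LINT x:A|M. f i x)"
  using assms unfolding set_lebesgue_integral_def set_integrable_def scaleR_sum_right
  by (rule Bochner_Integration.integral_sum)

subsection \<open>Divergence form equations tested with continuously differentiable functions\<close>

text \<open>The coefficients are mollified, not the test function: near the support of \<zeta> one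
  has div(\<rho>_t * V) = \<rho>_t * F pointwise. This is integrated by parts against the C^1
  function \<zeta>, and then t tends to 0.\<close>

lemma weak_divergence_C1c:
  fixes V :: "real^'n::finite \<Rightarrow> real^'n" and F :: "real^'n \<Rightarrow> real"
  assumes \<Omega>: "open \<Omega>" and V: "continuous_on \<Omega> V" and F: "continuous_on \<Omega> F"
    and weak: "\<And>\<xi>. test_fun \<Omega> \<xi> \<Longrightarrow> (LINT x:\<Omega>|lborel. V x \<bullet> grad \<xi> x) = - (LINT x:\<Omega>|lborel. F x * \<xi> x)"
    and \<zeta>: "C1_on \<Omega> \<zeta>" and K: "compact K" "K \<subseteq> \<Omega>" "\<And>x. x \<in> \<Omega> - K \<Longrightarrow> \<zeta> x = 0"
  shows "(LINT x:\<Omega>|lborel. V x \<bullet> grad \<zeta> x) = - (LINT x:\<Omega>|lborel. F x * \<zeta> x)"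
proof -
  obtain r where r: "r > 0" "(\<Union>x\<in>K. cball x r) \<subseteq> \<Omega>"
    using compact_subset_open_imp_cball_epsilon_subset[OF K(1) \<Omega> K(2)] by blast
  \<comment> \<open>Two nested neighbourhoods of the support: \<open>K2\<close> is the closed one of
    radius r inside \<open>\<Omega>\<close>, and \<open>U\<close> below is the open one of radius
    r/2. Kernels of scale at most r/2 centred in \<open>U\<close> stay in \<open>K2\<close>, where
    the data are kept.\<close>
  define K2 where "K2 = {x + y | x y. x \<in> K \<and> y \<in> cball 0 r}"
  have cK2: "compact K2" unfolding K2_def by (rule compact_sums) (use K in auto)
  have K2I: "y \<in> K2" if "x \<in> K" "dist x y \<le> r" for x y
    unfolding K2_def using that
    by (intro CollectI exI[of _ x] exI[of _ "y - x"]) (auto simp: dist_norm norm_minus_commute)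
  have K2\<Omega>: "K2 \<subseteq> \<Omega>"
  proof
    fix z assume "z \<in> K2"
    then obtain x y where "x \<in> K" "norm y \<le> r" "z = x + y" by (auto simp: K2_def)
    then have "z \<in> cball x r" by (simp add: dist_norm)
    then show "z \<in> \<Omega>" using r(2) \<open>x \<in> K\<close> by blast
  qed
  define U where "U = (\<Union>x\<in>K. ball x (r / 2))"
  have U: "open U" "K \<subseteq> U" "U \<subseteq> K2" unfolding U_def using r(1) by (auto intro!: K2I)
  have U\<Omega>: "U \<subseteq> \<Omega>" using U(3) K2\<Omega> by blast
  have sub: "cball x t \<subseteq> K2" if "x \<in> U" "t \<le> r / 2" for x t
  proof
    fix y assume y: "y \<in> cball x t"
    obtain z where z: "z \<in> K" "dist z x < r / 2" using \<open>x \<in> U\<close> by (auto simp: U_def)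
    show "y \<in> K2" by (rule K2I[OF z(1)]) (use z(2) y that(2) dist_triangle[of z y x] in auto)
  qed
  define v where "v i x = indicator K2 x * V x $ i" for i x
  define Fh where "Fh x = indicator K2 x * F x" for x
  have VK: "continuous_on K2 (\<lambda>x. V x $ i)" for i
    using continuous_on_subset[OF V K2\<Omega>] by (intro continuous_intros)
  have FK: "continuous_on K2 F" using continuous_on_subset[OF F K2\<Omega>] .
  have v_int: "cs_integrable (v i)" for i unfolding v_def[abs_def]
    using borel_integrable_compact[OF cK2 VK[of i]] by (intro cs_integrableI_indicator cK2) (simp add: set_integrable_def)
  have cF: "cs_integrable Fh" unfolding Fh_def[abs_def]
    using borel_integrable_compact[OF cK2 FK] by (intro cs_integrableI_indicator cK2) (simp add: set_integrable_def)
  have bounded: "\<exists>B. \<forall>x. \<bar>indicator K2 x * f x\<bar> \<le> B" if fc: "continuous_on K2 f" for f :: "real^'n \<Rightarrow> real"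
  proof -
    obtain B where "\<And>x. x \<in> K2 \<Longrightarrow> \<bar>f x\<bar> \<le> B"
      using compact_imp_bounded[OF compact_continuous_image[OF fc cK2]] by (metis bounded_real imageI)
    then have "\<bar>indicator K2 x * f x\<bar> \<le> max 0 B" for x by (cases "x \<in> K2") (auto simp: max.coboundedI2)
    then show ?thesis by blast
  qed
  obtain B where B: "\<And>i x. \<bar>v i x\<bar> \<le> B i" using bounded[OF VK] unfolding v_def by metis
  obtain BF where BF: "\<And>x. \<bar>Fh x\<bar> \<le> BF" using bounded[OF FK] unfolding Fh_def by metis
  have isC: "isCont (v i) x" "isCont Fh x" if x: "x \<in> U" for x i
  proof -
    have "continuous_on U (v i)"
      by (rule continuous_on_eq[OF continuous_on_subset[OF VK U(3)]]) (use U(3) in \<open>auto simp: v_def\<close>)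
    then show "isCont (v i) x" using U(1) x continuous_on_eq_continuous_at by blast
    have "continuous_on U Fh"
      by (rule continuous_on_eq[OF continuous_on_subset[OF FK U(3)]]) (use U(3) in \<open>auto simp: Fh_def\<close>)
    then show "isCont Fh x" using U(1) x continuous_on_eq_continuous_at by blast
  qed
  \<comment> \<open>The weak equation with the test function \<rho>_t(x - y) is the pointwise
    divergence equation for the mollified field.\<close>
  have div: "(\<Sum>i\<in>UNIV. convolve (DRho i t) (v i) x) = convolve (Rho t) Fh x" if x: "x \<in> U" and t: "0 < t" "t \<le> r / 2" for x t
  proof -
    define \<xi> where "\<xi> y = Rho t (x - y)" for y
    have tf: "test_fun \<Omega> \<xi>" unfolding \<xi>_def[abs_def]
      by (rule kernel_test_fun(1)[OF t(1)]) (use sub[OF x t(2)] K2\<Omega> in blast)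
    have z: "Rho t (x - y) = 0" "DRho i t (x - y) = 0" if "y \<notin> K2" for y i
    proof -
      have "y \<notin> cball x t" using sub[OF x t(2)] that by blast
      then have "t \<le> norm (x - y)" by (simp add: dist_norm)
      then show "Rho t (x - y) = 0" "DRho i t (x - y) = 0" using t(1) by (simp_all add: kernel_zero)
    qed
    have "(LINT y:\<Omega>|lborel. V y \<bullet> grad \<xi> y) = (LINT y|lborel. - (\<Sum>i\<in>UNIV. v i y * DRho i t (x - y)))"
      unfolding set_lebesgue_integral_def
    proof (rule Bochner_Integration.integral_cong)
      fix y
      show "indicator \<Omega> y *\<^sub>R (V y \<bullet> grad \<xi> y) = - (\<Sum>i\<in>UNIV. v i y * DRho i t (x - y))"
        using z(2)[of y] K2\<Omega> unfolding \<xi>_def[abs_def]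
        by (cases "y \<in> K2") (auto simp: inner_vec_def partial_kernel v_def sum_negf indicator_def)
    qed simp
    also have "\<dots> = - (\<Sum>i\<in>UNIV. convolve (DRho i t) (v i) x)"
      unfolding convolve_def using cs_integrable_kernel(3)[OF v_int t(1), of _ _ x] by simp
    finally have 1: "(LINT y:\<Omega>|lborel. V y \<bullet> grad \<xi> y) = - (\<Sum>i\<in>UNIV. convolve (DRho i t) (v i) x)" .
    have "(LINT y:\<Omega>|lborel. F y * \<xi> y) = convolve (Rho t) Fh x"
      unfolding set_lebesgue_integral_def convolve_def
    proof (rule Bochner_Integration.integral_cong)
      fix y
      show "indicator \<Omega> y *\<^sub>R (F y * \<xi> y) = Fh y * Rho t (x - y)"
        using z(1)[of y] K2\<Omega> by (cases "y \<in> K2") (auto simp: \<xi>_def Fh_def indicator_def)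
    qed simp
    with weak[OF tf] 1 show ?thesis by simp
  qed
  have \<zeta>U: "C1_on U \<zeta>" using \<zeta> U\<Omega> continuous_on_subset unfolding C1_on_def by blast
  have \<zeta>0: "\<zeta> x = 0" if "x \<in> U - K" for x using K(3) that U\<Omega> by blast
  have \<zeta>p0: "partial i \<zeta> x = 0" if "x \<in> \<Omega> - K" for i x
    by (rule partial_zero_outside[OF \<Omega> K(1) K(3) that])
  have ident: "(\<Sum>i\<in>UNIV. LINT x:U|lborel. convolve (Rho t) (v i) x * partial i \<zeta> x) = - (LINT x:U|lborel. convolve (Rho t) Fh x * \<zeta> x)"
    if t: "0 < t" "t \<le> r / 2" for t
  proof -
    have C1: "C1_on U (convolve (Rho t) (v i))" for i
    proof -
      have d: "(convolve (Rho t) (v i) has_derivative (\<lambda>h. (\<chi> k. convolve (DRho k t) (v i) x) \<bullet> h)) (at x)" for x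
        by (rule convolve_Rho_has_derivative[OF v_int t(1)])
      have "continuous_on U (\<lambda>x. convolve (DRho k t) (v i) x)" for k
        by (rule continuous_on_subset[OF continuous_on_convolve_DRho[OF v_int t(1)]]) simp
      then show ?thesis using d by (intro C1_onI) auto
    qed
    have p: "partial i (convolve (Rho t) (v i)) x = convolve (DRho i t) (v i) x" for i x
      by (subst partial_eqI_grad[OF convolve_Rho_has_derivative[OF v_int t(1)]]) simp
    have si: "set_integrable lborel U (\<lambda>x. convolve (DRho i t) (v i) x * \<zeta> x)" for i
      using \<zeta>0 C1_on_continuous_on[OF \<zeta>U] continuous_on_subset[OF continuous_on_convolve_DRho[OF v_int t(1)]]
      by (intro set_integrable_continuous_compact_support[OF U(1) K(1) U(2)])
         (auto intro!: continuous_on_mult)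
    have "(\<Sum>i\<in>UNIV. LINT x:U|lborel. convolve (Rho t) (v i) x * partial i \<zeta> x) = (\<Sum>i\<in>UNIV. - (LINT x:U|lborel. convolve (DRho i t) (v i) x * \<zeta> x))"
      using integration_by_parts[OF U(1) C1 \<zeta>U K(1) U(2) \<zeta>0] by (simp add: p)
    also have "\<dots> = - (LINT x:U|lborel. (\<Sum>i\<in>UNIV. convolve (DRho i t) (v i) x * \<zeta> x))"
      using si by (simp add: sum_negf set_integral_sum_finite)
    also have "(LINT x:U|lborel. (\<Sum>i\<in>UNIV. convolve (DRho i t) (v i) x * \<zeta> x)) = (LINT x:U|lborel. convolve (Rho t) Fh x * \<zeta> x)"
      using div[OF _ t] U(1) by (intro set_lebesgue_integral_cong) (auto simp: sum_distrib_right[symmetric])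
    finally show ?thesis .
  qed
  define \<tau> where "\<tau> n = (r / 2) / real (Suc n)" for n
  have \<tau>: "0 < \<tau> n" "\<tau> n \<le> r / 2" for n using r(1) by (auto simp: \<tau>_def divide_simps)
  have \<tau>0: "\<tau> \<longlonglongrightarrow> 0"
    unfolding \<tau>_def[abs_def] divide_inverse[of _ "real (Suc _)"]
    by (rule tendsto_mult_right_zero[OF LIMSEQ_inverse_real_of_nat])
  \<comment> \<open>The truncated coefficients jump at the boundary of \<open>K2\<close> but are
    bounded everywhere and continuous on \<open>U\<close>, which is enough for dominated convergence
    against functions supported in \<open>K\<close>.\<close>
  have lim: "(\<lambda>n. LINT x:U|lborel. convolve (Rho (\<tau> n)) u x * \<eta> x) \<longlonglongrightarrow> (LINT x:U|lborel. u x * \<eta> x)"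
    if u: "cs_integrable u" "\<And>x. x \<in> U \<Longrightarrow> isCont u x" "\<And>x. \<bar>u x\<bar> \<le> b"
      and \<eta>: "continuous_on U \<eta>" "\<And>x. x \<in> U - K \<Longrightarrow> \<eta> x = 0" for u \<eta> b
    unfolding set_lebesgue_integral_def
  proof (rule integral_dominated_convergence)
    have i\<eta>: "integrable lborel (\<lambda>x. indicator U x *\<^sub>R \<eta> x)"
      using set_integrable_continuous_compact_support[OF U(1) K(1) U(2) \<eta>] by (simp add: set_integrable_def)
    have [measurable]: "(\<lambda>x. indicator U x *\<^sub>R \<eta> x) \<in> borel_measurable borel" using i\<eta> by auto
    have [measurable]: "u \<in> borel_measurable borel" using u(1) by measurable
    have [measurable]: "convolve (Rho (\<tau> n)) u \<in> borel_measurable borel" for n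
      using convolve_Rho_has_derivative[OF u(1) \<tau>(1)]
      by (auto intro!: borel_measurable_continuous_onI continuous_at_imp_continuous_on has_derivative_continuous)
    have "(\<lambda>x. u x * (indicator U x *\<^sub>R \<eta> x)) \<in> borel_measurable borel" by measurable
    then show "(\<lambda>x. indicator U x *\<^sub>R (u x * \<eta> x)) \<in> borel_measurable lborel" by (simp only: mult_scaleR_right measurable_lborel1 measurable_lborel2)
    have "(\<lambda>x. convolve (Rho (\<tau> n)) u x * (indicator U x *\<^sub>R \<eta> x)) \<in> borel_measurable borel" for n by measurable
    then show "(\<lambda>x. indicator U x *\<^sub>R (convolve (Rho (\<tau> n)) u x * \<eta> x)) \<in> borel_measurable lborel" for n by (simp only: mult_scaleR_right measurable_lborel1 measurable_lborel2)
    show "integrable lborel (\<lambda>x. b * \<bar>indicator U x *\<^sub>R \<eta> x\<bar>)"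
      using integrable_abs[OF i\<eta>] by simp
    show "AE x in lborel. norm (indicator U x *\<^sub>R (convolve (Rho (\<tau> n)) u x * \<eta> x)) \<le> b * \<bar>indicator U x *\<^sub>R \<eta> x\<bar>" for n
    proof (rule AE_I2)
      fix x
      have "\<bar>convolve (Rho (\<tau> n)) u x - 0\<bar> \<le> b" by (rule convolve_Rho_close[OF u(1) \<tau>(1)]) (simp add: u(3))
      then have "\<bar>convolve (Rho (\<tau> n)) u x\<bar> * \<bar>indicator U x *\<^sub>R \<eta> x\<bar> \<le> b * \<bar>indicator U x *\<^sub>R \<eta> x\<bar>"
        by (intro mult_right_mono) auto
      then show "norm (indicator U x *\<^sub>R (convolve (Rho (\<tau> n)) u x * \<eta> x)) \<le> b * \<bar>indicator U x *\<^sub>R \<eta> x\<bar>"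
        by (simp only: mult_scaleR_right[symmetric] real_norm_def abs_mult)
    qed
    show "AE x in lborel. (\<lambda>n. indicator U x *\<^sub>R (convolve (Rho (\<tau> n)) u x * \<eta> x)) \<longlonglongrightarrow> indicator U x *\<^sub>R (u x * \<eta> x)"
    proof (rule AE_I2)
      fix x show "(\<lambda>n. indicator U x *\<^sub>R (convolve (Rho (\<tau> n)) u x * \<eta> x)) \<longlonglongrightarrow> indicator U x *\<^sub>R (u x * \<eta> x)"
        using convolve_Rho_tendsto[OF u(1) u(2) \<tau>(1) \<tau>0, of x]
        by (cases "x \<in> U") (auto intro!: tendsto_intros)
    qed
  qed
  have c\<zeta>: "continuous_on U \<zeta>" "continuous_on U (partial i \<zeta>)" for i
    using \<zeta>U C1_on_continuous_on by (auto simp: C1_on_def)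
  have \<zeta>pU: "partial i \<zeta> x = 0" if "x \<in> U - K" for i x using \<zeta>p0 that U\<Omega> by blast
  have "(\<lambda>n. \<Sum>i\<in>UNIV. LINT x:U|lborel. convolve (Rho (\<tau> n)) (v i) x * partial i \<zeta> x) \<longlonglongrightarrow> (\<Sum>i\<in>UNIV. LINT x:U|lborel. v i x * partial i \<zeta> x)"
    by (intro tendsto_sum lim[OF v_int isC(1) B] c\<zeta> \<zeta>pU)
  moreover have "(\<lambda>n. - (LINT x:U|lborel. convolve (Rho (\<tau> n)) Fh x * \<zeta> x)) \<longlonglongrightarrow> - (LINT x:U|lborel. Fh x * \<zeta> x)"
    by (intro tendsto_minus lim[OF cF isC(2) BF] c\<zeta> \<zeta>0)
  ultimately have eq: "(\<Sum>i\<in>UNIV. LINT x:U|lborel. v i x * partial i \<zeta> x) = - (LINT x:U|lborel. Fh x * \<zeta> x)"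
    using ident[OF \<tau>] LIMSEQ_unique by simp
  have si: "set_integrable lborel U (\<lambda>x. v i x * partial i \<zeta> x)" for i
    using isC(1) \<zeta>pU by (intro set_integrable_continuous_compact_support[OF U(1) K(1) U(2)] continuous_on_mult c\<zeta>)
       (auto intro: continuous_at_imp_continuous_on)
  have "(LINT x:\<Omega>|lborel. V x \<bullet> grad \<zeta> x) = (LINT x:U|lborel. (\<Sum>i\<in>UNIV. v i x * partial i \<zeta> x))"
    unfolding set_lebesgue_integral_def
  proof (rule Bochner_Integration.integral_cong)
    fix x
    show "indicator \<Omega> x *\<^sub>R (V x \<bullet> grad \<zeta> x) = indicator U x *\<^sub>R (\<Sum>i\<in>UNIV. v i x * partial i \<zeta> x)"
    proof (cases "x \<in> K")
      case True
      then have "x \<in> U" "x \<in> \<Omega>" "x \<in> K2" using U U\<Omega> by auto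
      then show ?thesis by (simp add: inner_vec_def v_def)
    next
      case False
      show ?thesis
      proof (cases "x \<in> \<Omega>")
        case True
        then show ?thesis using False \<zeta>p0[of x] by (simp add: inner_vec_def)
      qed (use U\<Omega> in \<open>auto simp: indicator_def\<close>)
    qed
  qed simp
  also have "\<dots> = (\<Sum>i\<in>UNIV. LINT x:U|lborel. v i x * partial i \<zeta> x)"
    using si by (simp add: set_integral_sum_finite)
  also have "\<dots> = - (LINT x:U|lborel. Fh x * \<zeta> x)" by (rule eq)
  also have "(LINT x:U|lborel. Fh x * \<zeta> x) = (LINT x:\<Omega>|lborel. F x * \<zeta> x)"
    unfolding set_lebesgue_integral_def
  proof (rule Bochner_Integration.integral_cong)
    fix x
    show "indicator U x *\<^sub>R (Fh x * \<zeta> x) = indicator \<Omega> x *\<^sub>R (F x * \<zeta> x)"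
      using K(3)[of x] U U\<Omega> by (cases "x \<in> K") (auto simp: Fh_def indicator_def)
  qed simp
  finally show ?thesis .
qed

subsection \<open>Regularity of weak solutions of the Poisson equation\<close>

text \<open>The bound is the sup of the kernel times the L^1 norm of \<open>v\<close>. At the
  largest admissible scale it provides the initial value for the descent in t.\<close>

lemma convolve_DRho_bounded:
  fixes v :: "real^'n::finite \<Rightarrow> real"
  assumes v: "cs_integrable v" and t: "t > 0"
  shows "\<exists>Z\<ge>0. \<forall>x. \<bar>convolve (DRho i t) v x\<bar> \<le> Z"
proof -
  obtain D where D: "D \<ge> 0" "\<And>z::real^'n. \<bar>DRho i t z\<bar> \<le> D" using DRho_bounded[OF t] by blast
  have iv: "integrable lborel (\<lambda>y. \<bar>v y\<bar> * D)" using v by (auto simp: cs_integrable_def)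
  have "\<bar>convolve (DRho i t) v x\<bar> \<le> convolve (\<lambda>_. D) (\<lambda>y. \<bar>v y\<bar>) x" for x
    by (rule abs_convolve_le[OF iv]) (simp add: abs_mult D mult_left_mono)
  moreover have "convolve (\<lambda>_. D) (\<lambda>y. \<bar>v y\<bar>) x \<ge> 0" for x :: "real^'n"
    unfolding convolve_def using D(1) by (intro Bochner_Integration.integral_nonneg) auto
  moreover have "convolve (\<lambda>_. D) (\<lambda>y. \<bar>v y\<bar>) x = convolve (\<lambda>_. D) (\<lambda>y. \<bar>v y\<bar>) 0" for x :: "real^'n"
    by (simp add: convolve_def)
  ultimately show ?thesis by metis
qed

text \<open>The fields \<open>v j\<close> stand for the components of Du after a cutoff; only the
  weak curl and divergence relations against kernels are retained. Since \<open>g\<close> may depend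
  on \<open>v\<close> itself, its continuity modulus is not known beforehand: boundedness of
  \<open>g\<close> first yields a Hoelder estimate for \<open>v\<close>, and the hypothesis
  \<open>lip\<close> passes it on to \<open>g\<close>. The equations are tested on radius 4R, the
  Hoelder estimate is obtained on 2R, and the conclusion on R.\<close>

lemma poisson_regularity_local:
  fixes v :: "'n::finite \<Rightarrow> real^'n \<Rightarrow> real" and g :: "real^'n \<Rightarrow> real"
  assumes R: "R > 0" and v: "\<And>j. cs_integrable (v j)" and g: "cs_integrable g" "\<And>y. \<bar>g y\<bar> \<le> \<Gamma>"
    and vc: "\<And>j. continuous_on (ball x0 (4 * R)) (v j)"
    and curl: "\<And>\<xi> i j. smooth_elem \<xi> \<Longrightarrow> test_fun (ball x0 (4 * R)) \<xi> \<Longrightarrow>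
      (LINT y|lborel. v j y * partial i \<xi> y) = (LINT y|lborel. v i y * partial j \<xi> y)"
    and div: "\<And>\<xi>. smooth_elem \<xi> \<Longrightarrow> test_fun (ball x0 (4 * R)) \<xi> \<Longrightarrow>
      (\<Sum>i\<in>UNIV. LINT y|lborel. v i y * partial i \<xi> y) = - (LINT y|lborel. g y * \<xi> y)"
    and L: "L \<ge> 0" and lip: "\<And>x y. x \<in> ball x0 (4 * R) \<Longrightarrow> y \<in> ball x0 (4 * R) \<Longrightarrow>
      \<bar>g x - g y\<bar> \<le> L * (norm (x - y) + (\<Sum>j\<in>UNIV. \<bar>v j x - v j y\<bar>))"
  shows "\<exists>Z. (\<forall>j. \<forall>x\<in>ball x0 R. (v j has_derivative (\<lambda>h. (\<chi> i. Z i j x) \<bullet> h)) (at x)) \<and>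
    (\<forall>i j. continuous_on (ball x0 R) (Z i j)) \<and> (\<forall>x\<in>ball x0 R. (\<Sum>i\<in>UNIV. Z i i x) = g x)"
proof -
  define n where "n = real CARD('n)"
  have n0: "n \<ge> 0" by (simp add: n_def)
  have \<Gamma>0: "\<Gamma> \<ge> 0" using g(2)[of 0] abs_ge_zero order_trans by blast
  have sub: "cball x t \<subseteq> ball x0 (4 * R)" if "x \<in> ball x0 (2 * R)" "t \<le> 2 * R" for x t
  proof
    fix y assume "y \<in> cball x t"
    then show "y \<in> ball x0 (4 * R)" using that dist_triangle[of x0 y x] by simp
  qed
  have vcont: "isCont (v j) x" if "x \<in> ball x0 (4 * R)" for j x
    using vc that continuous_on_eq_continuous_at open_ball by blast
  define w where "w j t x = convolve (Rho t) (v j) x" for j t x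
  define z where "z i j t x = convolve (DRho i t) (v j) x" for i j t x

  \<comment> \<open>The curl relation exchanges D_k D_k \<kappa>_t * v_j for D_k D_j \<kappa>_t *
    v_k; summed over k this is the divergence equation tested with D_j \<kappa>_t.\<close>
  have w_scale: "((\<lambda>t. w j t x) has_real_derivative t * convolve (DKap j t) g x) (at t)"
    if x: "x \<in> ball x0 (2 * R)" and t: "0 < t" "t \<le> 2 * R" for j x t
  proof -
    have "(\<Sum>k\<in>UNIV. convolve (HKap k k t) (v j) x) = convolve (DKap j t) g x"
    proof -
      have "convolve (HKap k k t) (v j) x = convolve (HKap k j t) (v k) x" for k
      proof -
        have "HKap j k t = (HKap k j t :: real^'n \<Rightarrow> real)" by (auto simp: HKap_def fun_eq_iff)
        then show ?thesis
          using curl[OF kernel_smooth_elem(3) kernel_test_fun(2)[OF t(1) sub[OF x t(2)]], of j k k]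
          by (simp add: partial_kernel convolve_def)
      qed
      then have "(\<Sum>k\<in>UNIV. convolve (HKap k k t) (v j) x) = (\<Sum>k\<in>UNIV. convolve (HKap k j t) (v k) x)" by simp
      also have "\<dots> = convolve (DKap j t) g x"
        using div[OF kernel_smooth_elem(3) kernel_test_fun(2)[OF t(1) sub[OF x t(2)]], of j]
        by (simp add: partial_kernel convolve_def sum_negf)
      finally show ?thesis .
    qed
    then show ?thesis using convolve_Rho_scale[OF v t(1), of j x] by (simp add: w_def)
  qed
  \<comment> \<open>The same exchange one derivative higher, with D_i D_j \<kappa>_t as the test
    function.\<close>
  have z_scale: "((\<lambda>t. z i j t x) has_real_derivative t * convolve (HKap i j t) g x) (at t)"
    if x: "x \<in> ball x0 (2 * R)" and t: "0 < t" "t \<le> 2 * R" for i j x t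
  proof -
    have sym: "TKap i k j t = (TKap i j k t :: real^'n \<Rightarrow> real)" for k
      by (auto simp: TKap_def fun_eq_iff)
    have "(\<Sum>k\<in>UNIV. convolve (TKap i k k t) (v j) x) = convolve (HKap i j t) g x"
    proof -
      have "convolve (TKap i k k t) (v j) x = convolve (TKap i j k t) (v k) x" for k
        using curl[OF kernel_smooth_elem(4) kernel_test_fun(3)[OF t(1) sub[OF x t(2)]], of j k i k]
        by (simp add: partial_kernel convolve_def sym)
      then have "(\<Sum>k\<in>UNIV. convolve (TKap i k k t) (v j) x) = (\<Sum>k\<in>UNIV. convolve (TKap i j k t) (v k) x)" by simp
      also have "\<dots> = convolve (HKap i j t) g x"
        using div[OF kernel_smooth_elem(4) kernel_test_fun(3)[OF t(1) sub[OF x t(2)]], of i j]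
        by (simp add: partial_kernel convolve_def sum_negf)
      finally show ?thesis .
    qed
    then show ?thesis using convolve_DRho_scale[OF v t(1), of i j x] by (simp add: z_def)
  qed
  \<comment> \<open>Since t |D\<kappa>_t| \<le> \<rho>_t, the scale derivative is at most \<Gamma>.
    The limit so obtained equals the value of \<open>v j\<close> because mollifications converge at
    points of continuity.\<close>
  have w_limit: "\<bar>w j t x - v j x\<bar> \<le> \<Gamma> * t"
    if x: "x \<in> ball x0 (2 * R)" and t: "0 < t" "t \<le> 2 * R" for j x t
  proof -
    have "\<exists>l. \<forall>t. 0 < t \<longrightarrow> t \<le> 2 * R \<longrightarrow> \<bar>w j t x - l\<bar> \<le> \<Gamma> * t"
    proof (rule limit_at_zero_of_derivative_bound[of _ "\<lambda>t. w j t x" "\<lambda>t. t * convolve (DKap j t) g x" "\<lambda>t. \<Gamma> * t" "\<lambda>_. \<Gamma>"])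
      fix s :: real assume s: "0 < s" "s \<le> 2 * R"
      show "((\<lambda>t. w j t x) has_real_derivative s * convolve (DKap j s) g x) (at s)" by (rule w_scale[OF x s])
      show "\<bar>s * convolve (DKap j s) g x\<bar> \<le> \<Gamma>"
      proof -
        have "\<bar>convolve (DKap j s) g x\<bar> \<le> convolve (\<lambda>z. Rho s z / s) (\<lambda>_. \<Gamma>) x"
        proof (rule abs_convolve_le)
          show "integrable lborel (\<lambda>y. \<Gamma> * (Rho s (x - y) / s))"
            using integrable_Rho[OF s(1), of x] by simp
          show "\<bar>g y * DKap j s (x - y)\<bar> \<le> \<Gamma> * (Rho s (x - y) / s)" for y
            unfolding abs_mult by (rule mult_mono[OF g(2) DKap_le_Rho[OF s(1)] \<Gamma>0]) simp
        qed
        also have "\<dots> = \<Gamma> / s" unfolding convolve_def using integral_Rho[OF s(1), of x] by simp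
        finally show ?thesis using s(1) by (simp add: abs_mult pos_le_divide_eq mult.commute)
      qed
    qed (use R in \<open>auto intro!: derivative_eq_intros tendsto_eq_intros\<close>)
    then obtain l where l: "\<And>t. 0 < t \<Longrightarrow> t \<le> 2 * R \<Longrightarrow> \<bar>w j t x - l\<bar> \<le> \<Gamma> * t" by blast
    define \<sigma> where "\<sigma> k = (2 * R) * inverse (real (Suc k))" for k
    have \<sigma>: "0 < \<sigma> k" "\<sigma> k \<le> 2 * R" for k using R by (auto simp: \<sigma>_def divide_simps)
    have \<sigma>0: "\<sigma> \<longlonglongrightarrow> 0"
      unfolding \<sigma>_def[abs_def] by (rule tendsto_mult_right_zero[OF LIMSEQ_inverse_real_of_nat])
    have "(\<lambda>k. w j (\<sigma> k) x) \<longlonglongrightarrow> l"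
    proof (rule LIM_zero_cancel, rule Lim_null_comparison)
      show "(\<lambda>k. \<Gamma> * \<sigma> k) \<longlonglongrightarrow> 0" using \<sigma>0 by (rule tendsto_mult_right_zero)
      show "\<forall>\<^sub>F k in sequentially. norm (w j (\<sigma> k) x - l) \<le> \<Gamma> * \<sigma> k" using l \<sigma> by auto
    qed
    moreover have "(\<lambda>k. w j (\<sigma> k) x) \<longlonglongrightarrow> v j x"
      unfolding w_def by (rule convolve_Rho_tendsto[OF v vcont \<sigma>(1) \<sigma>0]) (use x R in auto)
    ultimately have "l = v j x" by (rule LIMSEQ_unique)
    then show ?thesis using l t by blast
  qed

  obtain C where C: "C \<ge> 0" "\<And>u (x::real^'n) t c \<omega> i j. cs_integrable u \<Longrightarrow> t > 0 \<Longrightarrow> (\<And>y. y\<in>cball x t \<Longrightarrow> \<bar>u y - c\<bar> \<le> \<omega>) \<Longrightarrow>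
     \<bar>convolve (HKap i j t) u x\<bar> \<le> C * \<omega> / t^2"
    using convolve_HKap_bound[where 'n='n] by (metis (no_types, lifting))
  \<comment> \<open>From C \<Gamma> / s = C \<Gamma> sqrt s / (s sqrt s): the factor sqrt(2R) bounds
    sqrt s and replaces the logarithmic primitive by a power.\<close>
  define a where "a = C * \<Gamma> * sqrt (2 * R)"
  have a0: "a \<ge> 0" using C \<Gamma>0 R by (simp add: a_def)
  obtain Z0 where Z0: "\<And>i j. Z0 i j \<ge> 0" "\<And>i j x. \<bar>z i j (2 * R) x\<bar> \<le> Z0 i j"
  proof -
    have "\<forall>i j. \<exists>Z\<ge>0. \<forall>x. \<bar>z i j (2 * R) x\<bar> \<le> Z"
      unfolding z_def using convolve_DRho_bounded[OF v, of "2 * R"] R by simp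
    then show ?thesis using that by metis
  qed
  \<comment> \<open>Summing over all index pairs gives one bound valid for every component.\<close>
  define Z1 where "Z1 = (\<Sum>i\<in>UNIV. \<Sum>j\<in>UNIV. Z0 i j)"
  have Z1: "Z0 i j \<le> Z1" for i j
  proof -
    have "Z0 i j \<le> (\<Sum>j\<in>UNIV. Z0 i j)" using Z0 by (intro member_le_sum) auto
    also have "\<dots> \<le> Z1" unfolding Z1_def using Z0 by (intro member_le_sum) (auto intro: sum_nonneg)
    finally show ?thesis .
  qed
  have Z10: "Z1 \<ge> 0" using Z0(1) Z1 order_trans by blast
  \<comment> \<open>The value at scale 2R is absorbed through 1 \<le> sqrt(2R)/sqrt t; 2a/sqrt t is
    the contribution of the primitive of a t^(-3/2).\<close>
  define A where "A = Z1 * sqrt (2 * R) + 2 * a"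
  have A0: "A \<ge> 0" using Z10 a0 R by (simp add: A_def)
  have dsqrt: "((\<lambda>t. - (2 * a / sqrt t)) has_real_derivative a / (t * sqrt t)) (at t)" if "t > 0" for t a
  proof -
    have "((\<lambda>t. - (2 * a / sqrt t)) has_real_derivative - (- (2 * a * (inverse (sqrt t) / 2)) / (sqrt t * sqrt t))) (at t)"
      using that by (auto intro!: derivative_eq_intros)
    moreover have "- (- (2 * a * (inverse (sqrt t) / 2)) / (sqrt t * sqrt t)) = a / (t * sqrt t)"
      using that by (simp add: divide_simps)
    ultimately show ?thesis by simp
  qed
  have z_bound: "\<bar>z i j t x\<bar> \<le> A / sqrt t"
    if x: "x \<in> ball x0 (2 * R)" and t: "0 < t" "t \<le> 2 * R" for i j x t
  proof -
    have "\<bar>z i j (2 * R) x - z i j t x\<bar> \<le> - (2 * a / sqrt (2 * R)) - (- (2 * a / sqrt t))"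
    proof (rule difference_le_of_derivative_bound[OF t(2), where f = "\<lambda>t. z i j t x" 
         and f' = "\<lambda>t. t * convolve (HKap i j t) g x" and G' = "\<lambda>t. a / (t * sqrt t)"])
      fix s assume s: "t \<le> s" "s \<le> 2 * R"
      then have s0: "s > 0" using t by simp
      show "((\<lambda>t. z i j t x) has_real_derivative s * convolve (HKap i j s) g x) (at s)" by (rule z_scale[OF x s0 s(2)])
      show "((\<lambda>t. - (2 * a / sqrt t)) has_real_derivative a / (s * sqrt s)) (at s)" by (rule dsqrt[OF s0])
      have "\<bar>convolve (HKap i j s) g x\<bar> \<le> C * \<Gamma> / s^2"
        by (rule C(2)[OF g(1) s0, where c = 0]) (simp add: g)
      then have "s * \<bar>convolve (HKap i j s) g x\<bar> \<le> s * (C * \<Gamma> / s^2)" using s0 by (intro mult_left_mono) auto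
      also have "\<dots> = C * \<Gamma> * sqrt s / (s * sqrt s)" using s0 by (simp add: power2_eq_square)
      also have "\<dots> \<le> a / (s * sqrt s)"
        unfolding a_def using s s0 C(1) \<Gamma>0 by (intro divide_right_mono mult_left_mono) auto
      finally show "\<bar>s * convolve (HKap i j s) g x\<bar> \<le> a / (s * sqrt s)" using s0 by (simp add: abs_mult)
    qed
    moreover have "2 * a / sqrt (2 * R) \<ge> 0" using a0 R by simp
    moreover have "\<bar>z i j (2 * R) x\<bar> \<le> Z1" using Z0(2) Z1 order_trans by blast
    ultimately have "\<bar>z i j t x\<bar> \<le> Z1 + 2 * a / sqrt t" by linarith
    moreover have "Z1 \<le> Z1 * sqrt (2 * R) / sqrt t"
    proof -
      have "Z1 * sqrt t \<le> Z1 * sqrt (2 * R)" using Z10 t by (intro mult_left_mono) auto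
      then show ?thesis using t by (simp add: pos_le_divide_eq)
    qed
    ultimately show ?thesis by (simp add: A_def add_divide_distrib)
  qed

  \<comment> \<open>Two approximation errors \<Gamma> t with t \<le> sqrt(2R) sqrt t, and the
    gradient bound n A / sqrt t times the distance t.\<close>
  define A2 where "A2 = 2 * \<Gamma> * sqrt (2 * R) + n * A"
  have A20: "A2 \<ge> 0" using \<Gamma>0 R A0 n0 by (simp add: A2_def)
  have v_holder: "\<bar>v j x - v j y\<bar> \<le> A2 * sqrt (norm (x - y))"
    if x: "x \<in> ball x0 (2 * R)" and y: "y \<in> ball x0 (2 * R)" and xy: "norm (x - y) \<le> 2 * R" for j x y
  proof (cases "x = y")
    case False
    \<comment> \<open>The mollification scale equals the distance of the two points: the
      approximation error grows with t and the gradient bound with 1/sqrt t, and at this scale both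
      terms are O(sqrt t).\<close>
    define t where "t = norm (x - y)"
    have t: "0 < t" "t \<le> 2 * R" using False xy by (auto simp: t_def)
    have "norm (w j t x - w j t y) \<le> (n * (A / sqrt t)) * norm (x - y)"
    proof (rule differentiable_bound[of "ball x0 (2 * R)" "\<lambda>x. w j t x" "\<lambda>x h. (\<chi> i. z i j t x) \<bullet> h"])
      fix u assume u: "u \<in> ball x0 (2 * R)"
      have "(convolve (Rho t) (v j) has_derivative (\<lambda>h. (\<chi> i. z i j t u) \<bullet> h)) (at u)"
        unfolding z_def by (rule convolve_Rho_has_derivative[OF v t(1)])
      then show "((\<lambda>x. w j t x) has_derivative (\<lambda>h. (\<chi> i. z i j t u) \<bullet> h)) (at u within ball x0 (2 * R))"
        unfolding w_def by (rule has_derivative_at_withinI)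
      have "norm (\<chi> i. z i j t u) \<le> (\<Sum>i\<in>UNIV. \<bar>(\<chi> i. z i j t u) $ i\<bar>)" by (rule norm_le_l1_cart)
      also have "\<dots> \<le> (\<Sum>i\<in>(UNIV::'n set). A / sqrt t)" using z_bound[OF u t] by (intro sum_mono) simp
      finally have nb: "norm (\<chi> i. z i j t u) \<le> n * (A / sqrt t)" by (simp add: n_def)
      show "onorm (\<lambda>h. (\<chi> i. z i j t u) \<bullet> h) \<le> n * (A / sqrt t)"
      proof (rule onorm_bound)
        show "0 \<le> n * (A / sqrt t)" using n0 A0 t by simp
        show "norm ((\<chi> i. z i j t u) \<bullet> h) \<le> n * (A / sqrt t) * norm h" for h
          using Cauchy_Schwarz_ineq2[of "\<chi> i. z i j t u" h] mult_right_mono[OF nb norm_ge_zero[of h]] by simp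
      qed
    qed (use x y in auto)
    also have "(n * (A / sqrt t)) * norm (x - y) = n * A * (t / sqrt t)" by (simp add: t_def)
    also have "t / sqrt t = sqrt t" using t(1) by (simp add: real_div_sqrt)
    finally have 1: "\<bar>w j t x - w j t y\<bar> \<le> n * A * sqrt t" by simp
    have "\<Gamma> * t = \<Gamma> * (sqrt t * sqrt t)" using t(1) by simp
    also have "\<dots> \<le> \<Gamma> * (sqrt (2 * R) * sqrt t)"
      using t \<Gamma>0 by (intro mult_left_mono mult_right_mono) auto
    finally have 2: "\<Gamma> * t \<le> \<Gamma> * sqrt (2 * R) * sqrt t" by (simp add: mult.assoc)
    have "\<bar>v j x - v j y\<bar> \<le> 2 * (\<Gamma> * t) + n * A * sqrt t"
      using w_limit[OF x t, of j] w_limit[OF y t, of j] 1 by linarith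
    also have "\<dots> \<le> A2 * sqrt t" using 2 by (simp add: A2_def algebra_simps)
    finally show ?thesis by (simp add: t_def)
  qed simp
  define A3 where "A3 = L * (sqrt (2 * R) + n * A2)"
  have A30: "A3 \<ge> 0" using L R n0 A20 by (simp add: A3_def)
  have g_holder: "\<bar>g y - g x\<bar> \<le> A3 * sqrt t"
    if x: "x \<in> ball x0 R" and t: "0 < t" "t \<le> R" and y: "y \<in> cball x t" for x y t
  proof -
    have x2: "x \<in> ball x0 (2 * R)" "y \<in> ball x0 (2 * R)"
      using x y t dist_triangle[of x0 y x] by auto
    define s where "s = norm (y - x)"
    have s: "0 \<le> s" "s \<le> t" "s \<le> 2 * R" using y t by (auto simp: s_def dist_norm norm_minus_commute)
    have "s = sqrt s * sqrt s" using s by simp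
    also have "\<dots> \<le> sqrt (2 * R) * sqrt s" using s by (intro mult_right_mono) auto
    finally have 1: "s \<le> sqrt (2 * R) * sqrt s" .
    have "(\<Sum>j\<in>UNIV. \<bar>v j y - v j x\<bar>) \<le> (\<Sum>j\<in>(UNIV::'n set). A2 * sqrt s)"
      using v_holder[OF x2(2,1)] s by (intro sum_mono) (simp add: s_def)
    then have 2: "(\<Sum>j\<in>UNIV. \<bar>v j y - v j x\<bar>) \<le> n * (A2 * sqrt s)" by (simp add: n_def)
    have "\<bar>g y - g x\<bar> \<le> L * (s + (\<Sum>j\<in>UNIV. \<bar>v j y - v j x\<bar>))"
      unfolding s_def by (rule lip) (use x2 R in auto)
    also have "\<dots> \<le> L * (sqrt (2 * R) * sqrt s + n * (A2 * sqrt s))"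
      using 1 2 L by (intro mult_left_mono add_mono) auto
    also have "\<dots> = A3 * sqrt s" by (simp add: A3_def algebra_simps)
    also have "\<dots> \<le> A3 * sqrt t" using s A30 by (intro mult_left_mono) auto
    finally show ?thesis .
  qed
  \<comment> \<open>The primitive of C A3 / sqrt t vanishing at 0 is 2 C A3 sqrt t. The oscillation
    of \<open>g\<close> has improved the scale derivative of \<open>z\<close> from 1/t to this
    integrable rate.\<close>
  define E where "E = 2 * (C * A3)"
  have z_limit: "\<exists>l. \<forall>t. 0 < t \<longrightarrow> t \<le> R \<longrightarrow> \<bar>z i j t x - l\<bar> \<le> E * sqrt t" if x: "x \<in> ball x0 R" for i j x
  proof (rule limit_at_zero_of_derivative_bound[OF R, of "\<lambda>t. z i j t x" "\<lambda>t. t * convolve (HKap i j t) g x" 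
        "\<lambda>t. E * sqrt t" "\<lambda>t. C * A3 / sqrt t"])
    fix s :: real assume s: "0 < s" "s \<le> R"
    show "((\<lambda>t. z i j t x) has_real_derivative s * convolve (HKap i j s) g x) (at s)"
      by (rule z_scale) (use x R s in auto)
    show "((\<lambda>t. E * sqrt t) has_real_derivative C * A3 / sqrt s) (at s)"
      using s by (auto intro!: derivative_eq_intros simp: E_def divide_simps)
    have "\<bar>convolve (HKap i j s) g x\<bar> \<le> C * (A3 * sqrt s) / s^2"
      by (rule C(2)[OF g(1) s(1), where c = "g x"]) (rule g_holder[OF x s])
    then have "s * \<bar>convolve (HKap i j s) g x\<bar> \<le> s * (C * (A3 * sqrt s) / s^2)" using s by (intro mult_left_mono) auto
    also have "\<dots> = C * A3 * (sqrt s / s)" using s by (simp add: power2_eq_square)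
    also have "sqrt s / s = 1 / sqrt s" using s by (simp add: sqrt_divide_self_eq inverse_eq_divide)
    finally show "\<bar>s * convolve (HKap i j s) g x\<bar> \<le> C * A3 / sqrt s" using s by (simp add: abs_mult)
  next
    have "((\<lambda>t. E * sqrt t) \<longlongrightarrow> E * sqrt 0) (at_right 0)" by (intro tendsto_intros)
    then show "((\<lambda>t. E * sqrt t) \<longlongrightarrow> 0) (at_right 0)" by simp
  qed
  define Z where "Z i j x = (SOME l. \<forall>t. 0 < t \<longrightarrow> t \<le> R \<longrightarrow> \<bar>z i j t x - l\<bar> \<le> E * sqrt t)" for i j x
  have Z: "\<bar>z i j t x - Z i j x\<bar> \<le> E * sqrt t" if "x \<in> ball x0 R" "0 < t" "t \<le> R" for i j x t
    using someI_ex[OF z_limit[OF that(1), of i j]] that(2,3) unfolding Z_def by blast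
  define \<tau> where "\<tau> k = R * inverse (real (Suc k))" for k
  have \<tau>: "0 < \<tau> k" "\<tau> k \<le> R" for k using R by (auto simp: \<tau>_def divide_simps)
  have \<tau>0: "\<tau> \<longlonglongrightarrow> 0"
    unfolding \<tau>_def[abs_def] by (rule tendsto_mult_right_zero[OF LIMSEQ_inverse_real_of_nat])
  have E\<tau>: "(\<lambda>k. E * sqrt (\<tau> k)) \<longlonglongrightarrow> 0"
    using tendsto_mult_right_zero[OF tendsto_real_sqrt[OF \<tau>0, simplified]] by simp
  have unif: "\<forall>\<^sub>F k in sequentially. \<forall>x\<in>ball x0 R. \<bar>z i j (\<tau> k) x - Z i j x\<bar> \<le> \<epsilon>" if "\<epsilon> > 0" for i j \<epsilon>
    using order_tendstoD(2)[OF E\<tau> that]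
  proof eventually_elim
    case (elim k)
    then show ?case using Z[OF _ \<tau>, of _ i j k] by (meson less_imp_le order_trans)
  qed
  have limw: "(\<lambda>k. w j (\<tau> k) x) \<longlonglongrightarrow> v j x" if "x \<in> ball x0 R" for j x
    unfolding w_def by (rule convolve_Rho_tendsto[OF v vcont \<tau>(1) \<tau>0]) (use that R in auto)
  have "(v j has_derivative (\<lambda>h. (\<chi> i. Z i j x) \<bullet> h)) (at x)" if x: "x \<in> ball x0 R" for j x
  proof (rule has_derivative_limit[where f = "\<lambda>k. w j (\<tau> k)" and g = "\<lambda>k x. \<chi> i. z i j (\<tau> k) x" 
      and G = "\<lambda>x. \<chi> i. Z i j x", OF _ _ limw x])
    show "(w j (\<tau> k) has_derivative (\<bullet>) (\<chi> i. z i j (\<tau> k) x)) (at x)" for k x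
      unfolding w_def[abs_def] z_def by (rule convolve_Rho_has_derivative[OF v \<tau>(1)])
    show "\<forall>\<^sub>F k in sequentially. \<forall>x\<in>ball x0 R. \<bar>(\<chi> i. z i j (\<tau> k) x) $ i - (\<chi> i. Z i j x) $ i\<bar> \<le> \<epsilon>"
      if "\<epsilon> > 0" for i \<epsilon> using unif[OF that, of i j] by simp
  qed
  moreover have "continuous_on (ball x0 R) (Z i j)" for i j
  proof (rule uniform_limit_theorem[where f = "\<lambda>k. z i j (\<tau> k)"])
    show "\<forall>\<^sub>F k in sequentially. continuous_on (ball x0 R) (z i j (\<tau> k))"
      unfolding z_def[abs_def]
      by (intro always_eventually allI continuous_on_subset[OF continuous_on_convolve_DRho[OF v \<tau>(1)]]) simp
    show "uniform_limit (ball x0 R) (\<lambda>k. z i j (\<tau> k)) (Z i j) sequentially"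
      unfolding uniform_limit_iff
    proof (intro allI impI)
      fix e :: real assume "e > 0"
      then have "e / 2 > 0" by simp
      from unif[OF this, of i j] show "\<forall>\<^sub>F k in sequentially. \<forall>x\<in>ball x0 R. dist (z i j (\<tau> k) x) (Z i j x) < e"
        by eventually_elim (use \<open>e > 0\<close> in \<open>force simp: dist_real_def\<close>)
    qed
  qed simp
  moreover have "(\<Sum>i\<in>UNIV. Z i i x) = g x" if x: "x \<in> ball x0 R" for x
  proof -
    have x4: "x \<in> ball x0 (4 * R)" "x \<in> ball x0 (2 * R)" using x R by auto
    have gc: "isCont g x"
    proof -
      have "(\<lambda>y. L * (norm (y - x) + (\<Sum>j\<in>UNIV. \<bar>v j y - v j x\<bar>))) \<midarrow>x\<rightarrow> L * (norm (x - x) + (\<Sum>j\<in>UNIV. \<bar>v j x - v j x\<bar>))"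
        by (intro tendsto_intros isContD[OF vcont[OF x4(1)]])
      then have 0: "(\<lambda>y. L * (norm (y - x) + (\<Sum>j\<in>UNIV. \<bar>v j y - v j x\<bar>))) \<midarrow>x\<rightarrow> 0" by simp
      have "(\<lambda>y. g y - g x) \<midarrow>x\<rightarrow> 0"
      proof (rule Lim_null_comparison[OF _ 0])
        have "\<forall>\<^sub>F y in at x. y \<in> ball x0 (4 * R)"
          by (rule eventually_at_in_open'[OF open_ball x4(1)])
        then show "\<forall>\<^sub>F y in at x. norm (g y - g x) \<le> L * (norm (y - x) + (\<Sum>j\<in>UNIV. \<bar>v j y - v j x\<bar>))"
          by eventually_elim (use lip x4(1) in auto)
      qed
      then show ?thesis unfolding isCont_def by (rule LIM_zero_cancel)
    qed
    \<comment> \<open>The divergence equation tested with the mollifier: the trace of the smoothed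
      second derivatives is \<rho>_t * g, whose limit is g by continuity.\<close>
    have tr: "(\<Sum>i\<in>UNIV. z i i t x) = convolve (Rho t) g x" if t: "0 < t" "t \<le> 2 * R" for t
      using div[OF kernel_smooth_elem(2) kernel_test_fun(1)[OF t(1) sub[OF x4(2) t(2)]]]
      by (simp add: partial_kernel convolve_def z_def sum_negf)
    have "(\<lambda>k. \<Sum>i\<in>UNIV. z i i (\<tau> k) x) \<longlonglongrightarrow> (\<Sum>i\<in>UNIV. Z i i x)"
    proof (intro tendsto_sum)
      fix i
      show "(\<lambda>k. z i i (\<tau> k) x) \<longlonglongrightarrow> Z i i x"
        by (rule LIM_zero_cancel, rule Lim_null_comparison[OF _ E\<tau>]) (use Z[OF x \<tau>] in auto)
    qed
    moreover have "(\<Sum>i\<in>UNIV. z i i (\<tau> k) x) = convolve (Rho (\<tau> k)) g x" for k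
      using tr[OF \<tau>(1), of k] \<tau>(2)[of k] R by simp
    moreover have "(\<lambda>k. convolve (Rho (\<tau> k)) g x) \<longlonglongrightarrow> g x"
      by (rule convolve_Rho_tendsto[OF g(1) gc \<tau>(1) \<tau>0])
    ultimately show ?thesis using LIMSEQ_unique by simp
  qed
  ultimately show ?thesis by blast
qed

text \<open>The hypothesis on \<open>G\<close> allows it to depend on Du in a Lipschitz way, as
  H(Du) does, without any modulus of continuity for Du being known. Near each point the gradient and
  \<open>G\<close> are truncated to a closed ball, so that they can be convolved.\<close>

lemma poisson_regularity:
  fixes u :: "real^'n::finite \<Rightarrow> real"
  assumes \<Omega>: "open \<Omega>" and u: "C1_on \<Omega> u" and G: "continuous_on \<Omega> G"
    and weak: "\<And>\<xi>. test_fun \<Omega> \<xi> \<Longrightarrow> (LINT x:\<Omega>|lborel. grad u x \<bullet> grad \<xi> x) = - (LINT x:\<Omega>|lborel. G x * \<xi> x)"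
    and lip: "\<And>x0. x0 \<in> \<Omega> \<Longrightarrow> \<exists>r>0. \<exists>L\<ge>0. \<forall>x\<in>ball x0 r. \<forall>y\<in>ball x0 r.
       \<bar>G x - G y\<bar> \<le> L * (norm (x - y) + norm (grad u x - grad u y))"
  shows "C2_on \<Omega> u" and "x \<in> \<Omega> \<Longrightarrow> laplacian u x = G x"
proof -
  define P where "P x0 R Z \<longleftrightarrow> (\<forall>j. \<forall>x\<in>ball x0 R. (partial j u has_derivative (\<lambda>h. (\<chi> i. Z i j x) \<bullet> h)) (at x)) \<and>
      (\<forall>i j. continuous_on (ball x0 R) (Z i j)) \<and> (\<forall>x\<in>ball x0 R. (\<Sum>i\<in>UNIV. Z i i x) = G x)" for x0 R Z
  have loc: "\<exists>R>0. \<exists>Z. P x0 R Z"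
    if x0: "x0 \<in> \<Omega>" for x0
  proof -
    obtain e where e: "e > 0" "cball x0 e \<subseteq> \<Omega>" using \<Omega> x0 open_contains_cball by blast
    obtain r L where r: "r > 0" "L \<ge> 0" "\<And>x y. x\<in>ball x0 r \<Longrightarrow> y\<in>ball x0 r \<Longrightarrow>
       \<bar>G x - G y\<bar> \<le> L * (norm (x - y) + norm (grad u x - grad u y))" using lip[OF x0] by blast
    define R where "R = min e r / 4"
    have R: "R > 0" "4 * R \<le> e" "4 * R \<le> r" using e r by (auto simp: R_def)
    define K where "K = cball x0 (4 * R)"
    have K: "compact K" "K \<subseteq> \<Omega>" using R(2) e(2) by (auto simp: K_def)
    have BK: "ball x0 (4 * R) \<subseteq> K" by (auto simp: K_def)
    define v where "v j x = indicator K x * partial j u x" for j x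
    define g where "g x = indicator K x * G x" for x
    have cp: "continuous_on K (partial j u)" for j
      using u K(2) continuous_on_subset unfolding C1_on_def by blast
    have cG: "continuous_on K G" using G K(2) continuous_on_subset by blast
    have v_int: "cs_integrable (v j)" for j unfolding v_def[abs_def]
      using borel_integrable_compact[OF K(1) cp] by (intro cs_integrableI_indicator K(1)) (simp add: set_integrable_def)
    have cg: "cs_integrable g" unfolding g_def[abs_def]
      using borel_integrable_compact[OF K(1) cG] by (intro cs_integrableI_indicator K(1)) (simp add: set_integrable_def)
    obtain \<Gamma> where \<Gamma>: "\<And>x. x \<in> K \<Longrightarrow> \<bar>G x\<bar> \<le> \<Gamma>"
      using compact_imp_bounded[OF compact_continuous_image[OF cG K(1)]] by (metis bounded_real imageI)
    have transfer: "(LINT y:\<Omega>|lborel. f y * \<eta> y) = (LINT y|lborel. (indicator K y * f y) * \<eta> y)"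
      if "\<And>y. y \<notin> K \<Longrightarrow> \<eta> y = 0" for f \<eta> :: "real^'n \<Rightarrow> real"
      unfolding set_lebesgue_integral_def
    proof (rule Bochner_Integration.integral_cong)
      fix y show "indicator \<Omega> y *\<^sub>R (f y * \<eta> y) = (indicator K y * f y) * \<eta> y"
        using that[of y] K(2) by (cases "y \<in> K") (auto simp: indicator_def)
    qed simp
    have tst: "(\<forall>y. y \<notin> K \<longrightarrow> \<xi> y = 0) \<and> (\<forall>i y. y \<notin> K \<longrightarrow> partial i \<xi> y = 0) \<and> test_fun \<Omega> \<xi>"
      if \<xi>: "test_fun (ball x0 (4 * R)) \<xi>" for \<xi>
    proof -
      obtain K' where K': "compact K'" "K' \<subseteq> ball x0 (4 * R)" "\<And>x. x \<notin> K' \<Longrightarrow> \<xi> x = 0"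
        by (rule test_fun_support[OF \<xi>], rule that)
      have "partial i \<xi> x = 0" if "x \<notin> K'" for x i
        using partial_zero_outside[OF open_UNIV K'(1), of \<xi> x i] K'(3) that by blast
      moreover have "test_fun \<Omega> \<xi>" using \<xi> BK K(2) unfolding test_fun_def by blast
      ultimately show ?thesis using K' BK by blast
    qed
    have "\<exists>Z. (\<forall>j. \<forall>x\<in>ball x0 R. (v j has_derivative (\<lambda>h. (\<chi> i. Z i j x) \<bullet> h)) (at x)) \<and>
      (\<forall>i j. continuous_on (ball x0 R) (Z i j)) \<and> (\<forall>x\<in>ball x0 R. (\<Sum>i\<in>UNIV. Z i i x) = g x)"
    proof (rule poisson_regularity_local[OF R(1) v_int cg, where \<Gamma> = "max 0 \<Gamma>" and L = L])
      show "\<bar>g y\<bar> \<le> max 0 \<Gamma>" for y using \<Gamma>[of y] by (cases "y \<in> K") (auto simp: g_def max.coboundedI2)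
      show "continuous_on (ball x0 (4 * R)) (v j)" for j
        by (rule continuous_on_eq[OF continuous_on_subset[OF cp BK]]) (use BK in \<open>auto simp: v_def\<close>)
      show "(LINT y|lborel. v j y * partial i \<xi> y) = (LINT y|lborel. v i y * partial j \<xi> y)"
        if smooth_elem: "smooth_elem \<xi>" and \<xi>: "test_fun (ball x0 (4 * R)) \<xi>" for \<xi> i j
      proof -
        note t = tst[OF \<xi>]
        \<comment> \<open>Moving the derivative from u onto the test function leaves -\<integral>u
          D_j D_i \<xi>, which is symmetric in i and j.\<close>
        have *: "(LINT y|lborel. v j y * partial i \<xi> y) = - (LINT y:\<Omega>|lborel. u y * partial j (partial i \<xi>) y)" for i j
        proof -
          have "(LINT y:\<Omega>|lborel. u y * partial j (partial i \<xi>) y) = - (LINT y:\<Omega>|lborel. partial j u y * partial i \<xi> y)"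
            by (rule integration_by_parts[OF \<Omega> u smooth_elem_C1_on[OF smooth_elem_partial[OF smooth_elem]] K]) (use t in auto)
          also have "(LINT y:\<Omega>|lborel. partial j u y * partial i \<xi> y) = (LINT y|lborel. v j y * partial i \<xi> y)"
            unfolding v_def by (rule transfer) (use t in auto)
          finally show ?thesis by simp
        qed
        show ?thesis unfolding * by (simp add: smooth_elem_partial_commute[OF smooth_elem, of i j])
      qed
      show "(\<Sum>i\<in>UNIV. LINT y|lborel. v i y * partial i \<xi> y) = - (LINT y|lborel. g y * \<xi> y)"
        if smooth_elem: "smooth_elem \<xi>" and \<xi>: "test_fun (ball x0 (4 * R)) \<xi>" for \<xi>
      proof -
        note t = tst[OF \<xi>]
        have si: "set_integrable lborel \<Omega> (\<lambda>y. partial i u y * partial i \<xi> y)" for i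
          using u smooth_elem_continuous_on[OF smooth_elem_partial[OF smooth_elem]] t
          by (intro set_integrable_continuous_compact_support[OF \<Omega> K]) (auto simp: C1_on_def intro!: continuous_on_mult)
        have "(\<Sum>i\<in>UNIV. LINT y|lborel. v i y * partial i \<xi> y) = (\<Sum>i\<in>UNIV. LINT y:\<Omega>|lborel. partial i u y * partial i \<xi> y)"
          unfolding v_def using t by (intro sum.cong transfer[symmetric]) auto
        also have "\<dots> = (LINT y:\<Omega>|lborel. (\<Sum>i\<in>UNIV. partial i u y * partial i \<xi> y))"
          by (rule set_integral_sum_finite[symmetric]) (rule si)
        also have "\<dots> = (LINT y:\<Omega>|lborel. grad u y \<bullet> grad \<xi> y)" by (simp add: inner_vec_def)
        also have "\<dots> = - (LINT y:\<Omega>|lborel. G y * \<xi> y)" by (rule weak) (use t in blast)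
        also have "(LINT y:\<Omega>|lborel. G y * \<xi> y) = (LINT y|lborel. g y * \<xi> y)"
          unfolding g_def by (rule transfer) (use t in auto)
        finally show ?thesis .
      qed
      show "L \<ge> 0" by (rule r(2))
      fix x y assume xy: "x \<in> ball x0 (4 * R)" "y \<in> ball x0 (4 * R)"
      then have k: "x \<in> K" "y \<in> K" "x \<in> ball x0 r" "y \<in> ball x0 r" using BK R(3) by auto
      have "\<bar>G x - G y\<bar> \<le> L * (norm (x - y) + norm (grad u x - grad u y))" by (rule r(3)[OF k(3,4)])
      also have "\<dots> \<le> L * (norm (x - y) + (\<Sum>j\<in>UNIV. \<bar>(grad u x - grad u y) $ j\<bar>))"
        by (intro mult_left_mono[OF _ r(2)] add_left_mono norm_le_l1_cart)
      finally show "\<bar>g x - g y\<bar> \<le> L * (norm (x - y) + (\<Sum>j\<in>UNIV. \<bar>v j x - v j y\<bar>))"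
        using k by (simp add: g_def v_def)
    qed
    then obtain Z where Z: "\<And>j x. x\<in>ball x0 R \<Longrightarrow> (v j has_derivative (\<lambda>h. (\<chi> i. Z i j x) \<bullet> h)) (at x)"
      "\<And>i j. continuous_on (ball x0 R) (Z i j)" "\<And>x. x\<in>ball x0 R \<Longrightarrow> (\<Sum>i\<in>UNIV. Z i i x) = g x" by blast
    have RK: "ball x0 R \<subseteq> K" using R(1) by (auto simp: K_def)
    have "(partial j u has_derivative (\<lambda>h. (\<chi> i. Z i j x) \<bullet> h)) (at x)" if "x \<in> ball x0 R" for j x
      by (rule has_derivative_transform_within_open[OF Z(1)[OF that] open_ball that]) (use RK in \<open>auto simp: v_def\<close>)
    moreover have "(\<Sum>i\<in>UNIV. Z i i x) = G x" if "x \<in> ball x0 R" for x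
      using Z(3)[OF that] RK that by (auto simp: g_def)
    ultimately have "P x0 R Z" using Z(2) by (simp add: P_def)
    then show ?thesis using R(1) by blast
  qed
  have C1: "C1_on \<Omega> (partial j u)" for j
    unfolding C1_on_def
  proof (intro conjI ballI allI)
    show "partial j u differentiable (at x)" if x: "x \<in> \<Omega>" for x
    proof -
      obtain R Z where "R > 0" "P x R Z" using loc[OF x] by blast
      then have "(partial j u has_derivative (\<lambda>h. (\<chi> i. Z i j x) \<bullet> h)) (at x)" by (simp add: P_def)
      then show ?thesis by (auto simp: differentiable_def)
    qed
    show "continuous_on \<Omega> (partial i (partial j u))" for i
    proof (rule continuous_at_imp_continuous_on, rule ballI)
      fix x0 assume "x0 \<in> \<Omega>"
      then obtain R Z where Z0: "R > 0" "P x0 R Z" using loc by blast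
      then have Z: "R > 0" "\<And>j x. x\<in>ball x0 R \<Longrightarrow> (partial j u has_derivative (\<lambda>h. (\<chi> i. Z i j x) \<bullet> h)) (at x)"
        "\<And>i j. continuous_on (ball x0 R) (Z i j)" by (simp_all add: P_def)
      have "continuous_on (ball x0 R) (partial i (partial j u))"
        by (rule continuous_on_eq[OF Z(3)[of i j]]) (simp add: partial_eqI_grad[OF Z(2)])
      then show "isCont (partial i (partial j u)) x0"
        using Z(1) continuous_on_eq_continuous_at[OF open_ball] centre_in_ball by blast
    qed
  qed
  then show "C2_on \<Omega> u" using u by (simp add: C2_on_def)
  show "laplacian u x = G x" if x: "x \<in> \<Omega>" for x
  proof -
    obtain R Z where Z0: "R > 0" "P x R Z" using loc[OF x] by blast
    then have Z: "R > 0" "\<And>j y. y\<in>ball x R \<Longrightarrow> (partial j u has_derivative (\<lambda>h. (\<chi> i. Z i j y) \<bullet> h)) (at y)"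
        "\<And>y. y \<in> ball x R \<Longrightarrow> (\<Sum>i\<in>UNIV. Z i i y) = G y" by (simp_all add: P_def)
    have "x \<in> ball x R" using Z(1) by simp
    then show ?thesis unfolding laplacian_def using Z(3) by (simp add: partial_eqI_grad[OF Z(2)])
  qed
qed

subsection \<open>Local Sobolev functions with continuously differentiable representatives\<close>

lemma set_borel_measurable_continuous:
  fixes f :: "'a::euclidean_space \<Rightarrow> 'b::euclidean_space"
  assumes "open \<Omega>" "continuous_on \<Omega> f"
  shows "set_borel_measurable lborel \<Omega> f"
  unfolding set_borel_measurable_def
  using borel_measurable_continuous_on_indicator[of \<Omega> f] assms by simp

lemma set_borel_measurable_times:
  fixes f g :: "'a::euclidean_space \<Rightarrow> real"
  assumes "set_borel_measurable lborel \<Omega> f" "set_borel_measurable lborel \<Omega> g"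
  shows "set_borel_measurable lborel \<Omega> (\<lambda>x. f x * g x)"
proof -
  have [measurable]: "(\<lambda>x. indicator \<Omega> x * f x) \<in> borel_measurable lborel"
    "(\<lambda>x. indicator \<Omega> x * g x) \<in> borel_measurable lborel"
    using assms by (simp_all add: set_borel_measurable_def)
  have "(\<lambda>x. (indicator \<Omega> x * f x) * (indicator \<Omega> x * g x)) \<in> borel_measurable lborel" by measurable
  moreover have "(\<lambda>x. (indicator \<Omega> x * f x) * (indicator \<Omega> x * g x)) = (\<lambda>x. indicator \<Omega> x * (f x * g x))"
    by (auto simp: indicator_def fun_eq_iff)
  ultimately show ?thesis by (simp add: set_borel_measurable_def)
qed

lemma set_borel_measurable_powr:
  fixes f :: "'a::euclidean_space \<Rightarrow> real"
  assumes "set_borel_measurable lborel \<Omega> f"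
  shows "set_borel_measurable lborel \<Omega> (\<lambda>x. f x powr p)"
proof -
  have [measurable]: "(\<lambda>x. indicator \<Omega> x * f x) \<in> borel_measurable lborel"
    using assms by (simp add: set_borel_measurable_def)
  have "(\<lambda>x. (indicator \<Omega> x * f x) powr p) \<in> borel_measurable lborel" by measurable
  \<comment> \<open>Outside \<open>\<Omega>\<close> both sides are 0, since 0 powr p is 0 for every
    p, also for p \<le> 0.\<close>
  moreover have "(\<lambda>x. (indicator \<Omega> x * f x) powr p) = (\<lambda>x. indicator \<Omega> x * (f x powr p))"
    by (auto simp: indicator_def fun_eq_iff)
  ultimately show ?thesis by (simp add: set_borel_measurable_def)
qed

lemma set_integral_cong_AE_on:
  fixes f g :: "'a::euclidean_space \<Rightarrow> real"
  assumes "set_borel_measurable lborel \<Omega> f" "set_borel_measurable lborel \<Omega> g"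
    and "AE x in lborel. x \<in> \<Omega> \<longrightarrow> f x = g x"
  shows "(LINT x:\<Omega>|lborel. f x) = (LINT x:\<Omega>|lborel. g x)"
  unfolding set_lebesgue_integral_def
proof (rule integral_cong_AE)
  show "AE x in lborel. indicator \<Omega> x *\<^sub>R f x = indicator \<Omega> x *\<^sub>R g x"
    using assms(3) by eventually_elim (auto simp: indicator_def)
qed (use assms in \<open>auto simp: set_borel_measurable_def\<close>)

lemma Lp_loc_1_set_integrable:
  assumes "Lp_loc \<Omega> 1 v" "compact K" "K \<subseteq> \<Omega>"
  shows "set_integrable lborel K v"
proof -
  have [measurable]: "(\<lambda>x. indicator \<Omega> x * v x) \<in> borel_measurable lborel"
    using assms(1) by (simp add: Lp_loc_def set_borel_measurable_def)
  have [measurable]: "K \<in> sets borel" using assms(2) by (simp add: borel_compact)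
  have "(\<lambda>x. indicator K x * (indicator \<Omega> x * v x)) \<in> borel_measurable lborel" by measurable
  moreover have "(\<lambda>x. indicator K x * (indicator \<Omega> x * v x)) = (\<lambda>x. indicator K x * v x)"
    using assms(3) by (auto simp: indicator_def fun_eq_iff)
  ultimately have m: "(\<lambda>x. indicator K x * v x) \<in> borel_measurable lborel" by simp
  have "integrable lborel (\<lambda>x. indicator K x *\<^sub>R (\<bar>v x\<bar> powr 1))"
    using assms by (simp add: Lp_loc_def set_integrable_def)
  also have "(\<lambda>x. indicator K x *\<^sub>R (\<bar>v x\<bar> powr 1)) = (\<lambda>x. \<bar>indicator K x * v x\<bar>)"
    by (auto simp: indicator_def fun_eq_iff)
  finally have "integrable lborel (\<lambda>x. indicator K x * v x)"
    using integrable_norm_iff[OF m] by simp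
  then show ?thesis by (simp add: set_integrable_def)
qed

lemma Lp_loc_continuous_AE:
  fixes v M :: "real^'n::finite \<Rightarrow> real"
  assumes "open \<Omega>" "continuous_on \<Omega> M" "p > 0"
    and v: "set_borel_measurable lborel \<Omega> v" "AE x in lborel. x \<in> \<Omega> \<longrightarrow> v x = M x"
  shows "Lp_loc \<Omega> p v"
  unfolding Lp_loc_def
proof (intro conjI allI impI v(1))
  fix K assume K: "compact K \<and> K \<subseteq> \<Omega>"
  have "continuous_on K (\<lambda>x. \<bar>M x\<bar> powr p)"
    using continuous_on_subset[OF assms(2)] K \<open>p > 0\<close>
    by (intro continuous_on_powr' continuous_intros) auto
  then have i: "integrable lborel (\<lambda>x. indicator K x *\<^sub>R (\<bar>M x\<bar> powr p))"
    using borel_integrable_compact[of K "\<lambda>x. \<bar>M x\<bar> powr p"] K by simp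
  have [measurable]: "(\<lambda>x. indicator \<Omega> x * v x) \<in> borel_measurable lborel"
    using v(1) by (simp add: set_borel_measurable_def)
  have [measurable]: "K \<in> sets borel" using K by (simp add: borel_compact)
  have "(\<lambda>x. indicator K x * (\<bar>indicator \<Omega> x * v x\<bar> powr p)) \<in> borel_measurable lborel" by measurable
  moreover have "(\<lambda>x. indicator K x * (\<bar>indicator \<Omega> x * v x\<bar> powr p)) = (\<lambda>x. indicator K x *\<^sub>R (\<bar>v x\<bar> powr p))"
    using K by (auto simp: indicator_def fun_eq_iff)
  ultimately have m: "(\<lambda>x. indicator K x *\<^sub>R (\<bar>v x\<bar> powr p)) \<in> borel_measurable lborel" by simp
  have "AE x in lborel. indicator K x *\<^sub>R (\<bar>M x\<bar> powr p) = indicator K x *\<^sub>R (\<bar>v x\<bar> powr p)"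
    using v(2) by eventually_elim (use K in \<open>auto simp: indicator_def\<close>)
  then show "set_integrable lborel K (\<lambda>x. \<bar>v x\<bar> powr p)"
    unfolding set_integrable_def
    by (rule integrable_cong_AE_imp[OF i m, rotated])
qed

lemma Lp_loc_continuous:
  fixes M :: "real^'n::finite \<Rightarrow> real"
  assumes "open \<Omega>" "continuous_on \<Omega> M" "p > 0"
  shows "Lp_loc \<Omega> p M"
  by (rule Lp_loc_continuous_AE[OF assms]) (use assms set_borel_measurable_continuous in auto)

lemma test_fun_measurable:
  assumes "open \<Omega>" "test_fun \<Omega> \<xi>"
  shows "set_borel_measurable lborel \<Omega> \<xi>" "set_borel_measurable lborel \<Omega> (partial i \<xi>)"
  using test_fun_C1_on[OF assms(2), of \<Omega>] C1_on_continuous_on assms(1)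
  by (auto intro!: set_borel_measurable_continuous simp: C1_on_def)

text \<open>\<open>v\<close> may differ from its C^1 representative on a null set: the pointwise
  power of a given m is not itself known to be C^1.\<close>

lemma W1p_grad_C1:
  assumes \<Omega>: "open \<Omega>" and M: "C1_on \<Omega> M" and p: "p > 0"
    and v: "set_borel_measurable lborel \<Omega> v" "AE x in lborel. x \<in> \<Omega> \<longrightarrow> v x = M x"
  shows "W1p_grad \<Omega> p v (grad M)"
proof -
  have c: "continuous_on \<Omega> M" "continuous_on \<Omega> (grad M)" "continuous_on \<Omega> (partial i M)" for i
    using M C1_on_continuous_on continuous_on_grad by (auto simp: C1_on_def)
  have "(LINT x:\<Omega>|lborel. v x * partial i \<xi> x) = - (LINT x:\<Omega>|lborel. grad M x $ i * \<xi> x)"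
    if \<xi>: "test_fun \<Omega> \<xi>" for \<xi> i
  proof -
    obtain K where K: "compact K" "K \<subseteq> \<Omega>" "\<And>x. x \<notin> K \<Longrightarrow> \<xi> x = 0"
      by (rule test_fun_support[OF \<xi>], rule that)
    have "(LINT x:\<Omega>|lborel. v x * partial i \<xi> x) = (LINT x:\<Omega>|lborel. M x * partial i \<xi> x)"
    proof (rule set_integral_cong_AE_on)
      show "AE x in lborel. x \<in> \<Omega> \<longrightarrow> v x * partial i \<xi> x = M x * partial i \<xi> x"
        using v(2) by eventually_elim simp
    qed (intro set_borel_measurable_times v(1) test_fun_measurable[OF \<Omega> \<xi>] set_borel_measurable_continuous[OF \<Omega> c(1)])+
    also have "\<dots> = - (LINT x:\<Omega>|lborel. partial i M x * \<xi> x)"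
      by (rule integration_by_parts[OF \<Omega> M test_fun_C1_on[OF \<xi>] K(1,2)]) (use K in auto)
    finally show ?thesis by simp
  qed
  then show ?thesis
    unfolding W1p_grad_def weak_grad_def
  proof (intro conjI allI impI)
    show "Lp_loc \<Omega> 1 v" "Lp_loc \<Omega> p v" by (rule Lp_loc_continuous_AE[OF \<Omega> c(1) _ v], use p in simp)+
    show "Lp_loc \<Omega> 1 (\<lambda>x. grad M x $ i)" for i by (rule Lp_loc_continuous[OF \<Omega>]) (use c(3) in simp_all)
    show "Lp_loc \<Omega> p (\<lambda>x. norm (grad M x))" by (rule Lp_loc_continuous[OF \<Omega> continuous_on_norm[OF c(2)] p])
  qed
qed

text \<open>A solution carries its weak gradient existentially. This identifies it with the gradient
  of the C^1 representative; the fundamental lemma is applied to each component.\<close>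

lemma weak_grad_unique:
  assumes \<Omega>: "open \<Omega>" and g: "weak_grad \<Omega> v g1" "weak_grad \<Omega> v g2"
  shows "AE x in lborel. x \<in> \<Omega> \<longrightarrow> g1 x = g2 x"
proof -
  have "AE x in lborel. x \<in> \<Omega> \<longrightarrow> g1 x $ i - g2 x $ i = 0" for i
  proof (rule fundamental_lemma[OF \<Omega>])
    have int: "set_integrable lborel K (\<lambda>x. g1 x $ i)" "set_integrable lborel K (\<lambda>x. g2 x $ i)"
      if "compact K" "K \<subseteq> \<Omega>" for K
      using g that Lp_loc_1_set_integrable unfolding weak_grad_def by blast+
    then show "set_integrable lborel K (\<lambda>x. g1 x $ i - g2 x $ i)" if "compact K" "K \<subseteq> \<Omega>" for K
      using that by (intro set_integral_diff) auto
    fix \<xi> assume \<xi>: "test_fun \<Omega> \<xi>"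
    obtain K where K: "compact K" "K \<subseteq> \<Omega>" "\<And>x. x \<notin> K \<Longrightarrow> \<xi> x = 0"
      by (rule test_fun_support[OF \<xi>], rule that)
    have i: "set_integrable lborel \<Omega> (\<lambda>x. h x * \<xi> x)" if "set_integrable lborel K h" for h
    proof -
      have ck: "continuous_on UNIV \<xi>" by (rule C1_on_continuous_on[OF test_fun_C1_on[OF \<xi>]])
      have "integrable lborel (\<lambda>x. (indicator K x * h x) * \<xi> x)"
        using cs_integrable_integrable[OF cs_integrableI_indicator[OF K(1) that] borel_measurable_continuous_onI[OF ck] ck] .
      also have "(\<lambda>x. (indicator K x * h x) * \<xi> x) = (\<lambda>x. indicator \<Omega> x *\<^sub>R (h x * \<xi> x))"
        using K by (auto simp: indicator_def fun_eq_iff)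
      finally show ?thesis by (simp add: set_integrable_def)
    qed
    have "(LINT x:\<Omega>|lborel. g1 x $ i * \<xi> x) = (LINT x:\<Omega>|lborel. g2 x $ i * \<xi> x)"
    proof -
      have "(LINT x:\<Omega>|lborel. v x * partial i \<xi> x) = - (LINT x:\<Omega>|lborel. g1 x $ i * \<xi> x)"
        "(LINT x:\<Omega>|lborel. v x * partial i \<xi> x) = - (LINT x:\<Omega>|lborel. g2 x $ i * \<xi> x)"
        using g \<xi> by (simp_all add: weak_grad_def)
      then show ?thesis by simp
    qed
    then show "(LINT x:\<Omega>|lborel. (g1 x $ i - g2 x $ i) * \<xi> x) = 0"
      using set_integral_diff(2)[OF i[OF int(1)[OF K(1,2)]] i[OF int(2)[OF K(1,2)]]]
      by (simp add: left_diff_distrib)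
  qed
  then have "AE x in lborel. \<forall>i\<in>UNIV. x \<in> \<Omega> \<longrightarrow> g1 x $ i - g2 x $ i = 0"
    by (intro AE_finite_allI) auto
  then show ?thesis by eventually_elim (simp add: vec_eq_iff)
qed

text \<open>The common entry point of both directions, used with v = m and with v = \<phi>. The
  alternative of the zero solution is excluded by \<open>nz\<close>, which in both cases comes from
  the normalised integral.\<close>

lemma weak_grad_representative:
  fixes v :: "real^'n::finite \<Rightarrow> real" and b :: "real^'n \<Rightarrow> real^'n"
  assumes \<Omega>: "open \<Omega>" "connected \<Omega>" and g: "weak_grad \<Omega> v g"
    and nn: "AE x in lborel. x \<in> \<Omega> \<longrightarrow> v x \<ge> 0" and nz: "\<not> (AE x in lborel. x \<in> \<Omega> \<longrightarrow> v x = 0)"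
    and b: "continuous_on \<Omega> b" and eq: "AE x in lborel. x \<in> \<Omega> \<longrightarrow> g x = - v x *\<^sub>R b x"
  obtains M where "C1_on \<Omega> M" "\<And>x. x \<in> \<Omega> \<Longrightarrow> M x > 0" "\<And>x. x \<in> \<Omega> \<Longrightarrow> grad M x = - M x *\<^sub>R b x"
    "AE x in lborel. x \<in> \<Omega> \<longrightarrow> v x = M x"
proof -
  have mv: "set_borel_measurable lborel \<Omega> v" and mg: "set_borel_measurable lborel \<Omega> (\<lambda>x. g x $ i)" for i
    using g by (auto simp: weak_grad_def Lp_loc_def)
  have bi: "continuous_on \<Omega> (\<lambda>x. b x $ i)" for i using b by (intro continuous_intros)
  have "\<exists>M. (\<forall>x\<in>\<Omega>. M x \<ge> 0 \<and> (M has_derivative (\<lambda>h. (- M x *\<^sub>R b x) \<bullet> h)) (at x)) \<and>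
      (AE x in lborel. x \<in> \<Omega> \<longrightarrow> v x = M x)"
  proof (rule first_order_regularity[OF \<Omega>(1) _ nn b])
    show "set_integrable lborel K v" if "compact K" "K \<subseteq> \<Omega>" for K
      using g that Lp_loc_1_set_integrable unfolding weak_grad_def by blast
    fix \<xi> i assume \<xi>: "test_fun \<Omega> \<xi>"
    have "(LINT x:\<Omega>|lborel. v x * partial i \<xi> x) = - (LINT x:\<Omega>|lborel. g x $ i * \<xi> x)"
      using g \<xi> unfolding weak_grad_def by blast
    also have "(LINT x:\<Omega>|lborel. g x $ i * \<xi> x) = (LINT x:\<Omega>|lborel. (- v x * b x $ i) * \<xi> x)"
    proof (rule set_integral_cong_AE_on)
      show "AE x in lborel. x \<in> \<Omega> \<longrightarrow> g x $ i * \<xi> x = (- v x * b x $ i) * \<xi> x"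
        using eq by eventually_elim auto
      show "set_borel_measurable lborel \<Omega> (\<lambda>x. g x $ i * \<xi> x)"
        by (intro set_borel_measurable_times mg test_fun_measurable[OF \<Omega>(1) \<xi>])
      have "set_borel_measurable lborel \<Omega> (\<lambda>x. v x * (- b x $ i) * \<xi> x)"
        by (intro set_borel_measurable_times mv test_fun_measurable[OF \<Omega>(1) \<xi>] set_borel_measurable_continuous[OF \<Omega>(1)]
            continuous_on_minus bi)
      then show "set_borel_measurable lborel \<Omega> (\<lambda>x. (- v x * b x $ i) * \<xi> x)" by simp
    qed
    also have "(LINT x:\<Omega>|lborel. (- v x * b x $ i) * \<xi> x) = - (LINT x:\<Omega>|lborel. v x * b x $ i * \<xi> x)"
      by (simp add: set_lebesgue_integral_def)
    finally show "(LINT x:\<Omega>|lborel. v x * partial i \<xi> x) = (LINT x:\<Omega>|lborel. v x * b x $ i * \<xi> x)" by simp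
  qed
  then obtain M where M: "\<And>x. x \<in> \<Omega> \<Longrightarrow> M x \<ge> 0" "\<And>x. x \<in> \<Omega> \<Longrightarrow> (M has_derivative (\<lambda>h. (- M x *\<^sub>R b x) \<bullet> h)) (at x)"
    "AE x in lborel. x \<in> \<Omega> \<longrightarrow> v x = M x" by blast
  have "\<exists>x1\<in>\<Omega>. M x1 \<noteq> 0"
  proof (rule ccontr)
    assume "\<not> ?thesis"
    then have "AE x in lborel. x \<in> \<Omega> \<longrightarrow> v x = 0" using M(3) by (auto elim: eventually_mono)
    then show False using nz by contradiction
  qed
  then obtain x1 where x1: "x1 \<in> \<Omega>" "M x1 \<noteq> 0" by blast
  have "M x > 0" if "x \<in> \<Omega>" for x
    by (rule first_order_positive[OF \<Omega> M(1,2) b x1 that])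
  moreover have "continuous_on \<Omega> M"
    using M(2) has_derivative_continuous by (intro continuous_at_imp_continuous_on ballI) blast
  then have "C1_on \<Omega> M"
    by (intro C1_onI[OF M(2)]) (use bi in \<open>simp_all add: continuous_on_mult continuous_on_minus\<close>)
  moreover have "grad M x = - M x *\<^sub>R b x" if "x \<in> \<Omega>" for x by (rule grad_eqI[OF M(2)[OF that]])
  ultimately show ?thesis using that M(3) by blast
qed

lemma C1_on_locally_Lipschitz:
  fixes F :: "real^'n::finite \<Rightarrow> real"
  assumes \<Omega>: "open \<Omega>" and F: "C1_on \<Omega> F" and x0: "x0 \<in> \<Omega>"
  shows "\<exists>r>0. \<exists>L\<ge>0. \<forall>x\<in>ball x0 r. \<forall>y\<in>ball x0 r. \<bar>F x - F y\<bar> \<le> L * norm (x - y)"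
proof -
  obtain r where r: "r > 0" "cball x0 r \<subseteq> \<Omega>" using \<Omega> x0 open_contains_cball by blast
  obtain L where L: "\<And>x. x \<in> cball x0 r \<Longrightarrow> norm (grad F x) \<le> L"
    using compact_imp_bounded[OF compact_continuous_image[OF continuous_on_subset[OF continuous_on_grad[OF F] r(2)] compact_cball]]
    by (metis bounded_iff imageI)
  have L0: "L \<ge> 0" using L[of x0] r(1) by (intro order_trans[OF norm_ge_zero]) auto
  have "norm (F x - F y) \<le> L * norm (x - y)" if "x \<in> ball x0 r" "y \<in> ball x0 r" for x y
  proof (rule differentiable_bound[of "ball x0 r" F "\<lambda>x h. grad F x \<bullet> h"])
    fix z assume z: "z \<in> ball x0 r"
    have "z \<in> \<Omega>" using z r(2) by auto
    then have "F differentiable (at z)" using F by (simp add: C1_on_def)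
    then show "(F has_derivative (\<lambda>h. grad F z \<bullet> h)) (at z within ball x0 r)"
      by (rule has_derivative_at_withinI[OF has_derivative_grad])
    show "onorm (\<lambda>h. grad F z \<bullet> h) \<le> L"
    proof (rule onorm_bound[OF L0])
      show "norm (grad F z \<bullet> h) \<le> L * norm h" for h
        using Cauchy_Schwarz_ineq2[of "grad F z" h] mult_right_mono[OF L norm_ge_zero, of z h] z by simp
    qed
  qed (use that in auto)
  then show ?thesis using r(1) L0 by (intro exI[of _ r] conjI exI[of _ L]) auto
qed

subsection \<open>Powers of the norm\<close>

text \<open>The exponent may be negative, as r' - 2 is for r' < 2. Continuity at a zero of
  \<open>f\<close> holds because the norm of the product is |p|^(a+1) with a + 1 > 0.\<close>

lemma continuous_on_norm_powr_scaleR: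
  fixes f :: "'a::topological_space \<Rightarrow> 'b::real_normed_vector"
  assumes "continuous_on S f" "a > -1"
  shows "continuous_on S (\<lambda>x. norm (f x) powr a *\<^sub>R f x)"
proof -
  have "isCont (\<lambda>p::'b. norm p powr a *\<^sub>R p) p" for p
  proof (cases "p = 0")
    case False
    then show ?thesis by (intro continuous_intros) auto
  next
    case True
    have "((\<lambda>p::'b. norm p powr (a + 1)) \<longlongrightarrow> norm (0::'b) powr (a + 1)) (at 0)"
      using assms(2) by (intro tendsto_powr2 tendsto_norm tendsto_ident_at tendsto_const) auto
    then have "((\<lambda>p::'b. norm p powr (a + 1)) \<longlongrightarrow> 0) (at 0)" by simp
    then have "((\<lambda>p::'b. norm p powr a *\<^sub>R p) \<longlongrightarrow> 0) (at 0)"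
      by (rule Lim_null_comparison[rotated]) (auto simp: powr_add intro!: always_eventually)
    then show ?thesis using True by (simp add: isCont_def)
  qed
  then have "continuous_on UNIV (\<lambda>p::'b. norm p powr a *\<^sub>R p)"
    by (simp add: continuous_at_imp_continuous_on)
  from continuous_on_compose2[OF this assms(1)] show ?thesis by simp
qed

text \<open>The mean value theorem asks for differentiability only inside the interval, so the
  endpoint 0 is allowed.\<close>

lemma powr_Lipschitz:
  fixes a b P q :: real
  assumes "0 \<le> a" "a \<le> P" "0 \<le> b" "b \<le> P" "q > 1"
  shows "\<bar>a powr q - b powr q\<bar> \<le> q * P powr (q - 1) * \<bar>a - b\<bar>"
proof -
  have *: "\<bar>a powr q - b powr q\<bar> \<le> q * P powr (q - 1) * \<bar>a - b\<bar>" if ab: "a < b" "0 \<le> a" "b \<le> P" for a b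
  proof -
    have "\<exists>l z. a < z \<and> z < b \<and> ((\<lambda>s. s powr q) has_real_derivative l) (at z) \<and> b powr q - a powr q = (b - a) * l"
    proof (rule MVT[OF ab(1)])
      show "continuous_on {a..b} (\<lambda>s. s powr q)"
        using ab assms(5) by (intro continuous_on_powr' continuous_intros) auto
      show "(\<lambda>s. s powr q) differentiable (at x)" if "a < x" "x < b" for x
        using ab that has_real_derivative_powr[of x q] real_differentiable_def by fastforce
    qed
    then obtain l z where z: "a < z" "z < b" "((\<lambda>s. s powr q) has_real_derivative l) (at z)"
      "b powr q - a powr q = (b - a) * l" by blast
    have "l = q * z powr (q - 1)"
      using DERIV_unique[OF z(3) has_real_derivative_powr] z ab by simp
    moreover have "z powr (q - 1) \<le> P powr (q - 1)" using z ab assms(5) by (intro powr_mono2) auto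
    ultimately have "\<bar>l\<bar> \<le> q * P powr (q - 1)" using assms(5) by (simp add: abs_mult)
    then have "\<bar>b - a\<bar> * \<bar>l\<bar> \<le> \<bar>b - a\<bar> * (q * P powr (q - 1))" by (rule mult_left_mono) simp
    moreover have "\<bar>a powr q - b powr q\<bar> = \<bar>b - a\<bar> * \<bar>l\<bar>"
      using z(4) by (simp add: abs_minus_commute[of "a powr q"] abs_mult)
    ultimately show ?thesis by (simp add: abs_minus_commute[of a] mult.commute)
  qed
  show ?thesis
    using *[of a b] *[of b a] assms by (cases a b rule: linorder_cases) (auto simp: abs_minus_commute)
qed

text \<open>The duality maps p \<mapsto> |p|^(q-2) p and p \<mapsto> |p|^(r-2) p are inverse to each
  other for conjugate exponents; the second is homogeneous of degree r - 1, whence the power of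
  k.\<close>

lemma norm_powr_scaleR_conjugate:
  fixes p :: "'a::real_normed_vector"
  assumes k: "k > 0" and r: "(q - 1) * (r - 1) = 1"
  defines "D \<equiv> - k *\<^sub>R (norm p powr (q - 2) *\<^sub>R p)"
  shows "norm D powr (r - 2) *\<^sub>R D = - (k powr (r - 1)) *\<^sub>R p"
proof (cases "p = 0")
  case False
  define s where "s = norm p"
  have s: "s > 0" using False by (simp add: s_def)
  have nD: "norm D = k * s powr (q - 1)"
  proof -
    have "norm D = k * (s powr (q - 2) * s)" using k by (simp add: D_def s_def)
    also have "s powr (q - 2) * s = s powr (q - 2) * s powr 1" using s by simp
    also have "\<dots> = s powr (q - 1)" by (simp only: powr_add[symmetric]) simp
    finally show ?thesis .
  qed
  have "norm D powr (r - 2) * (k * s powr (q - 2)) = (k powr (r - 2) * k powr 1) * (s powr ((q - 1) * (r - 2)) * s powr (q - 2))"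
    unfolding nD using k s by (simp add: powr_mult powr_powr)
  also have "k powr (r - 2) * k powr 1 = k powr (r - 1)" by (simp only: powr_add[symmetric]) simp
  also have "s powr ((q - 1) * (r - 2)) * s powr (q - 2) = s powr ((q - 1) * (r - 2) + (q - 2))"
    by (rule powr_add[symmetric])
  also have "(q - 1) * (r - 2) + (q - 2) = 0" using r by (simp add: algebra_simps)
  finally have "norm D powr (r - 2) * (k * s powr (q - 2)) = k powr (r - 1)" using s by simp
  then show ?thesis by (simp add: D_def s_def)
qed (simp add: D_def)

section \<open>Measurability and regularity of the nonlinear expressions in both equations\<close>

lemma set_borel_measurable_vec:
  fixes g :: "'a::euclidean_space \<Rightarrow> real^'n::finite"
  assumes "\<And>i. set_borel_measurable lborel \<Omega> (\<lambda>x. g x $ i)"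
  shows "set_borel_measurable lborel \<Omega> g"
proof -
  have [measurable]: "(\<lambda>x. indicator \<Omega> x * g x $ i) \<in> borel_measurable lborel" for i
    using assms[of i] by (simp add: set_borel_measurable_def)
  have "(\<lambda>x. \<Sum>i\<in>UNIV. (indicator \<Omega> x * g x $ i) *\<^sub>R (axis i 1 :: real^'n)) \<in> borel_measurable lborel" by measurable
  moreover have "(\<lambda>x. \<Sum>i\<in>UNIV. (indicator \<Omega> x * g x $ i) *\<^sub>R (axis i 1 :: real^'n)) = (\<lambda>x. indicator \<Omega> x *\<^sub>R g x)"
    by (auto simp: fun_eq_iff vec_eq_iff axis_def if_distrib cong: if_cong)
  ultimately show ?thesis by (simp add: set_borel_measurable_def)
qed

lemma set_borel_measurable_norm_powr_inner:
  fixes g e :: "'a::euclidean_space \<Rightarrow> real^'n::finite"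
  assumes "set_borel_measurable lborel \<Omega> g" "set_borel_measurable lborel \<Omega> e"
  shows "set_borel_measurable lborel \<Omega> (\<lambda>x. norm (g x) powr p * (g x \<bullet> e x))"
proof -
  have [measurable]: "(\<lambda>x. indicator \<Omega> x *\<^sub>R g x) \<in> borel_measurable lborel"
    "(\<lambda>x. indicator \<Omega> x *\<^sub>R e x) \<in> borel_measurable lborel"
    using assms by (simp_all add: set_borel_measurable_def)
  have "(\<lambda>x. norm (indicator \<Omega> x *\<^sub>R g x) powr p * ((indicator \<Omega> x *\<^sub>R g x) \<bullet> (indicator \<Omega> x *\<^sub>R e x))) \<in> borel_measurable lborel"
    by measurable
  moreover have "(\<lambda>x. norm (indicator \<Omega> x *\<^sub>R g x) powr p * ((indicator \<Omega> x *\<^sub>R g x) \<bullet> (indicator \<Omega> x *\<^sub>R e x)))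
     = (\<lambda>x. indicator \<Omega> x *\<^sub>R (norm (g x) powr p * (g x \<bullet> e x)))"
    by (auto simp: indicator_def fun_eq_iff)
  ultimately show ?thesis by (simp add: set_borel_measurable_def)
qed

lemma C1_halfline_continuous:
  assumes "C1_halfline \<Omega> f"
  shows "continuous_on (\<Omega> \<times> {0..}) (\<lambda>z. f (fst z) (snd z))"
proof -
  obtain fx ft where "\<And>z. z \<in> \<Omega> \<times> {0..} \<Longrightarrow> ((\<lambda>(x, t). f x t) has_derivative (\<lambda>(h, s). fx z \<bullet> h + ft z * s))
                          (at z within \<Omega> \<times> {0..})"
    using assms unfolding C1_halfline_def by blast
  then have "continuous_on (\<Omega> \<times> {0..}) (\<lambda>(x, t). f x t)"
    by (rule has_derivative_continuous_on)
  then show ?thesis by (simp add: case_prod_beta')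
qed

text \<open>At t = 0 the derivative of f exists only relative to the half line, so the chain rule is
  applied within \<open>\<Omega>\<close> along the graph of m. The restriction is dropped only after
  composing, \<open>\<Omega>\<close> being open.\<close>

lemma C1_halfline_compose:
  fixes f :: "real^'n::finite \<Rightarrow> real \<Rightarrow> real"
  assumes \<Omega>: "open \<Omega>" and f: "C1_halfline \<Omega> f" and m: "C1_on \<Omega> m" "\<And>x. x \<in> \<Omega> \<Longrightarrow> m x \<ge> 0"
  shows "C1_on \<Omega> (\<lambda>x. f x (m x))"
proof -
  obtain fx ft where fc: "continuous_on (\<Omega> \<times> {0..}) fx" "continuous_on (\<Omega> \<times> {0..}) ft"
    and fd: "\<And>z. z \<in> \<Omega> \<times> {0..} \<Longrightarrow> ((\<lambda>(x, t). f x t) has_derivative (\<lambda>(h, s). fx z \<bullet> h + ft z * s))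
                          (at z within \<Omega> \<times> {0..})"
    using f unfolding C1_halfline_def by blast
  have cm: "continuous_on \<Omega> m" "continuous_on \<Omega> (partial i m)" for i
    using m C1_on_continuous_on by (auto simp: C1_on_def)
  have sub: "(\<lambda>x. (x, m x)) ` \<Omega> \<subseteq> \<Omega> \<times> {0..}" using m(2) by auto
  have cp: "continuous_on \<Omega> (\<lambda>x. (x, m x))" using cm by (intro continuous_intros)
  have d: "((\<lambda>x. f x (m x)) has_derivative (\<lambda>h. (fx (x, m x) + ft (x, m x) *\<^sub>R grad m x) \<bullet> h)) (at x)" if x: "x \<in> \<Omega>" for x
  proof -
    have "(m has_derivative (\<lambda>h. grad m x \<bullet> h)) (at x within \<Omega>)"
      by (rule has_derivative_at_withinI[OF has_derivative_grad]) (use m(1) x in \<open>auto simp: C1_on_def\<close>)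
    then have "((\<lambda>x. (x, m x)) has_derivative (\<lambda>h. (h, grad m x \<bullet> h))) (at x within \<Omega>)"
      by (intro has_derivative_Pair has_derivative_ident)
    moreover have "((\<lambda>(x, t). f x t) has_derivative (\<lambda>(h, s). fx (x, m x) \<bullet> h + ft (x, m x) * s))
         (at (x, m x) within (\<lambda>x. (x, m x)) ` \<Omega>)"
      by (rule has_derivative_subset[OF fd sub]) (use x m(2) in auto)
    ultimately have "((\<lambda>x. f x (m x)) has_derivative (\<lambda>h. fx (x, m x) \<bullet> h + ft (x, m x) * (grad m x \<bullet> h))) (at x within \<Omega>)"
      using has_derivative_in_compose[of "\<lambda>x. (x, m x)" _ x \<Omega> "\<lambda>(x, t). f x t"] by fastforce
    then show ?thesis using at_within_open[OF x \<Omega>] by (simp add: inner_add_left)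
  qed
  show ?thesis
  proof (rule C1_onI[OF d])
    fix i
    have "continuous_on \<Omega> (\<lambda>x. fx (x, m x))" "continuous_on \<Omega> (\<lambda>x. ft (x, m x))"
      using continuous_on_compose2[OF fc(1) cp sub] continuous_on_compose2[OF fc(2) cp sub] by auto
    then show "continuous_on \<Omega> (\<lambda>x. (fx (x, m x) + ft (x, m x) *\<^sub>R grad m x) $ i)"
      using cm(2) by (simp add: continuous_on_add continuous_on_mult continuous_on_component)
  qed
qed

text \<open>The function f is Borel as a function of both variables once it is set to 0 outside the
  half-cylinder; composing with the measurable pair (x, v x) is then immediate.\<close>

lemma set_borel_measurable_C1_halfline:
  fixes f :: "real^'n::finite \<Rightarrow> real \<Rightarrow> real"
  assumes \<Omega>: "open \<Omega>" and f: "C1_halfline \<Omega> f" and v: "set_borel_measurable lborel \<Omega> v" "\<And>x. x \<in> \<Omega> \<Longrightarrow> v x \<ge> 0"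
  shows "set_borel_measurable lborel \<Omega> (\<lambda>x. f x (v x))"
proof -
  have S: "\<Omega> \<times> {0..} \<in> sets (borel :: ((real^'n) \<times> real) measure)"
    using \<Omega> by (intro borel_Times) auto
  define F where "F z = indicator (\<Omega> \<times> {0..}) z *\<^sub>R f (fst z) (snd z)" for z
  have [measurable]: "F \<in> borel_measurable borel"
    unfolding F_def by (rule borel_measurable_continuous_on_indicator[OF S C1_halfline_continuous[OF f]])
  have [measurable]: "(\<lambda>x. indicator \<Omega> x * v x) \<in> borel_measurable lborel"
    using v(1) by (simp add: set_borel_measurable_def)
  have "(\<lambda>x. F (x, indicator \<Omega> x * v x)) \<in> borel_measurable lborel" by measurable
  moreover have "(\<lambda>x. F (x, indicator \<Omega> x * v x)) = (\<lambda>x. indicator \<Omega> x *\<^sub>R f x (v x))"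
    using v(2) by (auto simp: F_def indicator_def fun_eq_iff)
  ultimately show ?thesis by (simp add: set_borel_measurable_def)
qed

lemma Linf_loc_continuous_AE:
  fixes v M :: "real^'n::finite \<Rightarrow> real"
  assumes "open \<Omega>" "continuous_on \<Omega> M"
    and v: "set_borel_measurable lborel \<Omega> v" "AE x in lborel. x \<in> \<Omega> \<longrightarrow> v x = M x"
  shows "Linf_loc \<Omega> v"
  unfolding Linf_loc_def
proof (intro conjI allI impI v(1))
  fix K assume K: "compact K \<and> K \<subseteq> \<Omega>"
  then obtain C where C: "\<And>x. x \<in> K \<Longrightarrow> \<bar>M x\<bar> \<le> C"
    using compact_imp_bounded[OF compact_continuous_image[OF continuous_on_subset[OF assms(2)]]] by (metis bounded_real imageI)
  have "AE x in lborel. x \<in> K \<longrightarrow> \<bar>v x\<bar> \<le> C"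
    using v(2) by eventually_elim (use K C in auto)
  then show "\<exists>C. AE x in lborel. x \<in> K \<longrightarrow> \<bar>v x\<bar> \<le> C" by blast
qed

text \<open>The logarithmic gradient of M^q is q times that of M, so every power satisfies an
  equation of the same form. The powers 1/r, r, r - 1 and 1 - r occur below.\<close>

lemma C1_on_powr:
  fixes M :: "real^'n::finite \<Rightarrow> real"
  assumes M: "C1_on \<Omega> M" "\<And>x. x \<in> \<Omega> \<Longrightarrow> M x > 0"
  shows "C1_on \<Omega> (\<lambda>x. M x powr q)"
    and "x \<in> \<Omega> \<Longrightarrow> grad M x = - M x *\<^sub>R b x \<Longrightarrow> grad (\<lambda>x. M x powr q) x = - (q * M x powr q) *\<^sub>R b x"
proof -
  have cM: "continuous_on \<Omega> M" by (rule C1_on_continuous_on[OF M(1)])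
  have d: "((\<lambda>s. s powr q) has_real_derivative q * M x powr (q - 1)) (at (M x))" if "x \<in> \<Omega>" for x
    by (rule has_real_derivative_powr[OF M(2)[OF that]])
  have c: "continuous_on \<Omega> (\<lambda>x. q * M x powr (q - 1))"
    using M(2) by (intro continuous_intros cM) (metis less_irrefl)
  show "C1_on \<Omega> (\<lambda>x. M x powr q)"
    by (rule C1_on_chain(1)[OF M(1), where F' = "\<lambda>s. q * s powr (q - 1)"]) (use d c in auto)
  show "grad (\<lambda>x. M x powr q) x = - (q * M x powr q) *\<^sub>R b x" if x: "x \<in> \<Omega>" and g: "grad M x = - M x *\<^sub>R b x"
  proof -
    have "grad (\<lambda>x. M x powr q) x = (q * M x powr (q - 1)) *\<^sub>R grad M x"
      by (rule C1_on_chain(2)[OF M(1) _ _ x, where F' = "\<lambda>s. q * s powr (q - 1)"]) (use d c in auto)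
    also have "\<dots> = - (q * (M x powr (q - 1) * M x powr 1)) *\<^sub>R b x" using g M(2)[OF x] by simp
    also have "M x powr (q - 1) * M x powr 1 = M x powr q" by (simp only: powr_add[symmetric]) simp
    finally show ?thesis .
  qed
qed

subsection \<open>The generalised Hopf--Cole transformation\<close>

locale hopf_cole =
  fixes \<nu> h\<^sub>0 r' r \<mu> :: real
  assumes \<nu>: "\<nu> > 0" and h0: "h\<^sub>0 > 0" and r': "r' > 1"
    and r_def: "r = r' / (r' - 1)"
    and \<mu>_def: "\<mu> = \<nu> * (\<nu> * r / h\<^sub>0) powr (r - 1)"
begin

definition Ham :: "real^'n::finite \<Rightarrow> real" where "Ham p = h\<^sub>0 / r' * norm p powr r'"

text \<open>This is DH without the factor \<open>h\<^sub>0\<close>; the pointwise relations and the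
  divergence equation then share one vector field.\<close>

definition flux :: "real^'n::finite \<Rightarrow> real^'n" where "flux p = norm p powr (r' - 2) *\<^sub>R p"

definition c where "c = h\<^sub>0 / (\<nu> * r)"

lemma r_gt_1: "r > 1" using r' by (simp add: r_def divide_simps)

lemma conjugate_exponents: "(r' - 1) * (r - 1) = 1" using r' by (simp add: r_def field_simps)

lemma c_pos: "c > 0" using \<nu> h0 r_gt_1 by (simp add: c_def)

lemma \<mu>_c: "\<mu> * c powr (r - 1) = \<nu>"
proof -
  have "(\<nu> * r / h\<^sub>0) powr (r - 1) * c powr (r - 1) = (\<nu> * r / h\<^sub>0 * c) powr (r - 1)"
    using \<nu> h0 r_gt_1 by (intro powr_mult[symmetric])
  also have "\<nu> * r / h\<^sub>0 * c = 1" using \<nu> h0 r_gt_1 by (simp add: c_def)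
  finally show ?thesis by (simp add: \<mu>_def)
qed

text \<open>The second identity rests on (r - 1) r' = r and makes the derivative of a power of
  \<phi> reproduce H exactly.\<close>

lemma \<nu>_c: "\<nu> * r * c = h\<^sub>0" "\<nu> * ((r - 1) * c) = h\<^sub>0 / r'"
proof -
  show 1: "\<nu> * r * c = h\<^sub>0" using \<nu> r_gt_1 by (simp add: c_def)
  have "(r - 1) * r' = r" using r' by (simp add: r_def field_simps)
  then have "\<nu> * ((r - 1) * c) * r' = h\<^sub>0"
    using 1 by (metis mult.assoc mult.commute)
  then show "\<nu> * ((r - 1) * c) = h\<^sub>0 / r'" using r' by (simp add: eq_divide_eq)
qed

lemma inner_flux: "p \<bullet> flux p = norm p powr r'"
proof (cases "p = 0")
  case False
  have "p \<bullet> flux p = norm p powr (r' - 2) * norm p powr 2"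
    using False by (simp add: flux_def dot_square_norm)
  also have "\<dots> = norm p powr r'" by (simp only: powr_add[symmetric]) simp
  finally show ?thesis .
qed (simp add: flux_def)

lemma continuous_on_flux: "continuous_on S f \<Longrightarrow> continuous_on S (\<lambda>x. flux (f x))"
  unfolding flux_def using r' by (intro continuous_on_norm_powr_scaleR) auto

lemma continuous_on_Ham: "continuous_on S f \<Longrightarrow> continuous_on S (\<lambda>x. Ham (f x))"
  unfolding Ham_def using r' by (intro continuous_intros continuous_on_powr') auto

lemma rlap_flux:
  assumes "a > 0"
  shows "norm (- (c * a) *\<^sub>R flux p) powr (r - 2) * ((- (c * a) *\<^sub>R flux p) \<bullet> e)
    = - (c powr (r - 1)) * (a powr (r - 1) * (p \<bullet> e))"
proof -
  have "norm (- (c * a) *\<^sub>R flux p) powr (r - 2) *\<^sub>R (- (c * a) *\<^sub>R flux p) = - ((c * a) powr (r - 1)) *\<^sub>R p"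
    unfolding flux_def by (rule norm_powr_scaleR_conjugate) (use c_pos assms conjugate_exponents in auto)
  then have "(norm (- (c * a) *\<^sub>R flux p) powr (r - 2) *\<^sub>R (- (c * a) *\<^sub>R flux p)) \<bullet> e = (- ((c * a) powr (r - 1)) *\<^sub>R p) \<bullet> e"
    by simp
  then show ?thesis using c_pos assms by (simp add: powr_mult mult.assoc)
qed

text \<open>Since p . \<open>flux p\<close> = |p|^r', differentiating the weight \<phi>^(r-1)
  creates a multiple of H(Du), and differentiating its inverse gives the opposite sign. This is how
  the Hamiltonian enters and leaves the divergence equation.\<close>

lemma inner_grad_powr:
  fixes \<Phi> u :: "real^'n::finite \<Rightarrow> real"
  assumes \<Phi>: "C1_on \<Omega> \<Phi>" "\<And>x. x \<in> \<Omega> \<Longrightarrow> \<Phi> x > 0" "\<And>x. x \<in> \<Omega> \<Longrightarrow> grad \<Phi> x = - \<Phi> x *\<^sub>R (c *\<^sub>R flux (grad u x))"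
    and x: "x \<in> \<Omega>"
  shows "\<nu> * (grad u x \<bullet> grad (\<lambda>x. \<Phi> x powr (r - 1)) x) = - (\<Phi> x powr (r - 1) * Ham (grad u x))"
    and "\<nu> * (grad u x \<bullet> grad (\<lambda>x. \<Phi> x powr (1 - r)) x) = \<Phi> x powr (1 - r) * Ham (grad u x)"
proof -
  have *: "\<nu> * (grad u x \<bullet> grad (\<lambda>x. \<Phi> x powr q) x) = - (\<nu> * (q * c)) * (\<Phi> x powr q * norm (grad u x) powr r')" for q
    using C1_on_powr(2)[OF \<Phi>(1,2) x, of "\<lambda>x. c *\<^sub>R flux (grad u x)" q] \<Phi>(3)[OF x]
    by (simp add: inner_flux)
  show "\<nu> * (grad u x \<bullet> grad (\<lambda>x. \<Phi> x powr (r - 1)) x) = - (\<Phi> x powr (r - 1) * Ham (grad u x))"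
    unfolding * \<nu>_c(2) by (simp add: Ham_def)
  have "\<nu> * ((1 - r) * c) = - (h\<^sub>0 / r')" using \<nu>_c(2) by (simp add: algebra_simps)
  then show "\<nu> * (grad u x \<bullet> grad (\<lambda>x. \<Phi> x powr (1 - r)) x) = \<Phi> x powr (1 - r) * Ham (grad u x)"
    unfolding * by (simp add: Ham_def)
qed

text \<open>Here u is already C^2, so the Hamilton-Jacobi equation is multiplied by the C^1 function
  \<phi>^(r-1) \<xi> and the Laplacian is integrated by parts. Differentiating the weight cancels
  H(Du) and leaves the r-Laplace flux.\<close>

lemma mfg_imp_rlap:
  fixes \<Omega> :: "(real^'n::finite) set"
  assumes \<Omega>: "open \<Omega>" "connected \<Omega>"
    and sol: "mfg_solution \<Omega> \<nu> Ham (\<lambda>p. h\<^sub>0 *\<^sub>R flux p) f u m lam"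
    and g: "weak_grad \<Omega> m g" "AE x in lborel. x \<in> \<Omega> \<longrightarrow> \<nu> *\<^sub>R g x + (h\<^sub>0 * m x) *\<^sub>R flux (grad u x) = 0"
  shows "rlap_solution \<Omega> \<mu> r f (\<lambda>x. m x powr (1 / r)) lam"
proof -
  have u: "C1_on \<Omega> u" "\<And>i. C1_on \<Omega> (partial i u)" and int1: "(LINT x:\<Omega>|lborel. m x) = 1"
    and m0: "\<And>x. x \<in> \<Omega> \<Longrightarrow> m x \<ge> 0"
    and pde: "\<And>x. x \<in> \<Omega> \<Longrightarrow> - \<nu> * laplacian u x + Ham (grad u x) + lam = f x (m x)"
    using sol by (auto simp: mfg_solution_def C2_on_def)
  have mm: "set_borel_measurable lborel \<Omega> m" using g(1) by (simp add: weak_grad_def Lp_loc_def)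
  have cu: "continuous_on \<Omega> (grad u)" by (rule continuous_on_grad[OF u(1)])
  obtain M where M: "C1_on \<Omega> M" "\<And>x. x \<in> \<Omega> \<Longrightarrow> M x > 0"
    "\<And>x. x \<in> \<Omega> \<Longrightarrow> grad M x = - M x *\<^sub>R ((h\<^sub>0 / \<nu>) *\<^sub>R flux (grad u x))" "AE x in lborel. x \<in> \<Omega> \<longrightarrow> m x = M x"
  proof (rule weak_grad_representative[OF \<Omega> g(1), of "\<lambda>x. (h\<^sub>0 / \<nu>) *\<^sub>R flux (grad u x)"])
    show "AE x in lborel. x \<in> \<Omega> \<longrightarrow> m x \<ge> 0" using m0 by simp
    show "continuous_on \<Omega> (\<lambda>x. (h\<^sub>0 / \<nu>) *\<^sub>R flux (grad u x))"
      by (intro continuous_intros continuous_on_flux cu)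
    show "AE x in lborel. x \<in> \<Omega> \<longrightarrow> g x = - m x *\<^sub>R ((h\<^sub>0 / \<nu>) *\<^sub>R flux (grad u x))"
      using g(2)
    proof eventually_elim
      case (elim x)
      show ?case
      proof
        assume "x \<in> \<Omega>"
        then have "\<nu> *\<^sub>R g x = - ((h\<^sub>0 * m x) *\<^sub>R flux (grad u x))"
          using elim by (simp add: eq_neg_iff_add_eq_0)
        then have "(1 / \<nu>) *\<^sub>R (\<nu> *\<^sub>R g x) = (1 / \<nu>) *\<^sub>R (- ((h\<^sub>0 * m x) *\<^sub>R flux (grad u x)))" by simp
        then show "g x = - m x *\<^sub>R ((h\<^sub>0 / \<nu>) *\<^sub>R flux (grad u x))" using \<nu> by (simp add: mult.commute)
      qed
    qed
    show "\<not> (AE x in lborel. x \<in> \<Omega> \<longrightarrow> m x = 0)"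
    proof
      assume "AE x in lborel. x \<in> \<Omega> \<longrightarrow> m x = 0"
      then have "AE x in lborel. indicator \<Omega> x *\<^sub>R m x = 0" by eventually_elim (auto simp: indicator_def)
      then have "(LINT x:\<Omega>|lborel. m x) = 0" unfolding set_lebesgue_integral_def by (rule integral_eq_zero_AE)
      then show False using int1 by simp
    qed
  qed (use that in blast)
  define \<Phi> where "\<Phi> x = M x powr (1 / r)" for x
  have \<Phi>C: "C1_on \<Omega> \<Phi>" unfolding \<Phi>_def[abs_def] by (rule C1_on_powr(1)[OF M(1,2)])
  have \<Phi>0: "\<Phi> x > 0" if "x \<in> \<Omega>" for x using M(2)[OF that] by (simp add: \<Phi>_def)
  have \<Phi>g: "grad \<Phi> x = - \<Phi> x *\<^sub>R (c *\<^sub>R flux (grad u x))" if x: "x \<in> \<Omega>" for x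
  proof -
    have "grad \<Phi> x = - (1 / r * M x powr (1 / r)) *\<^sub>R ((h\<^sub>0 / \<nu>) *\<^sub>R flux (grad u x))"
      unfolding \<Phi>_def[abs_def]
      by (rule C1_on_powr(2)[OF M(1,2) x, of "\<lambda>x. (h\<^sub>0 / \<nu>) *\<^sub>R flux (grad u x)"]) (use M(3)[OF x] in auto)
    then show ?thesis by (simp add: \<Phi>_def c_def mult_ac)
  qed
  \<comment> \<open>Two versions of m^(1/r) coexist: \<open>\<phi>\<close> is the pointwise power in
    the conclusion, \<open>\<Phi>\<close> its positive C^1 representative in which all calculations
    take place. They agree almost everywhere.\<close>
  define \<phi> where "\<phi> x = m x powr (1 / r)" for x
  have m\<phi>: "set_borel_measurable lborel \<Omega> \<phi>" unfolding \<phi>_def by (rule set_borel_measurable_powr[OF mm])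
  have ae: "AE x in lborel. x \<in> \<Omega> \<longrightarrow> \<phi> x = \<Phi> x"
    using M(4) by eventually_elim (simp add: \<phi>_def \<Phi>_def)
  have \<phi>r: "\<phi> x powr r = m x" if "x \<in> \<Omega>" for x
    using m0[OF that] r_gt_1 by (simp add: \<phi>_def powr_powr)
  define A where "A x = \<Phi> x powr (r - 1)" for x
  have AC: "C1_on \<Omega> A" unfolding A_def[abs_def] by (rule C1_on_powr(1)[OF \<Phi>C \<Phi>0])
  \<comment> \<open>By the Hamilton-Jacobi equation this continuous function equals f(x,m) -
    \<lambda>, so f need not be composed with the merely measurable m.\<close>
  define T where "T x = - \<nu> * laplacian u x + Ham (grad u x)" for x
  have cl: "continuous_on \<Omega> (laplacian u)"
    unfolding laplacian_def[abs_def] using u(2) by (intro continuous_on_sum) (simp add: C1_on_def)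
  have cT: "continuous_on \<Omega> T" unfolding T_def by (intro continuous_intros cl continuous_on_Ham cu)
  have weak: "\<mu> * (LINT x:\<Omega>|lborel. norm (grad \<Phi> x) powr (r - 2) * (grad \<Phi> x \<bullet> grad \<xi> x))
           + (LINT x:\<Omega>|lborel. (f x (\<phi> x powr r) - lam) * \<phi> x powr (r - 1) * \<xi> x) = 0"
    if \<xi>: "test_fun \<Omega> \<xi>" for \<xi>
  proof -
    obtain K where K: "compact K" "K \<subseteq> \<Omega>" "\<And>x. x \<notin> K \<Longrightarrow> \<xi> x = 0"
      by (rule test_fun_support[OF \<xi>], rule that)
    have \<xi>C: "C1_on \<Omega> \<xi>" by (rule test_fun_C1_on[OF \<xi>])
    have c_pos\<xi>: "continuous_on \<Omega> \<xi>" "continuous_on \<Omega> (grad \<xi>)" using C1_on_continuous_on[OF \<xi>C] continuous_on_grad[OF \<xi>C] .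
    have p\<xi>0: "grad \<xi> x = 0" if "x \<in> \<Omega> - K" for x
      using partial_zero_outside[OF \<Omega>(1) K(1) _ that, of \<xi>] K(3) by (auto simp: vec_eq_iff)
    define \<psi> where "\<psi> x = A x * \<xi> x" for x
    have \<psi>C: "C1_on \<Omega> \<psi>" unfolding \<psi>_def[abs_def] by (rule C1_on_mult(1)[OF AC \<xi>C])
    have \<psi>0: "\<psi> x = 0" if "x \<in> \<Omega> - K" for x using K(3) that by (simp add: \<psi>_def)
    have p\<psi>0: "partial i \<psi> x = 0" if "x \<in> \<Omega> - K" for x i by (rule partial_zero_outside[OF \<Omega>(1) K(1) \<psi>0 that])
    have cu': "continuous_on \<Omega> (partial i u)" "continuous_on \<Omega> (partial i (partial i u))" "continuous_on \<Omega> (partial i \<psi>)" "continuous_on \<Omega> \<psi>" for i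
      using u \<psi>C C1_on_continuous_on[OF \<psi>C] by (simp_all add: C1_on_def)
    have "(LINT x:\<Omega>|lborel. grad u x \<bullet> grad \<psi> x) = (\<Sum>i\<in>UNIV. LINT x:\<Omega>|lborel. partial i u x * partial i \<psi> x)"
      by (subst set_integral_sum_finite[symmetric])
         (auto simp: inner_vec_def p\<psi>0 intro!: set_integrable_continuous_compact_support[OF \<Omega>(1) K(1,2)] continuous_on_mult cu')
    also have "\<dots> = (\<Sum>i\<in>UNIV. - (LINT x:\<Omega>|lborel. partial i (partial i u) x * \<psi> x))"
      by (intro sum.cong refl integration_by_parts[OF \<Omega>(1) u(2) \<psi>C K(1,2) \<psi>0])
    also have "\<dots> = - (LINT x:\<Omega>|lborel. laplacian u x * \<psi> x)"
      unfolding sum_negf laplacian_def sum_distrib_right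
      by (subst set_integral_sum_finite)
         (auto simp: \<psi>0 intro!: set_integrable_continuous_compact_support[OF \<Omega>(1) K(1,2)] continuous_on_mult cu')
    finally have ibp: "(LINT x:\<Omega>|lborel. grad u x \<bullet> grad \<psi> x) = - (LINT x:\<Omega>|lborel. laplacian u x * \<psi> x)" .
    have i1: "set_integrable lborel \<Omega> (\<lambda>x. grad u x \<bullet> grad \<psi> x)" 
      using p\<psi>0 by (intro set_integrable_continuous_compact_support[OF \<Omega>(1) K(1,2)])
         (auto simp: inner_vec_def intro!: continuous_on_sum continuous_on_mult cu')
    have i2: "set_integrable lborel \<Omega> (\<lambda>x. Ham (grad u x) * \<psi> x)" "set_integrable lborel \<Omega> (\<lambda>x. laplacian u x * \<psi> x)"
      using \<psi>0 by (auto intro!: set_integrable_continuous_compact_support[OF \<Omega>(1) K(1,2)] continuous_on_mult cu' cl continuous_on_Ham cu)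
    have "\<mu> * (LINT x:\<Omega>|lborel. norm (grad \<Phi> x) powr (r - 2) * (grad \<Phi> x \<bullet> grad \<xi> x))
      = \<mu> * (LINT x:\<Omega>|lborel. - (c powr (r - 1)) * (A x * (grad u x \<bullet> grad \<xi> x)))"
    proof (intro arg_cong[where f = "(*) \<mu>"] set_lebesgue_integral_cong)
      show "\<forall>x. x \<in> \<Omega> \<longrightarrow> norm (grad \<Phi> x) powr (r - 2) * (grad \<Phi> x \<bullet> grad \<xi> x) = - (c powr (r - 1)) * (A x * (grad u x \<bullet> grad \<xi> x))"
      proof (intro allI impI)
        fix x assume x: "x \<in> \<Omega>"
        have "grad \<Phi> x = - (c * \<Phi> x) *\<^sub>R flux (grad u x)" by (simp add: \<Phi>g[OF x] mult.commute)
        then show "norm (grad \<Phi> x) powr (r - 2) * (grad \<Phi> x \<bullet> grad \<xi> x) = - (c powr (r - 1)) * (A x * (grad u x \<bullet> grad \<xi> x))"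
          unfolding A_def using rlap_flux[OF \<Phi>0[OF x]] by metis
      qed
    qed (use \<Omega> in auto)
    also have "\<dots> = - (\<mu> * c powr (r - 1)) * (LINT x:\<Omega>|lborel. A x * (grad u x \<bullet> grad \<xi> x))"
      by (subst set_integral_mult_right) simp
    also have "\<dots> = - (LINT x:\<Omega>|lborel. \<nu> * (A x * (grad u x \<bullet> grad \<xi> x)))"
      unfolding \<mu>_c by (subst set_integral_mult_right) simp
    also have "(LINT x:\<Omega>|lborel. \<nu> * (A x * (grad u x \<bullet> grad \<xi> x))) = (LINT x:\<Omega>|lborel. \<nu> * (grad u x \<bullet> grad \<psi> x) + Ham (grad u x) * \<psi> x)"
    proof (rule set_lebesgue_integral_cong)
      show "\<forall>x. x \<in> \<Omega> \<longrightarrow> \<nu> * (A x * (grad u x \<bullet> grad \<xi> x)) = \<nu> * (grad u x \<bullet> grad \<psi> x) + Ham (grad u x) * \<psi> x"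
      proof (intro allI impI)
        fix x assume x: "x \<in> \<Omega>"
        have "grad \<psi> x = A x *\<^sub>R grad \<xi> x + \<xi> x *\<^sub>R grad A x"
          unfolding \<psi>_def[abs_def] by (rule C1_on_mult(2)[OF AC \<xi>C x])
        then have "\<nu> * (grad u x \<bullet> grad \<psi> x) = \<nu> * (A x * (grad u x \<bullet> grad \<xi> x)) + \<xi> x * (\<nu> * (grad u x \<bullet> grad A x))"
          by (simp add: inner_add_right algebra_simps)
        also have "\<nu> * (grad u x \<bullet> grad A x) = - (A x * Ham (grad u x))"
          unfolding A_def[abs_def] by (rule inner_grad_powr(1)[OF \<Phi>C \<Phi>0 \<Phi>g x])
        finally show "\<nu> * (A x * (grad u x \<bullet> grad \<xi> x)) = \<nu> * (grad u x \<bullet> grad \<psi> x) + Ham (grad u x) * \<psi> x"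
          unfolding \<psi>_def[of x] by simp
      qed
    qed (use \<Omega> in auto)
    also have "\<dots> = \<nu> * (LINT x:\<Omega>|lborel. grad u x \<bullet> grad \<psi> x) + (LINT x:\<Omega>|lborel. Ham (grad u x) * \<psi> x)"
      using i1 i2 by (subst set_integral_add(2)) (auto intro: set_integrable_mult_right)
    also have "\<dots> = (LINT x:\<Omega>|lborel. T x * \<psi> x)"
    proof -
      have "(LINT x:\<Omega>|lborel. T x * \<psi> x) = (LINT x:\<Omega>|lborel. (- \<nu>) * (laplacian u x * \<psi> x) + Ham (grad u x) * \<psi> x)"
        by (simp add: T_def algebra_simps)
      also have "\<dots> = (LINT x:\<Omega>|lborel. (- \<nu>) * (laplacian u x * \<psi> x)) + (LINT x:\<Omega>|lborel. Ham (grad u x) * \<psi> x)"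
        by (rule set_integral_add(2)[OF set_integrable_mult_right[OF i2(2)] i2(1)])
      also have "(LINT x:\<Omega>|lborel. (- \<nu>) * (laplacian u x * \<psi> x)) = (- \<nu>) * (LINT x:\<Omega>|lborel. laplacian u x * \<psi> x)"
        by (rule set_integral_mult_right)
      finally show ?thesis unfolding ibp by simp
    qed
    finally have 1: "\<mu> * (LINT x:\<Omega>|lborel. norm (grad \<Phi> x) powr (r - 2) * (grad \<Phi> x \<bullet> grad \<xi> x))
       = - (LINT x:\<Omega>|lborel. T x * \<psi> x)" .
    have "(LINT x:\<Omega>|lborel. (f x (\<phi> x powr r) - lam) * \<phi> x powr (r - 1) * \<xi> x) = (LINT x:\<Omega>|lborel. T x * \<phi> x powr (r - 1) * \<xi> x)"
    proof (rule set_lebesgue_integral_cong)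
      have "f x (\<phi> x powr r) - lam = T x" if "x \<in> \<Omega>" for x
        unfolding \<phi>r[OF that] T_def using pde[OF that] by linarith
      then show "\<forall>x. x \<in> \<Omega> \<longrightarrow> (f x (\<phi> x powr r) - lam) * \<phi> x powr (r - 1) * \<xi> x = T x * \<phi> x powr (r - 1) * \<xi> x"
        by simp
    qed (use \<Omega> in auto)
    also have "\<dots> = (LINT x:\<Omega>|lborel. T x * \<psi> x)"
    proof (rule set_integral_cong_AE_on)
      show "set_borel_measurable lborel \<Omega> (\<lambda>x. T x * \<phi> x powr (r - 1) * \<xi> x)"
        by (intro set_borel_measurable_times set_borel_measurable_powr m\<phi> set_borel_measurable_continuous[OF \<Omega>(1)] cT c_pos\<xi>)
      show "set_borel_measurable lborel \<Omega> (\<lambda>x. T x * \<psi> x)"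
        by (intro set_borel_measurable_times set_borel_measurable_continuous[OF \<Omega>(1)] cT cu')
      show "AE x in lborel. x \<in> \<Omega> \<longrightarrow> T x * \<phi> x powr (r - 1) * \<xi> x = T x * \<psi> x"
        using ae by eventually_elim (auto simp: \<psi>_def A_def)
    qed
    finally show ?thesis using 1 by simp
  qed
  have "rlap_solution \<Omega> \<mu> r f \<phi> lam"
    unfolding rlap_solution_def
  proof (intro conjI exI[of _ "grad \<Phi>"] allI impI)
    show "Linf_loc \<Omega> \<phi>" by (rule Linf_loc_continuous_AE[OF \<Omega>(1) C1_on_continuous_on[OF \<Phi>C] m\<phi> ae])
    have "(LINT x:\<Omega>|lborel. \<phi> x powr r) = (LINT x:\<Omega>|lborel. m x)"
      by (rule set_lebesgue_integral_cong) (use \<Omega> \<phi>r in auto)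
    then show "(LINT x:\<Omega>|lborel. \<phi> x powr r) = 1" using int1 by simp
    show "AE x in lborel. x \<in> \<Omega> \<longrightarrow> 0 < \<phi> x" using ae by eventually_elim (auto simp: \<Phi>0)
    show "W1p_grad \<Omega> r \<phi> (grad \<Phi>)" by (rule W1p_grad_C1[OF \<Omega>(1) \<Phi>C _ m\<phi> ae]) (use r_gt_1 in simp)
  qed (rule weak)
  then show ?thesis unfolding \<phi>_def .
qed

text \<open>\<open>\<phi>\<close> is determined only almost everywhere while the Hamilton-Jacobi
  equation holds at every point; therefore m is the power of the continuous representative of
  \<open>\<phi>\<close>, equal to \<phi>^r up to a null set.\<close>

lemma rlap_imp_mfg:
  fixes \<Omega> :: "(real^'n::finite) set"
  assumes \<Omega>: "open \<Omega>" "connected \<Omega>" and f: "C1_halfline \<Omega> f"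
    and sol: "rlap_solution \<Omega> \<mu> r f \<phi> lam" and u: "C1_on \<Omega> u"
    and g: "weak_grad \<Omega> \<phi> g" "AE x in lborel. x \<in> \<Omega> \<longrightarrow> (h\<^sub>0 * \<phi> x) *\<^sub>R flux (grad u x) + (\<nu> * r) *\<^sub>R g x = 0"
  shows "\<exists>m. (AE x in lborel. x \<in> \<Omega> \<longrightarrow> m x = \<phi> x powr r) \<and> mfg_solution \<Omega> \<nu> Ham (\<lambda>p. h\<^sub>0 *\<^sub>R flux p) f u m lam"
proof -
  obtain g1 where int1: "(LINT x:\<Omega>|lborel. \<phi> x powr r) = 1" and \<phi>0: "AE x in lborel. x \<in> \<Omega> \<longrightarrow> \<phi> x > 0"
    and g1: "W1p_grad \<Omega> r \<phi> g1"
    and eq: "\<And>\<xi>. test_fun \<Omega> \<xi> \<Longrightarrow>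
       \<mu> * (LINT x:\<Omega>|lborel. norm (g1 x) powr (r - 2) * (g1 x \<bullet> grad \<xi> x))
           + (LINT x:\<Omega>|lborel. (f x (\<phi> x powr r) - lam) * \<phi> x powr (r - 1) * \<xi> x) = 0"
    using sol unfolding rlap_solution_def by blast
  have m\<phi>: "set_borel_measurable lborel \<Omega> \<phi>" using g(1) by (simp add: weak_grad_def Lp_loc_def)
  have cu: "continuous_on \<Omega> (grad u)" by (rule continuous_on_grad[OF u])
  obtain \<Phi> where \<Phi>C: "C1_on \<Omega> \<Phi>" and \<Phi>0: "\<And>x. x \<in> \<Omega> \<Longrightarrow> \<Phi> x > 0"
    and \<Phi>g: "\<And>x. x \<in> \<Omega> \<Longrightarrow> grad \<Phi> x = - \<Phi> x *\<^sub>R (c *\<^sub>R flux (grad u x))" and ae: "AE x in lborel. x \<in> \<Omega> \<longrightarrow> \<phi> x = \<Phi> x"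
  proof (rule weak_grad_representative[OF \<Omega> g(1), of "\<lambda>x. c *\<^sub>R flux (grad u x)"])
    show "AE x in lborel. x \<in> \<Omega> \<longrightarrow> \<phi> x \<ge> 0" using \<phi>0 by eventually_elim auto
    show "continuous_on \<Omega> (\<lambda>x. c *\<^sub>R flux (grad u x))"
      by (intro continuous_intros continuous_on_flux cu)
    show "AE x in lborel. x \<in> \<Omega> \<longrightarrow> g x = - \<phi> x *\<^sub>R (c *\<^sub>R flux (grad u x))"
      using g(2)
    proof eventually_elim
      case (elim x)
      show ?case
      proof
        assume "x \<in> \<Omega>"
        then have "(\<nu> * r) *\<^sub>R g x = - ((h\<^sub>0 * \<phi> x) *\<^sub>R flux (grad u x))"
          using elim by (simp add: eq_neg_iff_add_eq_0 add.commute)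
        then have "(1 / (\<nu> * r)) *\<^sub>R ((\<nu> * r) *\<^sub>R g x) = (1 / (\<nu> * r)) *\<^sub>R (- ((h\<^sub>0 * \<phi> x) *\<^sub>R flux (grad u x)))" by simp
        then show "g x = - \<phi> x *\<^sub>R (c *\<^sub>R flux (grad u x))" using \<nu> r_gt_1 by (simp add: c_def mult.commute)
      qed
    qed
    show "\<not> (AE x in lborel. x \<in> \<Omega> \<longrightarrow> \<phi> x = 0)"
    proof
      assume "AE x in lborel. x \<in> \<Omega> \<longrightarrow> \<phi> x = 0"
      then have "AE x in lborel. indicator \<Omega> x *\<^sub>R \<phi> x powr r = 0" by eventually_elim (auto simp: indicator_def)
      then have "(LINT x:\<Omega>|lborel. \<phi> x powr r) = 0" unfolding set_lebesgue_integral_def by (rule integral_eq_zero_AE)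
      then show False using int1 by simp
    qed
  qed (use that in blast)
  have c_pos\<Phi>: "continuous_on \<Omega> \<Phi>" by (rule C1_on_continuous_on[OF \<Phi>C])
  \<comment> \<open>The gradient in the relation with Du and the one carried by the solution are
    separate witnesses; uniqueness puts the flux formula into the r-Laplace equation.\<close>
  have g1ae: "AE x in lborel. x \<in> \<Omega> \<longrightarrow> g1 x = grad \<Phi> x"
  proof (rule weak_grad_unique[OF \<Omega>(1)])
    show "weak_grad \<Omega> \<phi> g1" using g1 by (simp add: W1p_grad_def)
    show "weak_grad \<Omega> \<phi> (grad \<Phi>)" using W1p_grad_C1[OF \<Omega>(1) \<Phi>C zero_less_one m\<phi> ae] by (simp add: W1p_grad_def)
  qed
  define m where "m x = \<Phi> x powr r" for x
  have mC: "C1_on \<Omega> m" unfolding m_def[abs_def] by (rule C1_on_powr(1)[OF \<Phi>C \<Phi>0])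
  have cm: "continuous_on \<Omega> m" by (rule C1_on_continuous_on[OF mC])
  define F where "F x = f x (m x)" for x
  have FC: "C1_on \<Omega> F" unfolding F_def[abs_def]
    by (rule C1_halfline_compose[OF \<Omega>(1) f mC]) (simp add: m_def)
  have cF: "continuous_on \<Omega> F" by (rule C1_on_continuous_on[OF FC])
  define A where "A x = \<Phi> x powr (r - 1)" for x
  define A' where "A' x = \<Phi> x powr (1 - r)" for x
  have AC: "C1_on \<Omega> A" unfolding A_def[abs_def] by (rule C1_on_powr(1)[OF \<Phi>C \<Phi>0])
  have A'C: "C1_on \<Omega> A'" unfolding A'_def[abs_def] by (rule C1_on_powr(1)[OF \<Phi>C \<Phi>0])
  have cA: "continuous_on \<Omega> A" by (rule C1_on_continuous_on[OF AC])
  have AA': "A x * A' x = 1" if "x \<in> \<Omega>" for x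
    unfolding A_def A'_def powr_add[symmetric] using \<Phi>0[OF that] by simp
  \<comment> \<open>The representative enters only through equality almost everywhere, so the
    integrands are shown measurable on both sides.\<close>
  have weak1: "(LINT x:\<Omega>|lborel. (A x *\<^sub>R grad u x) \<bullet> grad \<xi> x) = - (LINT x:\<Omega>|lborel. ((lam - F x) / \<nu> * A x) * \<xi> x)"
    if \<xi>: "test_fun \<Omega> \<xi>" for \<xi>
  proof -
    have \<xi>C: "C1_on \<Omega> \<xi>" by (rule test_fun_C1_on[OF \<xi>])
    have c_pos\<xi>: "continuous_on \<Omega> \<xi>" "continuous_on \<Omega> (grad \<xi>)" using C1_on_continuous_on[OF \<xi>C] continuous_on_grad[OF \<xi>C] .
    have mg1: "set_borel_measurable lborel \<Omega> g1"
      using g1 by (intro set_borel_measurable_vec) (simp add: W1p_grad_def weak_grad_def Lp_loc_def)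
    have "(LINT x:\<Omega>|lborel. norm (g1 x) powr (r - 2) * (g1 x \<bullet> grad \<xi> x)) = (LINT x:\<Omega>|lborel. - (c powr (r - 1)) * ((A x *\<^sub>R grad u x) \<bullet> grad \<xi> x))"
    proof (rule set_integral_cong_AE_on)
      show "set_borel_measurable lborel \<Omega> (\<lambda>x. norm (g1 x) powr (r - 2) * (g1 x \<bullet> grad \<xi> x))"
        by (intro set_borel_measurable_norm_powr_inner mg1 set_borel_measurable_continuous[OF \<Omega>(1)] c_pos\<xi>)
      show "set_borel_measurable lborel \<Omega> (\<lambda>x. - (c powr (r - 1)) * ((A x *\<^sub>R grad u x) \<bullet> grad \<xi> x))"
        by (intro set_borel_measurable_continuous[OF \<Omega>(1)] continuous_intros cA cu c_pos\<xi>)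
      show "AE x in lborel. x \<in> \<Omega> \<longrightarrow> norm (g1 x) powr (r - 2) * (g1 x \<bullet> grad \<xi> x) = - (c powr (r - 1)) * ((A x *\<^sub>R grad u x) \<bullet> grad \<xi> x)"
        using g1ae
      proof eventually_elim
        case (elim x)
        show ?case
        proof
          assume x: "x \<in> \<Omega>"
          have "g1 x = - (c * \<Phi> x) *\<^sub>R flux (grad u x)" using elim x by (simp add: \<Phi>g[OF x] mult.commute)
          then show "norm (g1 x) powr (r - 2) * (g1 x \<bullet> grad \<xi> x) = - (c powr (r - 1)) * ((A x *\<^sub>R grad u x) \<bullet> grad \<xi> x)"
            using rlap_flux[OF \<Phi>0[OF x], of "grad u x" "grad \<xi> x"] by (simp only: A_def inner_scaleR_left)
        qed
      qed
    qed
    also have "\<dots> = - (c powr (r - 1)) * (LINT x:\<Omega>|lborel. (A x *\<^sub>R grad u x) \<bullet> grad \<xi> x)"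
      by (rule set_integral_mult_right)
    finally have 1: "\<mu> * (LINT x:\<Omega>|lborel. norm (g1 x) powr (r - 2) * (g1 x \<bullet> grad \<xi> x)) = - \<nu> * (LINT x:\<Omega>|lborel. (A x *\<^sub>R grad u x) \<bullet> grad \<xi> x)"
      using \<mu>_c by simp
    have "(LINT x:\<Omega>|lborel. (f x (\<phi> x powr r) - lam) * \<phi> x powr (r - 1) * \<xi> x) = (LINT x:\<Omega>|lborel. - \<nu> * ((lam - F x) / \<nu> * A x * \<xi> x))"
    proof (rule set_integral_cong_AE_on)
      have "set_borel_measurable lborel \<Omega> (\<lambda>x. f x (\<phi> x powr r))"
        by (rule set_borel_measurable_C1_halfline[OF \<Omega>(1) f set_borel_measurable_powr[OF m\<phi>]]) simp
      then have "set_borel_measurable lborel \<Omega> (\<lambda>x. f x (\<phi> x powr r) - lam)"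
        using set_borel_measurable_continuous[OF \<Omega>(1) continuous_on_const, of lam]
        unfolding set_borel_measurable_def scaleR_diff_right by (rule borel_measurable_diff)
      then show "set_borel_measurable lborel \<Omega> (\<lambda>x. (f x (\<phi> x powr r) - lam) * \<phi> x powr (r - 1) * \<xi> x)"
        by (intro set_borel_measurable_times set_borel_measurable_powr m\<phi> set_borel_measurable_continuous[OF \<Omega>(1) c_pos\<xi>(1)])
      show "set_borel_measurable lborel \<Omega> (\<lambda>x. - \<nu> * ((lam - F x) / \<nu> * A x * \<xi> x))"
        using \<nu> by (intro set_borel_measurable_continuous[OF \<Omega>(1)] continuous_intros cA cF c_pos\<xi>) auto
      show "AE x in lborel. x \<in> \<Omega> \<longrightarrow> (f x (\<phi> x powr r) - lam) * \<phi> x powr (r - 1) * \<xi> x = - \<nu> * ((lam - F x) / \<nu> * A x * \<xi> x)"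
        using ae
      proof eventually_elim
        case (elim x)
        have "(F x - lam) * A x * \<xi> x = - \<nu> * ((lam - F x) / \<nu> * A x * \<xi> x)" using \<nu> by (simp add: field_simps)
        then show ?case using elim by (simp add: F_def m_def A_def)
      qed
    qed
    also have "\<dots> = - \<nu> * (LINT x:\<Omega>|lborel. (lam - F x) / \<nu> * A x * \<xi> x)" by (rule set_integral_mult_right)
    finally have "\<nu> * ((LINT x:\<Omega>|lborel. (A x *\<^sub>R grad u x) \<bullet> grad \<xi> x) + (LINT x:\<Omega>|lborel. (lam - F x) / \<nu> * A x * \<xi> x)) = 0"
      using eq[OF \<xi>] 1 by (simp add: algebra_simps)
    then show ?thesis using \<nu> by simp
  qed
  \<comment> \<open>The right-hand side of the Poisson equation into which the Hamilton-Jacobi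
    equation turns when it is solved for \<Delta>u.\<close>
  define G where "G x = (Ham (grad u x) + lam - F x) / \<nu>" for x
  have cG: "continuous_on \<Omega> G" unfolding G_def using \<nu> by (intro continuous_intros continuous_on_Ham cu cF) auto
  have weak2: "(LINT x:\<Omega>|lborel. grad u x \<bullet> grad \<xi> x) = - (LINT x:\<Omega>|lborel. G x * \<xi> x)" if \<xi>: "test_fun \<Omega> \<xi>" for \<xi>
  proof -
    obtain K where K: "compact K" "K \<subseteq> \<Omega>" "\<And>x. x \<notin> K \<Longrightarrow> \<xi> x = 0"
      by (rule test_fun_support[OF \<xi>], rule that)
    have \<xi>C: "C1_on \<Omega> \<xi>" by (rule test_fun_C1_on[OF \<xi>])
    have c_pos\<xi>: "continuous_on \<Omega> \<xi>" "continuous_on \<Omega> (grad \<xi>)" using C1_on_continuous_on[OF \<xi>C] continuous_on_grad[OF \<xi>C] .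
    have p\<xi>0: "grad \<xi> x = 0" if "x \<in> \<Omega> - K" for x
      using partial_zero_outside[OF \<Omega>(1) K(1) _ that, of \<xi>] K(3) by (auto simp: vec_eq_iff)
    \<comment> \<open>The factor \<phi>^(1-r) cancels the weight of the divergence equation, and its
      own gradient contributes H(Du)/\<nu>.\<close>
    define \<zeta> where "\<zeta> x = A' x * \<xi> x" for x
    have \<zeta>C: "C1_on \<Omega> \<zeta>" unfolding \<zeta>_def[abs_def] by (rule C1_on_mult(1)[OF A'C \<xi>C])
    have "(LINT x:\<Omega>|lborel. (A x *\<^sub>R grad u x) \<bullet> grad \<zeta> x) = - (LINT x:\<Omega>|lborel. ((lam - F x) / \<nu> * A x) * \<zeta> x)"
    proof (rule weak_divergence_C1c[OF \<Omega>(1) _ _ weak1 \<zeta>C K(1,2)])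
      show "continuous_on \<Omega> (\<lambda>x. A x *\<^sub>R grad u x)" by (intro continuous_intros cA cu)
      show "continuous_on \<Omega> (\<lambda>x. (lam - F x) / \<nu> * A x)" using \<nu> by (intro continuous_intros cA cF) auto
      show "\<zeta> x = 0" if "x \<in> \<Omega> - K" for x using K(3) that by (simp add: \<zeta>_def)
    qed
    also have "(LINT x:\<Omega>|lborel. ((lam - F x) / \<nu> * A x) * \<zeta> x) = (LINT x:\<Omega>|lborel. (lam - F x) / \<nu> * \<xi> x)"
    proof (rule set_lebesgue_integral_cong)
      show "\<forall>x. x \<in> \<Omega> \<longrightarrow> ((lam - F x) / \<nu> * A x) * \<zeta> x = (lam - F x) / \<nu> * \<xi> x"
      proof (intro allI impI)
        fix x assume "x \<in> \<Omega>"
        have "((lam - F x) / \<nu> * A x) * \<zeta> x = (lam - F x) / \<nu> * \<xi> x * (A x * A' x)" by (simp add: \<zeta>_def)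
        then show "((lam - F x) / \<nu> * A x) * \<zeta> x = (lam - F x) / \<nu> * \<xi> x" using AA'[OF \<open>x \<in> \<Omega>\<close>] by simp
      qed
    qed (use \<Omega> in auto)
    also have "(LINT x:\<Omega>|lborel. (A x *\<^sub>R grad u x) \<bullet> grad \<zeta> x) = (LINT x:\<Omega>|lborel. grad u x \<bullet> grad \<xi> x + Ham (grad u x) / \<nu> * \<xi> x)"
    proof (rule set_lebesgue_integral_cong)
      show "\<forall>x. x \<in> \<Omega> \<longrightarrow> (A x *\<^sub>R grad u x) \<bullet> grad \<zeta> x = grad u x \<bullet> grad \<xi> x + Ham (grad u x) / \<nu> * \<xi> x"
      proof (intro allI impI)
        fix x assume x: "x \<in> \<Omega>"
        have "grad \<zeta> x = A' x *\<^sub>R grad \<xi> x + \<xi> x *\<^sub>R grad A' x"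
          unfolding \<zeta>_def[abs_def] by (rule C1_on_mult(2)[OF A'C \<xi>C x])
        then have "(A x *\<^sub>R grad u x) \<bullet> grad \<zeta> x = (A x * A' x) * (grad u x \<bullet> grad \<xi> x) + \<xi> x * A x * (grad u x \<bullet> grad A' x)"
          by (simp add: inner_add_right algebra_simps)
        also have "grad u x \<bullet> grad A' x = A' x * Ham (grad u x) / \<nu>"
          using inner_grad_powr(2)[OF \<Phi>C \<Phi>0 \<Phi>g x] \<nu> unfolding A'_def[abs_def] by (simp add: field_simps)
        also have "\<xi> x * A x * (A' x * Ham (grad u x) / \<nu>) = (A x * A' x) * (Ham (grad u x) / \<nu> * \<xi> x)" by simp
        finally show "(A x *\<^sub>R grad u x) \<bullet> grad \<zeta> x = grad u x \<bullet> grad \<xi> x + Ham (grad u x) / \<nu> * \<xi> x"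
          by (simp add: AA'[OF x])
      qed
    qed (use \<Omega> in auto)
    also have "\<dots> = (LINT x:\<Omega>|lborel. grad u x \<bullet> grad \<xi> x) + (LINT x:\<Omega>|lborel. Ham (grad u x) / \<nu> * \<xi> x)"
    proof (intro set_integral_add set_integrable_continuous_compact_support[OF \<Omega>(1) K(1,2)])
      show "continuous_on \<Omega> (\<lambda>x. grad u x \<bullet> grad \<xi> x)" by (intro continuous_intros cu c_pos\<xi>)
      show "continuous_on \<Omega> (\<lambda>x. Ham (grad u x) / \<nu> * \<xi> x)"
        using \<nu> by (intro continuous_intros continuous_on_Ham cu c_pos\<xi>) auto
    qed (use p\<xi>0 K(3) in auto)
    finally have "(LINT x:\<Omega>|lborel. grad u x \<bullet> grad \<xi> x) = - ((LINT x:\<Omega>|lborel. (lam - F x) / \<nu> * \<xi> x) + (LINT x:\<Omega>|lborel. Ham (grad u x) / \<nu> * \<xi> x))"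
      by simp
    also have "(LINT x:\<Omega>|lborel. (lam - F x) / \<nu> * \<xi> x) + (LINT x:\<Omega>|lborel. Ham (grad u x) / \<nu> * \<xi> x)
      = (LINT x:\<Omega>|lborel. (lam - F x) / \<nu> * \<xi> x + Ham (grad u x) / \<nu> * \<xi> x)"
    proof (intro set_integral_add(2)[symmetric] set_integrable_continuous_compact_support[OF \<Omega>(1) K(1,2)])
      show "continuous_on \<Omega> (\<lambda>x. (lam - F x) / \<nu> * \<xi> x)" using \<nu> by (intro continuous_intros cF c_pos\<xi>) auto
      show "continuous_on \<Omega> (\<lambda>x. Ham (grad u x) / \<nu> * \<xi> x)"
        using \<nu> by (intro continuous_intros continuous_on_Ham cu c_pos\<xi>) auto
    qed (use K(3) in auto)
    also have "\<dots> = (LINT x:\<Omega>|lborel. G x * \<xi> x)"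
      by (simp add: G_def add_divide_distrib diff_divide_distrib algebra_simps)
    finally show ?thesis .
  qed
  have lip: "\<exists>R>0. \<exists>L\<ge>0. \<forall>x\<in>ball x0 R. \<forall>y\<in>ball x0 R. \<bar>G x - G y\<bar> \<le> L * (norm (x - y) + norm (grad u x - grad u y))"
    if x0: "x0 \<in> \<Omega>" for x0
  proof -
    obtain R1 L1 where F1: "R1 > 0" "L1 \<ge> 0" "\<And>x y. x\<in>ball x0 R1 \<Longrightarrow> y\<in>ball x0 R1 \<Longrightarrow> \<bar>F x - F y\<bar> \<le> L1 * norm (x - y)"
      using C1_on_locally_Lipschitz[OF \<Omega>(1) FC x0] by blast
    obtain R2 where R2: "R2 > 0" "cball x0 R2 \<subseteq> \<Omega>" using \<Omega>(1) x0 open_contains_cball by blast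
    obtain P where P: "\<And>x. x \<in> cball x0 R2 \<Longrightarrow> norm (grad u x) \<le> P"
      using compact_imp_bounded[OF compact_continuous_image[OF continuous_on_subset[OF cu R2(2)] compact_cball]]
      by (metis bounded_iff imageI)
    \<comment> \<open>On a small ball |Du| \<le> P, and s \<mapsto> s^r' has Lipschitz constant r'
      P^(r'-1) on [0,P]; the factor in front is that of H.\<close>
    define L2 where "L2 = h\<^sub>0 / r' * (r' * P powr (r' - 1))"
    have L2: "L2 \<ge> 0" using h0 r' by (simp add: L2_def)
    have H: "\<bar>Ham (grad u x) - Ham (grad u y)\<bar> \<le> L2 * norm (grad u x - grad u y)" if "x \<in> ball x0 R2" "y \<in> ball x0 R2" for x y
    proof -
      have "\<bar>norm (grad u x) powr r' - norm (grad u y) powr r'\<bar> \<le> r' * P powr (r' - 1) * \<bar>norm (grad u x) - norm (grad u y)\<bar>"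
        by (rule powr_Lipschitz) (use P that r' in auto)
      also have "\<dots> \<le> r' * P powr (r' - 1) * norm (grad u x - grad u y)"
        using r' norm_triangle_ineq3 by (intro mult_left_mono) auto
      finally have "h\<^sub>0 / r' * \<bar>norm (grad u x) powr r' - norm (grad u y) powr r'\<bar> \<le> h\<^sub>0 / r' * (r' * P powr (r' - 1) * norm (grad u x - grad u y))"
        using h0 r' by (intro mult_left_mono) auto
      moreover have "\<bar>Ham (grad u x) - Ham (grad u y)\<bar> = h\<^sub>0 / r' * \<bar>norm (grad u x) powr r' - norm (grad u y) powr r'\<bar>"
        unfolding Ham_def right_diff_distrib[symmetric] abs_mult using h0 r' by simp
      ultimately show ?thesis by (simp only: L2_def mult.assoc)
    qed
    define L where "L = (L1 + L2) / \<nu>"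
    have "\<bar>G x - G y\<bar> \<le> L * (norm (x - y) + norm (grad u x - grad u y))" if "x\<in>ball x0 (min R1 R2)" "y\<in>ball x0 (min R1 R2)" for x y
    proof -
      have "G x - G y = ((Ham (grad u x) - Ham (grad u y)) - (F x - F y)) / \<nu>"
        by (simp add: G_def diff_divide_distrib add_divide_distrib)
      then have "\<bar>G x - G y\<bar> = \<bar>(Ham (grad u x) - Ham (grad u y)) - (F x - F y)\<bar> / \<nu>" using \<nu> by simp
      also have "\<dots> \<le> (L2 * norm (grad u x - grad u y) + L1 * norm (x - y)) / \<nu>"
        using \<nu> H[of x y] F1(3)[of x y] that by (intro divide_right_mono) auto
      also have "\<dots> \<le> ((L1 + L2) * (norm (x - y) + norm (grad u x - grad u y))) / \<nu>"
        using \<nu> F1(2) L2 by (intro divide_right_mono) (auto simp: algebra_simps)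
      finally show ?thesis by (simp add: L_def)
    qed
    moreover have "L \<ge> 0" "min R1 R2 > 0" using F1 L2 R2 \<nu> by (auto simp: L_def)
    ultimately show ?thesis by blast
  qed
  have reg: "C2_on \<Omega> u" "\<And>x. x \<in> \<Omega> \<Longrightarrow> laplacian u x = G x"
    using poisson_regularity[OF \<Omega>(1) u cG weak2 lip] by blast+
  have gm: "grad m x = - (r * m x) *\<^sub>R (c *\<^sub>R flux (grad u x))" if x: "x \<in> \<Omega>" for x
    unfolding m_def[abs_def] by (rule C1_on_powr(2)[OF \<Phi>C \<Phi>0 x]) (use \<Phi>g[OF x] in auto)
  have aem: "AE x in lborel. x \<in> \<Omega> \<longrightarrow> m x = \<phi> x powr r"
    using ae by eventually_elim (simp add: m_def)
  have "mfg_solution \<Omega> \<nu> Ham (\<lambda>p. h\<^sub>0 *\<^sub>R flux p) f u m lam"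
    unfolding mfg_solution_def
  proof (intro conjI exI[of _ "grad m"] allI impI ballI)
    show "C2_on \<Omega> u" by (rule reg(1))
    have "(LINT x:\<Omega>|lborel. m x) = (LINT x:\<Omega>|lborel. \<phi> x powr r)"
      by (rule set_integral_cong_AE_on[OF set_borel_measurable_continuous[OF \<Omega>(1) cm] set_borel_measurable_powr[OF m\<phi>] aem])
    then show "(LINT x:\<Omega>|lborel. m x) = 1" using int1 by simp
    show "m x \<ge> 0" for x by (simp add: m_def)
    show "- \<nu> * laplacian u x + Ham (grad u x) + lam = f x (m x)" if "x \<in> \<Omega>" for x
      using reg(2)[OF that] \<nu> by (simp add: G_def F_def)
    show "W1p_grad \<Omega> 2 m (grad m)"
      by (rule W1p_grad_C1[OF \<Omega>(1) mC _ set_borel_measurable_continuous[OF \<Omega>(1) cm]]) auto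
    fix \<xi> assume "test_fun \<Omega> \<xi>"
    \<comment> \<open>The vector field \<nu> Dm + m DH(Du) vanishes at every point because \<nu> r c
      = \<open>h\<^sub>0\<close>, so the weak equation for m holds with cancelling
      integrands.\<close>
    have "(LINT x:\<Omega>|lborel. m x * (h\<^sub>0 *\<^sub>R flux (grad u x) \<bullet> grad \<xi> x)) = (LINT x:\<Omega>|lborel. - \<nu> * (grad m x \<bullet> grad \<xi> x))"
    proof (rule set_lebesgue_integral_cong)
      show "\<forall>x. x \<in> \<Omega> \<longrightarrow> m x * (h\<^sub>0 *\<^sub>R flux (grad u x) \<bullet> grad \<xi> x) = - \<nu> * (grad m x \<bullet> grad \<xi> x)"
      proof (intro allI impI)
        fix x assume x: "x \<in> \<Omega>"
        have "- \<nu> * (grad m x \<bullet> grad \<xi> x) = (\<nu> * r * c) * (m x * (flux (grad u x) \<bullet> grad \<xi> x))"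
          by (simp add: gm[OF x])
        then show "m x * (h\<^sub>0 *\<^sub>R flux (grad u x) \<bullet> grad \<xi> x) = - \<nu> * (grad m x \<bullet> grad \<xi> x)"
          unfolding \<nu>_c(1) by simp
      qed
    qed (use \<Omega> in auto)
    also have "\<dots> = - \<nu> * (LINT x:\<Omega>|lborel. grad m x \<bullet> grad \<xi> x)" by (rule set_integral_mult_right)
    finally show "\<nu> * (LINT x:\<Omega>|lborel. grad m x \<bullet> grad \<xi> x) + (LINT x:\<Omega>|lborel. m x * (h\<^sub>0 *\<^sub>R flux (grad u x) \<bullet> grad \<xi> x)) = 0"
      by simp
  qed
  with aem show ?thesis by blast
qed

end

theorem theorem1:
  fixes \<Omega> :: "(real^'n::finite) set"
    and \<nu> h\<^sub>0 r' r \<mu> :: real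
    and f :: "real^'n \<Rightarrow> real \<Rightarrow> real"
    and H :: "real^'n \<Rightarrow> real"
    and DH :: "real^'n \<Rightarrow> real^'n"
  assumes "open \<Omega>" and "connected \<Omega>" and "\<Omega> \<noteq> {}"
    and "\<nu> > 0"
    and "C1_halfline \<Omega> f"
    and "h\<^sub>0 > 0" and "r' > 1"
    and "r = r' / (r' - 1)"
    and "H = (\<lambda>p. h\<^sub>0 / r' * norm p powr r')"
    and "DH = (\<lambda>p. (h\<^sub>0 * norm p powr (r' - 2)) *\<^sub>R p)"
    and "\<mu> = \<nu> * (\<nu> * r / h\<^sub>0) powr (r - 1)"
  shows
    "(\<forall>u m lam. mfg_solution \<Omega> \<nu> H DH f u m lam \<and>
        (\<exists>g. weak_grad \<Omega> m g \<and>
           (AE x in lborel. x \<in> \<Omega> \<longrightarrow>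
              \<nu> *\<^sub>R g x + (h\<^sub>0 * m x * norm (grad u x) powr (r' - 2)) *\<^sub>R grad u x = 0))
      \<longrightarrow> rlap_solution \<Omega> \<mu> r f (\<lambda>x. m x powr (1 / r)) lam)
   \<and>
    (\<forall>\<phi> lam u. rlap_solution \<Omega> \<mu> r f \<phi> lam \<and> C1_on \<Omega> u \<and>
        (\<exists>g. weak_grad \<Omega> \<phi> g \<and>
           (AE x in lborel. x \<in> \<Omega> \<longrightarrow>
              (h\<^sub>0 * \<phi> x * norm (grad u x) powr (r' - 2)) *\<^sub>R grad u x + (\<nu> * r) *\<^sub>R g x = 0))
      \<longrightarrow> (\<exists>m. (AE x in lborel. x \<in> \<Omega> \<longrightarrow> m x = \<phi> x powr r) \<and>
               mfg_solution \<Omega> \<nu> H DH f u m lam))"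
proof -
  interpret hopf_cole \<nu> h\<^sub>0 r' r \<mu> by unfold_locales (use assms in auto)
  have H: "H = Ham" using assms(9) by (simp add: Ham_def fun_eq_iff)
  have DH: "DH = (\<lambda>p. h\<^sub>0 *\<^sub>R flux p)" using assms(10) by (simp add: flux_def)
  have flux: "(h\<^sub>0 * a * norm p powr (r' - 2)) *\<^sub>R p = (h\<^sub>0 * a) *\<^sub>R flux p" for a and p :: "real^'n"
    by (simp add: flux_def)
  show ?thesis unfolding H DH flux
    using mfg_imp_rlap[OF assms(1,2)] rlap_imp_mfg[OF assms(1,2,5)] by blast
qed

end
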